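(* Let $k$ be a field of characteristic zero and let $m,n$ be integers with $2\le m\le n^2-2$ and $n\ge 3$. Then the fixed ring $\mathrm{UD}(m,n)^{\mathrm{GL}_m}$ of the natural $\mathrm{GL}_m$-action on the universal division algebra $\mathrm{UD}(m,n)$ of $m$ generic $n\times n$-matrices over $k$ is a division algebra of degree $n$.
   Context: Let $G_{m,n}$ be the $k$-subalgebra of $\mathrm{M}_n(k[x_{ij}^{(h)}])$ generated by the generic matrices $X_h=(x_{ij}^{(h)})$, $h=1,\dots,m$, where the $x_{ij}^{(h)}$ are $mn^2$ independent commuting variables. $G_{m,n}$ is a domain of PI-degree $n$; its division algebra of quotients is $\mathrm{UD}(m,n)$, the universal division algebra of $m$ generic $n\times n$-matrices. The group $\mathrm{GL}_m$ acts on $G_{m,n}$ by $k$-algebra automorphisms via $g=(g_{ij})\colon X_j\mapsto\sum_{i=1}^m g_{ij}X_i$, and this action extends to $\mathrm{UD}(m,n)$. The degree of a division algebra (finite-dimensional over its center) is the square root of its dimension over its center. *)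

theory Defs
  imports
    Complex_Main
    "HOL-Library.Poly_Mapping"
    "HOL-Library.Product_Lexorder"
    "HOL-Computational_Algebra.Polynomial_Factorial"
    "HOL-Algebra.Embedded_Algebras"
    "Jordan_Normal_Form.Matrix"
begin

section \<open>Polynomials in the entries of the generic matrices\<close>

text \<open>
  The triple \<open>(h, i, j)\<close> stands for the variable $x_{ij}^{(h)}$; all indices start at \<open>0\<close>.
  Polynomials are finitely supported functions from monomials (exponent functions) to
  coefficients.  The type contains variables for all triples of natural numbers; only those with
  \<open>h < m\<close> and \<open>i, j < n\<close> occur in the algebras defined below.  The lexicographic order on triples
  only serves to obtain the \<^class>\<open>idom\<close> instance and hence the field of fractions.
\<close>

type_synonym gvar = "nat \<times> nat \<times> nat"
type_synonym 'k gpoly = "(gvar \<Rightarrow>\<^sub>0 nat) \<Rightarrow>\<^sub>0 'k"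

definition gconst :: "'k::field \<Rightarrow> 'k gpoly" where
  "gconst c = Poly_Mapping.single 0 c"

definition gvar :: "gvar \<Rightarrow> 'k::field gpoly" where
  "gvar v = Poly_Mapping.single (Poly_Mapping.single v 1) 1"

definition gmonom_eval :: "(gvar \<Rightarrow> 'k::field gpoly) \<Rightarrow> (gvar \<Rightarrow>\<^sub>0 nat) \<Rightarrow> 'k gpoly" where
  "gmonom_eval f a = (\<Prod>v\<in>Poly_Mapping.keys a. f v ^ Poly_Mapping.lookup a v)"

definition gsubst :: "(gvar \<Rightarrow> 'k::field gpoly) \<Rightarrow> 'k gpoly \<Rightarrow> 'k gpoly" where
  "gsubst f p = (\<Sum>a\<in>Poly_Mapping.keys p. gconst (Poly_Mapping.lookup p a) * gmonom_eval f a)"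


section \<open>Generic matrices and the universal division algebra\<close>

definition generic_mat :: "nat \<Rightarrow> nat \<Rightarrow> 'k::field gpoly mat" where
  "generic_mat n h = mat n n (\<lambda>(i, j). gvar (h, i, j))"

inductive_set generic_mat_algebra :: "nat \<Rightarrow> nat \<Rightarrow> 'k::field gpoly mat set"
  for m n :: nat where
  scalar: "gconst c \<cdot>\<^sub>m 1\<^sub>m n \<in> generic_mat_algebra m n"
| generic: "h < m \<Longrightarrow> generic_mat n h \<in> generic_mat_algebra m n"
| add: "A \<in> generic_mat_algebra m n \<Longrightarrow> B \<in> generic_mat_algebra m n \<Longrightarrow>
    A + B \<in> generic_mat_algebra m n"
| mult: "A \<in> generic_mat_algebra m n \<Longrightarrow> B \<in> generic_mat_algebra m n \<Longrightarrow>
    A * B \<in> generic_mat_algebra m n"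

abbreviation frac_mat_ring :: "'k::field itself \<Rightarrow> nat \<Rightarrow> 'k gpoly fract mat ring" where
  "frac_mat_ring _ n \<equiv> ring_mat TYPE('k gpoly fract) n ()"

text \<open>
  The division algebra of quotients of the domain $G_{m,n}$, realised inside the matrices over the
  field of rational functions, where every nonzero element of $G_{m,n}$ is invertible: its elements
  are the right fractions $A B^{-1}$.
\<close>

definition UD :: "'k::field itself \<Rightarrow> nat \<Rightarrow> nat \<Rightarrow> 'k gpoly fract mat ring" where
  "UD ty m n = (frac_mat_ring ty n) \<lparr> carrier :=
     {map_mat to_fract A \<otimes>\<^bsub>frac_mat_ring ty n\<^esub> inv\<^bsub>frac_mat_ring ty n\<^esub> (map_mat to_fract B) | A B.
        A \<in> generic_mat_algebra m n \<and> B \<in> generic_mat_algebra m n \<and> B \<noteq> 0\<^sub>m n n} \<rparr>"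

definition base_scalars :: "'k::field itself \<Rightarrow> nat \<Rightarrow> 'k gpoly fract mat set" where
  "base_scalars _ n = range (\<lambda>c::'k. to_fract (gconst c) \<cdot>\<^sub>m 1\<^sub>m n)"


section \<open>The action of the general linear group\<close>

definition GL_mats :: "nat \<Rightarrow> 'k::field mat set" where
  "GL_mats m = {g \<in> carrier_mat m m. invertible_mat g}"

text \<open>
  The assignment $X_j \mapsto \sum_i g_{ij} X_i$ is, entry by entry, the linear substitution
  $x_{ab}^{(j)} \mapsto \sum_i g_{ij} x_{ab}^{(i)}$.  It is extended to rational functions by
  $p / q \mapsto p^g / q^g$ (see \<open>gl_fract_Fract\<close> for well-definedness) and then entrywise to matrices.
\<close>

definition gl_var :: "nat \<Rightarrow> 'k::field mat \<Rightarrow> gvar \<Rightarrow> 'k gpoly" where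
  "gl_var m g = (\<lambda>(j, a, b).
     if j < m then (\<Sum>i<m. gconst (g $$ (i, j)) * gvar (i, a, b)) else gvar (j, a, b))"

definition gl_poly :: "nat \<Rightarrow> 'k::field mat \<Rightarrow> 'k gpoly \<Rightarrow> 'k gpoly" where
  "gl_poly m g = gsubst (gl_var m g)"

definition gl_fract :: "nat \<Rightarrow> 'k::field mat \<Rightarrow> 'k gpoly fract \<Rightarrow> 'k gpoly fract" where
  "gl_fract m g r =
     (THE s. \<exists>p q. q \<noteq> 0 \<and> r = Fract p q \<and> s = Fract (gl_poly m g p) (gl_poly m g q))"

definition gl_act :: "nat \<Rightarrow> 'k::field mat \<Rightarrow> 'k gpoly fract mat \<Rightarrow> 'k gpoly fract mat" where
  "gl_act m g = map_mat (gl_fract m g)"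

definition UD_fixed :: "'k::field itself \<Rightarrow> nat \<Rightarrow> nat \<Rightarrow> 'k gpoly fract mat ring" where
  "UD_fixed ty m n = (UD ty m n) \<lparr> carrier :=
     {a \<in> carrier (UD ty m n). \<forall>g \<in> (GL_mats m :: 'k mat set). gl_act m g a = a} \<rparr>"


section \<open>Division algebras and their degree\<close>

definition ring_center :: "('a, 'b) ring_scheme \<Rightarrow> 'a set" where
  "ring_center R = {z \<in> carrier R. \<forall>a \<in> carrier R. z \<otimes>\<^bsub>R\<^esub> a = a \<otimes>\<^bsub>R\<^esub> z}"

definition division_algebra :: "'a set \<Rightarrow> ('a, 'b) ring_scheme \<Rightarrow> bool" where
  "division_algebra K R \<longleftrightarrow>
     ring R \<and> \<one>\<^bsub>R\<^esub> \<noteq> \<zero>\<^bsub>R\<^esub> \<and> Units R = carrier R - {\<zero>\<^bsub>R\<^esub>} \<and>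
     subfield K R \<and> K \<subseteq> ring_center R"

definition centrally_finite :: "('a, 'b) ring_scheme \<Rightarrow> bool" where
  "centrally_finite R \<longleftrightarrow> ring.finite_dimension R (ring_center R) (carrier R)"

definition division_degree :: "('a, 'b) ring_scheme \<Rightarrow> real" where
  "division_degree R = sqrt (real (ring.dim R (ring_center R) (carrier R)))"


section \<open>Well-definedness of the action\<close>

lemma gmonom_eval_superset:
  assumes "finite S" "Poly_Mapping.keys a \<subseteq> S"
  shows "gmonom_eval f a = (\<Prod>v\<in>S. f v ^ Poly_Mapping.lookup a v)"
  unfolding gmonom_eval_def using assms
  by (intro prod.mono_neutral_left) (auto simp: in_keys_iff)

lemma gmonom_eval_0 [simp]: "gmonom_eval f 0 = 1"
  by (simp add: gmonom_eval_def)

lemma gmonom_eval_add: "gmonom_eval f (a + b) = gmonom_eval f a * gmonom_eval f b"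
proof -
  let ?S = "Poly_Mapping.keys a \<union> Poly_Mapping.keys b"
  have "gmonom_eval f (a + b) = (\<Prod>v\<in>?S. f v ^ Poly_Mapping.lookup (a + b) v)"
    by (intro gmonom_eval_superset) (simp_all add: keys_add)
  also have "\<dots> = gmonom_eval f a * gmonom_eval f b"
    by (simp add: lookup_add power_add prod.distrib gmonom_eval_superset[of ?S])
  finally show ?thesis .
qed

lemma gconst_simps [simp]:
  "gconst 0 = 0" "gconst 1 = 1" "gconst (c + d) = gconst c + gconst d"
  "gconst (c * d) = gconst c * gconst d"
  by (simp_all add: gconst_def single_add mult_single)

lemma gconst_sum: "gconst (sum f S) = (\<Sum>x\<in>S. gconst (f x))"
  by (induction S rule: infinite_finite_induct) auto

lemma gsubst_superset:
  assumes "finite S" "Poly_Mapping.keys p \<subseteq> S"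
  shows "gsubst f p = (\<Sum>a\<in>S. gconst (Poly_Mapping.lookup p a) * gmonom_eval f a)"
  unfolding gsubst_def using assms
  by (intro sum.mono_neutral_left) (auto simp: in_keys_iff)

lemma gsubst_0 [simp]: "gsubst f 0 = 0"
  by (simp add: gsubst_def)

lemma gsubst_add [simp]: "gsubst f (p + q) = gsubst f p + gsubst f q"
proof -
  let ?S = "Poly_Mapping.keys p \<union> Poly_Mapping.keys q"
  have "gsubst f (p + q) =
      (\<Sum>a\<in>?S. gconst (Poly_Mapping.lookup (p + q) a) * gmonom_eval f a)"
    by (intro gsubst_superset) (simp_all add: keys_add)
  also have "\<dots> = gsubst f p + gsubst f q"
    by (simp add: lookup_add algebra_simps sum.distrib gsubst_superset[of ?S])
  finally show ?thesis .
qed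

lemma gsubst_sum: "gsubst f (sum p S) = (\<Sum>x\<in>S. gsubst f (p x))"
  by (induction S rule: infinite_finite_induct) auto

lemma gsubst_single: "gsubst f (Poly_Mapping.single a c) = gconst c * gmonom_eval f a"
  by (simp add: gsubst_def)

lemma gpoly_sum_single:
  "(\<Sum>a\<in>Poly_Mapping.keys p. Poly_Mapping.single a (Poly_Mapping.lookup p a)) = p"
  by (rule poly_mapping_eqI) (auto simp: lookup_sum lookup_single when_def in_keys_iff)

lemma gsubst_mult [simp]: "gsubst f (p * q) = gsubst f p * gsubst f q"
proof -
  let ?P = "Poly_Mapping.keys p" and ?Q = "Poly_Mapping.keys q"
  have "gsubst f (p * q) = gsubst f
      ((\<Sum>a\<in>?P. Poly_Mapping.single a (Poly_Mapping.lookup p a)) *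
       (\<Sum>b\<in>?Q. Poly_Mapping.single b (Poly_Mapping.lookup q b)))"
    by (simp only: gpoly_sum_single)
  also have "\<dots> = gsubst f p * gsubst f q"
    by (simp add: sum_product gsubst_sum mult_single gsubst_single gmonom_eval_add
        gsubst_def[of f p] gsubst_def[of f q] mult_ac)
  finally show ?thesis .
qed

lemma gsubst_gconst [simp]: "gsubst f (gconst c) = gconst c"
  unfolding gconst_def[of c] gsubst_single by (simp add: gconst_def)

lemma gsubst_1 [simp]: "gsubst f 1 = 1"
  using gsubst_gconst[of f 1] by simp

lemma gsubst_gvar [simp]: "gsubst f (gvar v) = f v"
  by (simp add: gvar_def gsubst_single gmonom_eval_def)

lemma gsubst_power: "gsubst f (p ^ k) = gsubst f p ^ k"
  by (induction k) auto

lemma gsubst_prod: "gsubst f (prod p S) = (\<Prod>x\<in>S. gsubst f (p x))"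
  by (induction S rule: infinite_finite_induct) auto

lemma gsubst_gsubst: "gsubst f (gsubst f' p) = gsubst (\<lambda>v. gsubst f (f' v)) p"
  by (simp add: gsubst_def[of f' p] gsubst_def[of _ p] gsubst_sum gmonom_eval_def
      gsubst_prod gsubst_power)

lemma gvar_power: "gvar v ^ k = Poly_Mapping.single (Poly_Mapping.single v k) 1"
  by (induction k) (auto simp: gvar_def mult_single simp flip: single_add)

lemma prod_single_one:
  "(\<Prod>v\<in>S. Poly_Mapping.single (e v) 1 :: 'k::field gpoly) = Poly_Mapping.single (sum e S) 1"
  by (induction S rule: infinite_finite_induct) (auto simp: mult_single)

lemma gmonom_eval_gvar: "gmonom_eval gvar a = Poly_Mapping.single a (1::'k::field)"
proof -
  have "(\<Sum>v\<in>Poly_Mapping.keys a. Poly_Mapping.single v (Poly_Mapping.lookup a v)) = a"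
    by (rule poly_mapping_eqI) (auto simp: lookup_sum lookup_single when_def in_keys_iff)
  then show ?thesis
    by (simp add: gmonom_eval_def gvar_power prod_single_one)
qed

lemma gsubst_gvar_id [simp]: "gsubst gvar p = p"
  by (simp add: gsubst_def gmonom_eval_gvar gconst_def mult_single gpoly_sum_single)

lemma gl_poly_mult:
  assumes "g \<in> carrier_mat m m" "h \<in> carrier_mat m m"
  shows "gl_poly m (g * h) p = gl_poly m g (gl_poly m h p)"
proof -
  have "gl_var m (g * h) v = gsubst (gl_var m g) (gl_var m h v)" for v
  proof (cases v)
    case (fields j a b)
    show ?thesis
    proof (cases "j < m")
      case True
      have "gl_var m (g * h) v =
          (\<Sum>i<m. \<Sum>l<m. gconst (g $$ (i, l)) * gconst (h $$ (l, j)) * gvar (i, a, b))"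
        using True assms fields
        by (auto simp: gl_var_def scalar_prod_def gconst_sum sum_distrib_right atLeast0LessThan
            intro!: sum.cong)
      also have "\<dots> =
          (\<Sum>l<m. \<Sum>i<m. gconst (g $$ (i, l)) * gconst (h $$ (l, j)) * gvar (i, a, b))"
        by (rule sum.swap)
      also have "\<dots> = gsubst (gl_var m g) (gl_var m h v)"
        using True fields
        by (auto simp: gl_var_def gsubst_sum sum_distrib_left mult_ac intro!: sum.cong)
      finally show ?thesis .
    qed (simp add: fields gl_var_def)
  qed
  then have "gl_var m (g * h) = (\<lambda>v. gsubst (gl_var m g) (gl_var m h v))" ..
  then show ?thesis
    by (simp add: gl_poly_def gsubst_gsubst)
qed

lemma gl_poly_one [simp]: "gl_poly m (1\<^sub>m m) p = (p :: 'k::field gpoly)"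
proof -
  have "gl_var m (1\<^sub>m m) v = (gvar v :: 'k gpoly)" for v
    by (cases v) (auto simp: gl_var_def if_distrib[of gconst] if_distrib[of "\<lambda>x. x * _"] sum.delta
        cong: if_cong)
  then have "gl_var m (1\<^sub>m m) = (gvar :: _ \<Rightarrow> 'k gpoly)" ..
  then show ?thesis by (simp add: gl_poly_def)
qed

lemma gl_poly_eq_0_iff:
  assumes "g \<in> GL_mats m"
  shows "gl_poly m g p = 0 \<longleftrightarrow> p = 0"
proof
  assume *: "gl_poly m g p = 0"
  from assms obtain h where h: "g * h = 1\<^sub>m m" "h * g = 1\<^sub>m (dim_row h)"
    by (auto simp: GL_mats_def invertible_mat_def inverts_mat_def)
  have g: "g \<in> carrier_mat m m" using assms by (simp add: GL_mats_def)
  have "dim_col (g * h) = m" "dim_col (h * g) = dim_row h" by (simp_all add: h)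
  with g have hc: "h \<in> carrier_mat m m" by auto
  have "p = gl_poly m (h * g) p" using h hc by simp
  also have "\<dots> = gl_poly m h (gl_poly m g p)" by (rule gl_poly_mult[OF hc g])
  also have "\<dots> = 0" unfolding * by (simp add: gl_poly_def)
  finally show "p = 0" .
qed (simp add: gl_poly_def)

lemma gl_fract_Fract:
  assumes g: "g \<in> GL_mats m" and q: "q \<noteq> 0"
  shows "gl_fract m g (Fract p q) = Fract (gl_poly m g p) (gl_poly m g q)"
  unfolding gl_fract_def
proof (rule the_equality)
  fix s
  assume "\<exists>p' q'. q' \<noteq> 0 \<and> Fract p q = Fract p' q' \<and> s = Fract (gl_poly m g p') (gl_poly m g q')"
  then obtain p' q' where *: "q' \<noteq> 0" "Fract p q = Fract p' q'"
    "s = Fract (gl_poly m g p') (gl_poly m g q')" by blast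
  then have "p * q' = p' * q" using q by (simp add: eq_fract)
  then have "gl_poly m g (p * q') = gl_poly m g (p' * q)" by simp
  then show "s = Fract (gl_poly m g p) (gl_poly m g q)"
    using * q gl_poly_eq_0_iff[OF g] by (simp add: eq_fract gl_poly_def)
qed (use q in blast)

lemma gl_fract_add:
  assumes "g \<in> GL_mats m"
  shows "gl_fract m g (r + s) = gl_fract m g r + gl_fract m g s"
  using assms gl_poly_eq_0_iff[OF assms]
  by (cases r; cases s) (simp add: gl_fract_Fract, simp add: gl_poly_def)

lemma gl_fract_mult:
  assumes "g \<in> GL_mats m"
  shows "gl_fract m g (r * s) = gl_fract m g r * gl_fract m g s"
  using assms gl_poly_eq_0_iff[OF assms]
  by (cases r; cases s) (simp add: gl_fract_Fract, simp add: gl_poly_def)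

lemma gl_fract_to_fract:
  assumes "g \<in> GL_mats m"
  shows "gl_fract m g (to_fract p) = to_fract (gl_poly m g p)"
  using gl_fract_Fract[OF assms, of 1 p] by (simp add: to_fract_def gl_poly_def)

lemma gl_fract_sum:
  assumes "g \<in> GL_mats m"
  shows "gl_fract m g (sum f S) = (\<Sum>x\<in>S. gl_fract m g (f x))"
  using gl_fract_to_fract[OF assms, of 0]
  by (induction S rule: infinite_finite_induct) (auto simp: gl_fract_add[OF assms] gl_poly_def)

lemma gl_act_add:
  assumes "g \<in> GL_mats m" "A \<in> carrier_mat n n" "B \<in> carrier_mat n n"
  shows "gl_act m g (A + B) = gl_act m g A + gl_act m g B"
  using assms by (auto simp: gl_act_def gl_fract_add)

lemma gl_act_mult:
  assumes "g \<in> GL_mats m" "A \<in> carrier_mat n n" "B \<in> carrier_mat n n"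
  shows "gl_act m g (A * B) = gl_act m g A * gl_act m g B"
  using assms
  by (auto simp: gl_act_def gl_fract_sum gl_fract_mult scalar_prod_def intro!: sum.cong)

lemma gl_act_scalar:
  assumes "g \<in> GL_mats m" "a \<in> base_scalars TYPE('k::field) n"
  shows "gl_act m g a = a"
  using assms gl_fract_to_fract[OF assms(1), of 0]
  by (auto simp: base_scalars_def gl_act_def gl_fract_mult gl_fract_to_fract gl_poly_def
      simp del: to_fract_0 to_fract_1 simp flip: to_fract_0 to_fract_1)

lemma gl_act_generic_mat:
  assumes "g \<in> GL_mats m" "j < m"
  shows "gl_act m g (map_mat to_fract (generic_mat n j)) =
    map_mat to_fract (mat n n (\<lambda>ab. \<Sum>i<m. gconst (g $$ (i, j)) * generic_mat n i $$ ab))"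
  using assms
  by (auto simp: gl_act_def gl_fract_to_fract gl_poly_def generic_mat_def gl_var_def)

end

theory Submission
  imports Defs "Jordan_Normal_Form.Determinant"
begin

text \<open>
  Write \<open>F\<close> for the field of rational functions in the entries of the generic matrices
  \<open>X\<^sub>0, \<dots>, X\<^sub>m\<^sub>-\<^sub>1\<close>.  Everything takes place inside the ring of \<open>n \<times> n\<close> matrices over \<open>F\<close>, and the
  proof has four ingredients.

  \<^emph>\<open>Division rings inside a matrix ring.\<close>  Let \<open>A\<close> be a subring of the matrix ring which contains an
  \<open>F\<close>-basis of it and whose nonzero elements are invertible matrices, and let \<open>Z\<close> be the field of
  those scalars that are ratios of elements of \<open>A\<close>.  A linear relation over \<open>F\<close> between elements of
  \<open>A\<close> can be replaced by one over \<open>Z\<close> (\<open>descent\<close>).  Three consequences carry the proof: \<open>A\<close>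
  satisfies the Ore condition, so that its fractions form a division ring
  (\<open>quotients_full_division\<close>); traces of elements of \<open>A\<close> lie in \<open>Z\<close> in characteristic zero
  (\<open>trace_in_ratios\<close>); and if \<open>A\<close> is a division ring, then \<open>Z\<close> is its center and an \<open>F\<close>-basis
  contained in \<open>A\<close> is a \<open>Z\<close>-basis of \<open>A\<close>, whence the degree of \<open>A\<close> is \<open>n\<close> (\<open>dimension_R\<close>).

  \<^emph>\<open>Generic matrices.\<close>  A nonzero element of the algebra of generic matrices has nonzero determinant
  (\<open>generic_det_nonzero\<close>), because the algebra embeds into a ring of skew polynomials in \<open>s\<close>,
  represented by matrices in such a way that every nonzero coefficient of a power of \<open>s\<close> has nonzero
  determinant.

  \<^emph>\<open>Invariants.\<close>  Let \<open>p\<close> be the orthogonal projection onto the span of \<open>X\<^sub>0, \<dots>, X\<^sub>m\<^sub>-\<^sub>1\<close> with respect to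
  the trace form.  A linear change of the \<open>X\<^sub>i\<close> does not change their span, so \<open>p\<close> commutes with
  the action of the general linear group.  Hence \<open>u = p(1)\<close> and \<open>v = p(u\<^sup>2)\<close> are fixed, and they lie in
  the universal division algebra because traces are central (\<open>span_proj_mem\<close>, \<open>gl_act_span_proj\<close>).

  \<^emph>\<open>Specialization.\<close>  It remains to see that, for some constant \<open>c\<close>, the products
  \<open>u\<^sup>i (v + c) u\<^sup>j\<close> with \<open>i, j < n\<close> are an \<open>F\<close>-basis of the matrix ring.  It suffices that \<open>u\<close> specializes
  to a diagonal matrix with distinct entries and \<open>v\<close> to a matrix without zeros off the diagonal.  Take
  \<open>X\<^sub>0 = diag(1, \<dots>, n)\<close>, let \<open>X\<^sub>1\<close> have ones off the diagonal and be orthogonal to \<open>1\<close> and \<open>X\<^sub>0\<close>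
  but not to \<open>X\<^sub>0\<^sup>2\<close>, which is possible as \<open>n \<ge> 3\<close>, and take the other \<open>X\<^sub>i\<close> in the orthogonal
  complement of \<open>1, X\<^sub>0, X\<^sub>0\<^sup>2, X\<^sub>1\<close>, where there is room for them as \<open>m - 2 \<le> n\<^sup>2 - 4\<close>.  Then \<open>u\<close> is a
  multiple of \<open>X\<^sub>0\<close> and \<open>v\<close> is a combination of \<open>X\<^sub>0\<close> and \<open>X\<^sub>1\<close> that involves \<open>X\<^sub>1\<close>
  (\<open>ex_rational_specialization\<close>).
\<close>

section \<open>Linear systems and sums of matrices\<close>

text \<open>
  Gaussian elimination: one equation is used up to solve for one unknown.  This is the source of all
  linear dependences below, be it between \<open>n\<^sup>2 + 1\<close> matrices or of a matrix orthogonal to fewer than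
  \<open>n\<^sup>2\<close> others.
\<close>

lemma underdetermined_system:
  fixes f :: "'i \<Rightarrow> 'j \<Rightarrow> 'f::field"
  assumes "finite I" "finite J" "card J < card I"
  shows "\<exists>c. (\<exists>i\<in>I. c i \<noteq> 0) \<and> (\<forall>j\<in>J. (\<Sum>i\<in>I. c i * f i j) = 0)"
  using assms(2,1,3)
proof (induction J arbitrary: I f rule: finite_induct)
  case empty
  then have "I \<noteq> {}" by auto
  then show ?case by (intro exI[of _ "\<lambda>_. 1"]) auto
next
  case (insert j J)
  show ?case
  proof (cases "\<exists>p\<in>I. f p j \<noteq> 0")
    case False
    then have "\<forall>i\<in>I. f i j = 0" by blast
    then show ?thesis using insert.IH[of I f] insert.prems insert.hyps by force
  next
    case True
    then obtain p where p: "p \<in> I" "f p j \<noteq> 0" by blast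
    let ?I = "I - {p}"
    let ?f = "\<lambda>i l. f i l - f i j / f p j * f p l"
    have "card J < card ?I" "finite ?I"
      using insert.prems insert.hyps p by auto
    from insert.IH[OF this(2,1), of ?f] obtain c where
      c: "\<exists>i\<in>?I. c i \<noteq> 0" "\<And>l. l \<in> J \<Longrightarrow> (\<Sum>i\<in>?I. c i * ?f i l) = 0" by blast
    define c' where "c' = c(p := - (\<Sum>i\<in>?I. c i * (f i j / f p j)))"
    have c'p: "c' p = - (\<Sum>i\<in>?I. c i * (f i j / f p j))" by (simp add: c'_def)
    have c'_eq: "c' i = c i" if "i \<in> ?I" for i using that by (simp add: c'_def)
    have split: "(\<Sum>i\<in>I. c' i * f i l) = c' p * f p l + (\<Sum>i\<in>?I. c i * f i l)" for l
      using p insert.prems by (subst sum.remove[of I p]) (auto simp: c'_eq)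
    have "(\<Sum>i\<in>I. c' i * f i l) = 0" if l: "l \<in> insert j J" for l
    proof (cases "l = j")
      case True
      have "c' p * f p j = - (\<Sum>i\<in>?I. c i * f i j)"
        using p by (simp add: c'p sum_distrib_right)
      then show ?thesis by (simp add: split True)
    next
      case False
      then have "(\<Sum>i\<in>?I. c i * ?f i l) = 0" using c l by blast
      then have "(\<Sum>i\<in>?I. c i * f i l) = (\<Sum>i\<in>?I. c i * (f i j / f p j) * f p l)"
        by (simp add: algebra_simps sum_subtractf)
      then show ?thesis by (simp add: split c'p sum_distrib_right)
    qed
    moreover have "\<exists>i\<in>I. c' i \<noteq> 0" using c(1) c'_eq by force
    ultimately show ?thesis by blast
  qed
qed

text \<open>
  The size of a matrix is not part of its type, so a sum over an empty family has to be told its size.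
\<close>

definition mat_sum :: "nat \<Rightarrow> ('i \<Rightarrow> 'a::comm_monoid_add mat) \<Rightarrow> 'i set \<Rightarrow> 'a mat" where
  "mat_sum n u I = mat n n (\<lambda>ij. \<Sum>x\<in>I. u x $$ ij)"

lemma mat_sum_carrier [simp, intro]: "mat_sum n u I \<in> carrier_mat n n"
  and mat_sum_dim [simp]: "dim_row (mat_sum n u I) = n" "dim_col (mat_sum n u I) = n"
  and mat_sum_index: "i < n \<Longrightarrow> j < n \<Longrightarrow> mat_sum n u I $$ (i, j) = (\<Sum>x\<in>I. u x $$ (i, j))"
  by (simp_all add: mat_sum_def)

lemma mat_sum_empty [simp]: "mat_sum n u {} = 0\<^sub>m n n"
  by (auto simp: mat_sum_def)

lemma mat_sum_insert:
  assumes "finite I" "x \<notin> I" "u x \<in> carrier_mat n n"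
  shows "mat_sum n u (insert x I) = u x + mat_sum n u I"
  using assms by (intro eq_matI) (auto simp: mat_sum_def)

lemma mat_sum_cong:
  "I = J \<Longrightarrow> (\<And>x. x \<in> J \<Longrightarrow> u x = v x) \<Longrightarrow> mat_sum n u I = mat_sum n v J"
  by (simp add: mat_sum_def)

lemma mat_sum_mult_left:
  fixes a :: "'a::comm_ring_1 mat"
  assumes "a \<in> carrier_mat n n" "\<And>x. x \<in> I \<Longrightarrow> u x \<in> carrier_mat n n"
  shows "a * mat_sum n u I = mat_sum n (\<lambda>x. a * u x) I"
proof (rule eq_matI)
  fix i j assume "i < dim_row (mat_sum n (\<lambda>x. a * u x) I)" "j < dim_col (mat_sum n (\<lambda>x. a * u x) I)"
  then have ij: "i < n" "j < n" by auto
  have "(a * mat_sum n u I) $$ (i, j) = (\<Sum>k<n. \<Sum>x\<in>I. a $$ (i, k) * u x $$ (k, j))"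
    using assms ij by (auto simp: scalar_prod_def mat_sum_index sum_distrib_left atLeast0LessThan)
  also have "\<dots> = (\<Sum>x\<in>I. \<Sum>k<n. a $$ (i, k) * u x $$ (k, j))" by (rule sum.swap)
  also have "\<dots> = mat_sum n (\<lambda>x. a * u x) I $$ (i, j)"
  proof -
    have "(a * u x) $$ (i, j) = (\<Sum>k<n. a $$ (i, k) * u x $$ (k, j))" if "x \<in> I" for x
      using assms(1) assms(2)[OF that] ij by (auto simp: scalar_prod_def atLeast0LessThan)
    then show ?thesis using ij by (simp add: mat_sum_index)
  qed
  finally show "(a * mat_sum n u I) $$ (i, j) = mat_sum n (\<lambda>x. a * u x) I $$ (i, j)" .
qed (use assms in auto)

lemma mat_sum_mult_right:
  fixes a :: "'a::comm_ring_1 mat"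
  assumes "a \<in> carrier_mat n n" "\<And>x. x \<in> I \<Longrightarrow> u x \<in> carrier_mat n n"
  shows "mat_sum n u I * a = mat_sum n (\<lambda>x. u x * a) I"
proof (rule eq_matI)
  fix i j assume "i < dim_row (mat_sum n (\<lambda>x. u x * a) I)" "j < dim_col (mat_sum n (\<lambda>x. u x * a) I)"
  then have ij: "i < n" "j < n" by auto
  have "(mat_sum n u I * a) $$ (i, j) = (\<Sum>k<n. \<Sum>x\<in>I. u x $$ (i, k) * a $$ (k, j))"
    using assms ij by (auto simp: scalar_prod_def mat_sum_index sum_distrib_right atLeast0LessThan)
  also have "\<dots> = (\<Sum>x\<in>I. \<Sum>k<n. u x $$ (i, k) * a $$ (k, j))" by (rule sum.swap)
  also have "\<dots> = mat_sum n (\<lambda>x. u x * a) I $$ (i, j)"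
  proof -
    have "(u x * a) $$ (i, j) = (\<Sum>k<n. u x $$ (i, k) * a $$ (k, j))" if "x \<in> I" for x
      using assms(1) assms(2)[OF that] ij by (auto simp: scalar_prod_def atLeast0LessThan)
    then show ?thesis using ij by (simp add: mat_sum_index)
  qed
  finally show "(mat_sum n u I * a) $$ (i, j) = mat_sum n (\<lambda>x. u x * a) I $$ (i, j)" .
qed (use assms in auto)

lemma mat_sum_diff:
  fixes u :: "'i \<Rightarrow> 'a::comm_ring_1 mat"
  assumes "\<And>x. x \<in> I \<Longrightarrow> u x \<in> carrier_mat n n" "\<And>x. x \<in> I \<Longrightarrow> v x \<in> carrier_mat n n"
  shows "mat_sum n (\<lambda>x. u x - v x) I = mat_sum n u I - mat_sum n v I"
proof (rule eq_matI)
  fix i j assume "i < dim_row (mat_sum n u I - mat_sum n v I)" "j < dim_col (mat_sum n u I - mat_sum n v I)"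
  then have ij: "i < n" "j < n" by auto
  have "(u x - v x) $$ (i, j) = u x $$ (i, j) - v x $$ (i, j)" if "x \<in> I" for x
    using assms(1,2)[OF that] ij by auto
  then show "mat_sum n (\<lambda>x. u x - v x) I $$ (i, j) = (mat_sum n u I - mat_sum n v I) $$ (i, j)"
    using ij by (simp add: mat_sum_index sum_subtractf)
qed auto

lemma mat_sum_smult:
  fixes u :: "'i \<Rightarrow> 'a::comm_ring_1 mat"
  assumes "\<And>x. x \<in> I \<Longrightarrow> u x \<in> carrier_mat n n"
  shows "mat_sum n (\<lambda>x. c \<cdot>\<^sub>m u x) I = c \<cdot>\<^sub>m mat_sum n u I"
proof (rule eq_matI)
  fix i j assume "i < dim_row (c \<cdot>\<^sub>m mat_sum n u I)" "j < dim_col (c \<cdot>\<^sub>m mat_sum n u I)"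
  then have ij: "i < n" "j < n" by auto
  have "(c \<cdot>\<^sub>m u x) $$ (i, j) = c * u x $$ (i, j)" if "x \<in> I" for x
    using assms[OF that] ij by auto
  then show "mat_sum n (\<lambda>x. c \<cdot>\<^sub>m u x) I $$ (i, j) = (c \<cdot>\<^sub>m mat_sum n u I) $$ (i, j)"
    using ij by (simp add: mat_sum_index sum_distrib_left)
qed auto

lemma mat_sum_smult_index:
  assumes "i < n" "j < n" "\<And>x. x \<in> I \<Longrightarrow> u x \<in> carrier_mat n n"
  shows "mat_sum n (\<lambda>x. c x \<cdot>\<^sub>m u x) I $$ (i, j) = (\<Sum>x\<in>I. c x * u x $$ (i, j))"
proof -
  have "(c x \<cdot>\<^sub>m u x) $$ (i, j) = c x * u x $$ (i, j)" if "x \<in> I" for x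
    using assms(3)[OF that] assms(1,2) by auto
  then show ?thesis using assms by (simp add: mat_sum_index)
qed

lemma mat_sum_zero: "(\<And>i. i \<in> I \<Longrightarrow> u i = 0\<^sub>m n n) \<Longrightarrow> mat_sum n u I = 0\<^sub>m n n"
  by (intro eq_matI) (auto simp: mat_sum_index)

lemma smult_smult_mat: "y \<cdot>\<^sub>m (z \<cdot>\<^sub>m a) = (y * z) \<cdot>\<^sub>m (a :: 'a::semigroup_mult mat)"
  by (intro eq_matI) (auto simp: mult.assoc)

lemma one_smult_mat: "1 \<cdot>\<^sub>m a = (a :: 'a::monoid_mult mat)"
  by (intro eq_matI) auto

lemma smult_diff_mat:
  "a \<in> carrier_mat n n \<Longrightarrow> b \<in> carrier_mat n n \<Longrightarrow> c \<cdot>\<^sub>m (a - b) = c \<cdot>\<^sub>m a - c \<cdot>\<^sub>m (b :: 'a::ring mat)"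
  by (intro eq_matI) (auto simp: algebra_simps)

lemma mat_eq_if_diff_zero:
  fixes a :: "'a::comm_ring_1 mat"
  assumes "a \<in> carrier_mat n n" "b \<in> carrier_mat n n" "a - b = 0\<^sub>m n n"
  shows "a = b"
proof (rule eq_matI)
  fix i j assume *: "i < dim_row b" "j < dim_col b"
  have "a $$ (i, j) - b $$ (i, j) = (a - b) $$ (i, j)" using assms(1,2) * by auto
  also have "\<dots> = 0" unfolding assms(3) using assms(2) * by auto
  finally show "a $$ (i, j) = b $$ (i, j)" by simp
qed (use assms in auto)

lemma smult_mat_eq_0_iff:
  fixes a :: "'f::idom mat"
  assumes "a \<in> carrier_mat n n"
  shows "c \<cdot>\<^sub>m a = 0\<^sub>m n n \<longleftrightarrow> c = 0 \<or> a = 0\<^sub>m n n"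
proof
  assume *: "c \<cdot>\<^sub>m a = 0\<^sub>m n n"
  show "c = 0 \<or> a = 0\<^sub>m n n"
  proof (cases "c = 0")
    case False
    have "a $$ (i, j) = 0" if "i < n" "j < n" for i j
    proof -
      have "(c \<cdot>\<^sub>m a) $$ (i, j) = 0" using * that by simp
      then show ?thesis using assms that False by simp
    qed
    then show ?thesis using assms by (intro disjI2 eq_matI) auto
  qed simp
qed (use assms in auto)

section \<open>Descent of linear relations to central ratios\<close>

text \<open>
  A subring of a matrix ring that may be far from a division ring, but is large: it contains a basis
  \<open>e\<close> of all matrices, and its nonzero elements are invertible at least as matrices.  The algebra of
  generic matrices, its ring of fractions and the ring of invariants are of this kind.
\<close>

locale full_subring =
  fixes n :: nat and A :: "'f::field mat set" and e :: "nat \<Rightarrow> 'f mat"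
  assumes n_pos: "0 < n"
    and subset_carrier: "A \<subseteq> carrier_mat n n"
    and one_mem: "1\<^sub>m n \<in> A"
    and uminus_mem: "a \<in> A \<Longrightarrow> - a \<in> A"
    and add_mem: "a \<in> A \<Longrightarrow> b \<in> A \<Longrightarrow> a + b \<in> A"
    and mult_mem: "a \<in> A \<Longrightarrow> b \<in> A \<Longrightarrow> a * b \<in> A"
    and ex_inverse: "a \<in> A \<Longrightarrow> a \<noteq> 0\<^sub>m n n \<Longrightarrow> \<exists>b\<in>carrier_mat n n. a * b = 1\<^sub>m n \<and> b * a = 1\<^sub>m n"
    and basis_mem: "i < n * n \<Longrightarrow> e i \<in> A"
    and basis_independent:
      "mat_sum n (\<lambda>i. c i \<cdot>\<^sub>m e i) {..<n * n} = 0\<^sub>m n n \<Longrightarrow> i < n * n \<Longrightarrow> c i = 0"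
begin

lemma mem_carrier [intro, simp]: "a \<in> A \<Longrightarrow> a \<in> carrier_mat n n"
  using subset_carrier by blast

lemma basis_carrier: "i < n * n \<Longrightarrow> e i \<in> carrier_mat n n"
  using basis_mem by blast

lemma mult_carrier [simp]:
  "(a :: 'f mat) \<in> carrier_mat n n \<Longrightarrow> b \<in> carrier_mat n n \<Longrightarrow> a * b \<in> carrier_mat n n"
  by (rule mult_carrier_mat)

lemmas assoc = assoc_mult_mat[of _ n n _ n _ n]

lemma diff_mem: "a \<in> A \<Longrightarrow> b \<in> A \<Longrightarrow> a - b \<in> A"
  using add_mem[of a "- b"] uminus_mem[of b] minus_add_uminus_mat[of a n n b] by simp

lemma zero_mem: "0\<^sub>m n n \<in> A"
proof -
  have "1\<^sub>m n - 1\<^sub>m n \<in> A" using diff_mem one_mem by blast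
  moreover have "1\<^sub>m n - 1\<^sub>m n = (0\<^sub>m n n :: 'f mat)" by auto
  ultimately show ?thesis by simp
qed

lemma mat_sum_mem: "finite I \<Longrightarrow> (\<And>x. x \<in> I \<Longrightarrow> u x \<in> A) \<Longrightarrow> mat_sum n u I \<in> A"
  by (induction I rule: finite_induct) (simp_all add: zero_mem mat_sum_insert add_mem)

lemma one_neq_zero: "1\<^sub>m n \<noteq> (0\<^sub>m n n :: 'f mat)"
proof
  assume "1\<^sub>m n = (0\<^sub>m n n :: 'f mat)"
  then have "1\<^sub>m n $$ (0, 0) = (0\<^sub>m n n :: 'f mat) $$ (0, 0)" by simp
  then show False using n_pos by simp
qed

lemma cancel_right:
  assumes "a \<in> A" "a \<noteq> 0\<^sub>m n n" "x \<in> carrier_mat n n" "x * a = 0\<^sub>m n n"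
  shows "x = 0\<^sub>m n n"
proof -
  obtain b where b: "b \<in> carrier_mat n n" "a * b = 1\<^sub>m n" using ex_inverse assms by blast
  have "x = x * a * b" using assms(1-3) b by (simp add: assoc)
  also have "\<dots> = 0\<^sub>m n n" unfolding assms(4) using b by simp
  finally show ?thesis .
qed

lemma cancel_left:
  assumes "a \<in> A" "a \<noteq> 0\<^sub>m n n" "x \<in> carrier_mat n n" "a * x = 0\<^sub>m n n"
  shows "x = 0\<^sub>m n n"
proof -
  obtain b where b: "b \<in> carrier_mat n n" "b * a = 1\<^sub>m n" using ex_inverse assms by blast
  have "x = b * (a * x)" using assms(1-3) b by (simp flip: assoc)
  also have "\<dots> = 0\<^sub>m n n" unfolding assms(4) using b by simp
  finally show ?thesis .
qed

lemma mult_nonzero: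
  "a \<in> A \<Longrightarrow> b \<in> A \<Longrightarrow> a \<noteq> 0\<^sub>m n n \<Longrightarrow> b \<noteq> 0\<^sub>m n n \<Longrightarrow> a * b \<noteq> 0\<^sub>m n n"
  using cancel_right by blast

text \<open>
  A further matrix is dependent on the \<open>n\<^sup>2\<close> basis elements, and it occurs in the relation because
  these are independent.
\<close>

lemma ex_coordinates:
  assumes x: "x \<in> carrier_mat n n"
  shows "\<exists>c. x = mat_sum n (\<lambda>i. c i \<cdot>\<^sub>m e i) {..<n * n}"
proof -
  let ?u = "\<lambda>i. if i < n * n then e i else x"
  have "\<exists>c. (\<exists>i\<in>{..n * n}. c i \<noteq> 0) \<and> (\<forall>kl\<in>{..<n} \<times> {..<n}. (\<Sum>i\<in>{..n * n}. c i * ?u i $$ kl) = 0)"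
    by (rule underdetermined_system) auto
  then obtain c where c: "\<exists>i\<in>{..n * n}. c i \<noteq> 0"
    "\<forall>kl\<in>{..<n} \<times> {..<n}. (\<Sum>i\<in>{..n * n}. c i * ?u i $$ kl) = 0"
    by blast
  let ?s = "mat_sum n (\<lambda>i. c i \<cdot>\<^sub>m e i) {..<n * n}"
  have entry: "?s $$ (k, l) + c (n * n) * x $$ (k, l) = 0" if "k < n" "l < n" for k l
  proof -
    have "{..n * n} = insert (n * n) {..<n * n}" by auto
    then show ?thesis
      using c(2)[rule_format, of "(k, l)"] that by (subst mat_sum_smult_index) (auto simp: basis_carrier add.commute)
  qed
  have cx: "c (n * n) \<noteq> 0"
  proof
    assume z: "c (n * n) = 0"
    then have "?s = 0\<^sub>m n n" using entry by (intro eq_matI) auto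
    then have "\<forall>i<n * n. c i = 0" using basis_independent by blast
    then show False using c(1) z by (metis atMost_iff le_neq_implies_less)
  qed
  have "x = mat_sum n (\<lambda>i. (- c i / c (n * n)) \<cdot>\<^sub>m e i) {..<n * n}"
  proof (rule eq_matI)
    fix k l assume "k < dim_row (mat_sum n (\<lambda>i. (- c i / c (n * n)) \<cdot>\<^sub>m e i) {..<n * n})"
      "l < dim_col (mat_sum n (\<lambda>i. (- c i / c (n * n)) \<cdot>\<^sub>m e i) {..<n * n})"
    then have kl: "k < n" "l < n" by auto
    have "x $$ (k, l) = - ?s $$ (k, l) / c (n * n)"
      using entry[OF kl] cx by (simp add: field_simps eq_neg_iff_add_eq_0)
    also have "\<dots> = (\<Sum>i<n * n. - c i / c (n * n) * e i $$ (k, l))"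
      using kl by (subst mat_sum_smult_index) (auto simp: basis_carrier sum_divide_distrib sum_negf)
    also have "\<dots> = mat_sum n (\<lambda>i. (- c i / c (n * n)) \<cdot>\<^sub>m e i) {..<n * n} $$ (k, l)"
      using kl by (subst mat_sum_smult_index) (auto simp: basis_carrier)
    finally show "x $$ (k, l) = mat_sum n (\<lambda>i. (- c i / c (n * n)) \<cdot>\<^sub>m e i) {..<n * n} $$ (k, l)" .
  qed (use x in auto)
  then show ?thesis by (intro exI[of _ "\<lambda>i. - c i / c (n * n)"])
qed

text \<open>
  A matrix that commutes with a basis commutes with every matrix, in particular with the elementary
  ones.
\<close>

lemma commuting_imp_scalar:
  assumes x: "x \<in> carrier_mat n n" and comm: "\<And>a. a \<in> A \<Longrightarrow> a * x = x * a"
  shows "\<exists>z. x = z \<cdot>\<^sub>m 1\<^sub>m n"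
proof -
  have comm': "y * x = x * y" if y: "y \<in> carrier_mat n n" for y
  proof -
    obtain c where c: "y = mat_sum n (\<lambda>i. c i \<cdot>\<^sub>m e i) {..<n * n}"
      using ex_coordinates[OF y] by blast
    have "c i \<cdot>\<^sub>m e i * x = x * (c i \<cdot>\<^sub>m e i)" if "i < n * n" for i
      using comm[OF basis_mem[OF that]] x basis_carrier[OF that]
      by (simp add: mult_smult_distrib[of _ n n _ n] mult_smult_assoc_mat[of _ n n _ n])
    moreover have "y * x = mat_sum n (\<lambda>i. c i \<cdot>\<^sub>m e i * x) {..<n * n}"
      unfolding c using x basis_carrier by (intro mat_sum_mult_right) auto
    moreover have "x * y = mat_sum n (\<lambda>i. x * (c i \<cdot>\<^sub>m e i)) {..<n * n}"
      unfolding c using x basis_carrier by (intro mat_sum_mult_left) auto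
    ultimately show ?thesis by (auto intro!: mat_sum_cong)
  qed
  let ?E = "\<lambda>k l. mat n n (\<lambda>(i, j). if i = k \<and> j = l then 1 else 0) :: 'f mat"
  have l: "(x * ?E k l) $$ (i, l) = x $$ (i, k)" if "i < n" "k < n" "l < n" for i k l
    using x that by (simp add: scalar_prod_def if_distrib[of "\<lambda>y. _ * y"] sum.delta cong: if_cong)
  have r: "(?E k l * x) $$ (i, j) = (if i = k then x $$ (l, j) else 0)" if "i < n" "k < n" "l < n" "j < n" for i j k l
    using x that by (auto simp: scalar_prod_def if_distrib[of "\<lambda>y. y * _"] sum.delta cong: if_cong)
  define z where "z = x $$ (0, 0)"
  have "x $$ (i, k) = (if i = k then z else 0)" if "i < n" "k < n" for i k
  proof -
    have "x $$ (i, k) = (x * ?E k 0) $$ (i, 0)" using l that n_pos by simp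
    also have "\<dots> = (?E k 0 * x) $$ (i, 0)" using comm'[of "?E k 0"] by (metis mat_carrier)
    also have "\<dots> = (if i = k then z else 0)" using r that n_pos by (simp add: z_def)
    finally show ?thesis .
  qed
  then have "x = z \<cdot>\<^sub>m 1\<^sub>m n" using x by (intro eq_matI) auto
  then show ?thesis by blast
qed

text \<open>
  The center of the ring of fractions of \<open>A\<close>.  Central elements need not be available in \<open>A\<close> itself,
  so a central fraction is recorded as a scalar \<open>z\<close> for which \<open>A\<close> contains some \<open>t \<noteq> 0\<close> and \<open>z t\<close>.
\<close>

definition ratios :: "'f set" where
  "ratios = {z. \<exists>s\<in>A. \<exists>t\<in>A. t \<noteq> 0\<^sub>m n n \<and> s = z \<cdot>\<^sub>m t}"

lemma ratiosI: "z \<cdot>\<^sub>m t \<in> A \<Longrightarrow> t \<in> A \<Longrightarrow> t \<noteq> 0\<^sub>m n n \<Longrightarrow> z \<in> ratios"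
  unfolding ratios_def by blast

lemma ratiosE:
  assumes "z \<in> ratios"
  obtains t where "t \<in> A" "t \<noteq> 0\<^sub>m n n" "z \<cdot>\<^sub>m t \<in> A"
  using assms unfolding ratios_def by blast

lemma smult_left: "(a::'f mat) \<in> carrier_mat n n \<Longrightarrow> b \<in> carrier_mat n n \<Longrightarrow> (z \<cdot>\<^sub>m a) * b = z \<cdot>\<^sub>m (a * b)"
  by (rule mult_smult_assoc_mat)

lemma smult_right: "(a::'f mat) \<in> carrier_mat n n \<Longrightarrow> b \<in> carrier_mat n n \<Longrightarrow> a * (z \<cdot>\<^sub>m b) = z \<cdot>\<^sub>m (a * b)"
  by (rule mult_smult_distrib)

lemma ratios_0: "0 \<in> ratios" and ratios_1: "1 \<in> ratios"
proof -
  have "0 \<cdot>\<^sub>m 1\<^sub>m n = (0\<^sub>m n n :: 'f mat)" "1 \<cdot>\<^sub>m 1\<^sub>m n = (1\<^sub>m n :: 'f mat)" by auto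
  then show "0 \<in> ratios" "1 \<in> ratios"
    using one_mem one_neq_zero zero_mem by (metis ratiosI)+
qed

lemma ratios_mult:
  assumes "y \<in> ratios" "z \<in> ratios" shows "y * z \<in> ratios"
proof -
  obtain s where s: "s \<in> A" "s \<noteq> 0\<^sub>m n n" "y \<cdot>\<^sub>m s \<in> A" using assms ratiosE by blast
  obtain t where t: "t \<in> A" "t \<noteq> 0\<^sub>m n n" "z \<cdot>\<^sub>m t \<in> A" using assms ratiosE by blast
  have "(y * z) \<cdot>\<^sub>m (s * t) = (y \<cdot>\<^sub>m s) * (z \<cdot>\<^sub>m t)"
    using s t by (simp add: smult_left smult_right smult_smult_mat mult.commute)
  then show ?thesis using mult_mem[OF s(3) t(3)] mult_mem[OF s(1) t(1)] mult_nonzero s t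
    by (intro ratiosI[of _ "s * t"]) auto
qed

lemma ratios_add:
  assumes "y \<in> ratios" "z \<in> ratios" shows "y + z \<in> ratios"
proof -
  obtain s where s: "s \<in> A" "s \<noteq> 0\<^sub>m n n" "y \<cdot>\<^sub>m s \<in> A" using assms ratiosE by blast
  obtain t where t: "t \<in> A" "t \<noteq> 0\<^sub>m n n" "z \<cdot>\<^sub>m t \<in> A" using assms ratiosE by blast
  have "(y + z) \<cdot>\<^sub>m (s * t) = (y \<cdot>\<^sub>m s) * t + s * (z \<cdot>\<^sub>m t)"
    using s t add_smult_distrib_right_mat[of "s * t" n n y z] by (simp add: smult_left smult_right)
  then show ?thesis using mult_mem[OF s(1) t(3)] mult_mem[OF s(3) t(1)] add_mem mult_mem[OF s(1) t(1)] mult_nonzero s t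
    by (intro ratiosI[of _ "s * t"]) auto
qed

lemma ratios_uminus:
  assumes "z \<in> ratios" shows "- z \<in> ratios"
proof -
  obtain t where t: "t \<in> A" "t \<noteq> 0\<^sub>m n n" "z \<cdot>\<^sub>m t \<in> A" using assms ratiosE by blast
  have "(- z) \<cdot>\<^sub>m t = - (z \<cdot>\<^sub>m t)" using t by auto
  then show ?thesis using t uminus_mem by (metis ratiosI)
qed

lemma ratios_sum: "(\<And>x. x \<in> I \<Longrightarrow> f x \<in> ratios) \<Longrightarrow> sum f I \<in> ratios"
  by (induction I rule: infinite_finite_induct) (auto simp: ratios_0 ratios_add)

lemma ratios_prod: "(\<And>x. x \<in> I \<Longrightarrow> f x \<in> ratios) \<Longrightarrow> prod f I \<in> ratios"
  by (induction I rule: infinite_finite_induct) (auto simp: ratios_1 ratios_mult)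

lemma ratios_inverse:
  assumes "z \<in> ratios" shows "inverse z \<in> ratios"
proof (cases "z = 0")
  case False
  obtain t where t: "t \<in> A" "t \<noteq> 0\<^sub>m n n" "z \<cdot>\<^sub>m t \<in> A" using assms ratiosE by blast
  have "inverse z \<cdot>\<^sub>m (z \<cdot>\<^sub>m t) = t" using False t by (simp add: smult_smult_mat one_smult_mat)
  then show ?thesis using t False smult_mat_eq_0_iff[of t n z] by (intro ratiosI[of _ "z \<cdot>\<^sub>m t"]) auto
qed (simp add: ratios_0)

lemma common_denominator:
  assumes "finite I" "\<And>x. x \<in> I \<Longrightarrow> z x \<in> ratios"
  shows "\<exists>t\<in>A. t \<noteq> 0\<^sub>m n n \<and> (\<forall>x\<in>I. z x \<cdot>\<^sub>m t \<in> A)"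
  using assms
proof (induction I rule: finite_induct)
  case empty
  then show ?case using one_mem one_neq_zero by blast
next
  case (insert y I)
  then obtain t where t: "t \<in> A" "t \<noteq> 0\<^sub>m n n" "\<forall>x\<in>I. z x \<cdot>\<^sub>m t \<in> A" by auto
  obtain s where s: "s \<in> A" "s \<noteq> 0\<^sub>m n n" "z y \<cdot>\<^sub>m s \<in> A" using insert.prems ratiosE by blast
  have "z x \<cdot>\<^sub>m (t * s) \<in> A" if "x \<in> insert y I" for x
  proof (cases "x = y")
    case True
    then show ?thesis using mult_mem[OF t(1) s(3)] s t by (simp add: smult_right)
  next
    case False
    then have "z x \<cdot>\<^sub>m t \<in> A" using t that by blast
    from mult_mem[OF this s(1)] show ?thesis using s t by (simp add: smult_left)
  qed
  then show ?case using mult_mem mult_nonzero s t by blast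
qed

end

context full_subring
begin

declare assoc [simp]

lemma square_simps [simp]:
  "(a :: 'f mat) \<in> carrier_mat n n \<Longrightarrow> a * 0\<^sub>m n n = 0\<^sub>m n n"
  "(a :: 'f mat) \<in> carrier_mat n n \<Longrightarrow> 0\<^sub>m n n * a = 0\<^sub>m n n"
  "(a :: 'f mat) \<in> carrier_mat n n \<Longrightarrow> a * 1\<^sub>m n = a"
  "(a :: 'f mat) \<in> carrier_mat n n \<Longrightarrow> 1\<^sub>m n * a = a"
  "(a :: 'f mat) \<in> carrier_mat n n \<Longrightarrow> a - 0\<^sub>m n n = a"
  "(a :: 'f mat) \<in> carrier_mat n n \<Longrightarrow> a - a = 0\<^sub>m n n"
  by auto

lemma mem_dim [simp]: "a \<in> A \<Longrightarrow> dim_row a = n" "a \<in> A \<Longrightarrow> dim_col a = n"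
  using mem_carrier by blast+

abbreviation lincomb :: "('i \<Rightarrow> 'f) \<Rightarrow> ('i \<Rightarrow> 'f mat) \<Rightarrow> 'i set \<Rightarrow> 'f mat" where
  "lincomb c u I \<equiv> mat_sum n (\<lambda>i. c i \<cdot>\<^sub>m u i) I"

lemma lincomb_mult_left:
  assumes "a \<in> carrier_mat n n" "\<And>i. i \<in> I \<Longrightarrow> u i \<in> carrier_mat n n"
  shows "lincomb c (\<lambda>i. a * u i) I = a * lincomb c u I"
  using assms by (subst mat_sum_mult_left) (auto intro!: mat_sum_cong simp: smult_right)

lemma lincomb_mult_right:
  assumes "a \<in> carrier_mat n n" "\<And>i. i \<in> I \<Longrightarrow> u i \<in> carrier_mat n n"
  shows "lincomb c (\<lambda>i. u i * a) I = lincomb c u I * a"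
  using assms by (subst mat_sum_mult_right) (auto intro!: mat_sum_cong simp: smult_left)

lemma lincomb_diff:
  assumes "\<And>i. i \<in> I \<Longrightarrow> u i \<in> carrier_mat n n" "\<And>i. i \<in> I \<Longrightarrow> v i \<in> carrier_mat n n"
  shows "lincomb c (\<lambda>i. u i - v i) I = lincomb c u I - lincomb c v I"
  using assms by (subst mat_sum_diff[symmetric]) (auto intro!: mat_sum_cong simp: smult_diff_mat[of _ n])

lemma lincomb_remove:
  assumes "finite I" "p \<in> I" "\<And>i. i \<in> I \<Longrightarrow> u i \<in> carrier_mat n n"
  shows "lincomb c u I = c p \<cdot>\<^sub>m u p + lincomb c u (I - {p})"
  using mat_sum_insert[of "I - {p}" p "\<lambda>i. c i \<cdot>\<^sub>m u i" n] assms by (simp add: insert_absorb)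

lemma lincomb_scalars:
  assumes "a \<in> carrier_mat n n"
  shows "lincomb c (\<lambda>i. z i \<cdot>\<^sub>m a) I = (\<Sum>i\<in>I. c i * z i) \<cdot>\<^sub>m a"
  using assms by (intro eq_matI) (auto simp: mat_sum_index sum_distrib_right mult.assoc)

text \<open>
  The set of families \<open>s\<close> in \<open>A\<close> with \<open>\<Sum> c\<^sub>i s\<^sub>i = 0\<close> is closed under left and right multiplication
  by \<open>A\<close>.  Take a nonzero \<open>s\<close> of minimal support and \<open>p\<close> in its support.  For every \<open>h\<close> in \<open>A\<close> the family
  \<open>s\<^sub>p h s\<^sub>i - s\<^sub>i h s\<^sub>p\<close> has smaller support and therefore vanishes.  This says that \<open>s\<^sub>i s\<^sub>p\<^sup>-\<^sup>1\<close> commutes with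
  \<open>A\<close>, so that \<open>s\<^sub>i = \<zeta>\<^sub>i s\<^sub>p\<close> with \<open>\<zeta>\<^sub>i\<close> a scalar, indeed a ratio.  Thus \<open>\<Sum> c\<^sub>i \<zeta>\<^sub>i = 0\<close>, which expresses
  \<open>c\<^sub>p\<close> by the other coefficients; substituting it leaves the shorter relation
  \<open>\<Sum> c\<^sub>i (u\<^sub>i - \<zeta>\<^sub>i u\<^sub>p) = 0\<close>, whose terms lie in \<open>A\<close> after multiplication by \<open>s\<^sub>p\<close>.

  The normalization \<open>c\<^sub>i\<^sub>0 = 1 = z\<^sub>i\<^sub>0\<close> makes the result usable: it says which element becomes a
  combination of the others.
\<close>

lemma descent:
  assumes "finite I" "i0 \<in> I" "c i0 = 1" "\<And>i. i \<in> I \<Longrightarrow> u i \<in> A" "lincomb c u I = 0\<^sub>m n n"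
  shows "\<exists>z. (\<forall>i\<in>I. z i \<in> ratios) \<and> z i0 = 1 \<and> lincomb z u I = 0\<^sub>m n n"
  using assms
proof (induction "card I" arbitrary: I u rule: less_induct)
  case less
  note fin = less.prems(1) and i0 = less.prems(2,3) and u = less.prems(4) and rel_u = less.prems(5)
  define rel where "rel s \<longleftrightarrow> (\<forall>i\<in>I. s i \<in> A) \<and> lincomb c s I = 0\<^sub>m n n" for s
  define supp where "supp s = {i \<in> I. s i \<noteq> 0\<^sub>m n n}" for s :: "_ \<Rightarrow> 'f mat"
  show ?case
  proof (cases "supp u = {}")
    case True
    let ?z = "\<lambda>i. if i = i0 then 1 else 0 :: 'f"
    have "lincomb ?z u I = 0\<^sub>m n n"
      using True by (intro mat_sum_zero) (auto simp: supp_def)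
    then show ?thesis using ratios_0 ratios_1 by (intro exI[of _ ?z]) auto
  next
    case False
    have "rel u" using u rel_u by (auto simp: rel_def)
    with False obtain s where s: "rel s" "supp s \<noteq> {}"
      and minimal: "\<And>t. rel t \<Longrightarrow> supp t \<noteq> {} \<Longrightarrow> card (supp s) \<le> card (supp t)"
      using ex_has_least_nat[of "\<lambda>s. rel s \<and> supp s \<noteq> {}" u "\<lambda>s. card (supp s)"] by blast
    have sA: "s i \<in> A" if "i \<in> I" for i using s that by (auto simp: rel_def)
    have rel_s: "lincomb c s I = 0\<^sub>m n n" using s by (simp add: rel_def)
    \<comment> \<open>The coefficient to be eliminated must not be the normalized one.\<close>
    have "\<exists>p\<in>supp s. p \<noteq> i0"
    proof (rule ccontr)
      assume no: "\<not> ?thesis"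
      have "lincomb c s I = c i0 \<cdot>\<^sub>m s i0 + lincomb c s (I - {i0})"
        using fin i0 sA by (intro lincomb_remove) auto
      also have "lincomb c s (I - {i0}) = 0\<^sub>m n n"
        using no by (intro mat_sum_zero) (auto simp: supp_def)
      also have "c i0 \<cdot>\<^sub>m s i0 + 0\<^sub>m n n = s i0"
        using i0 sA by (simp add: one_smult_mat)
      finally have "i0 \<notin> supp s" using rel_s by (simp add: supp_def)
      then show False using no s(2) by auto
    qed
    then obtain p where p: "p \<in> I" "p \<noteq> i0" "s p \<noteq> 0\<^sub>m n n" by (auto simp: supp_def)
    have key: "s p * h * s i = s i * (h * s p)" if h: "h \<in> A" and i: "i \<in> I" for h i
    proof -
      define t where "t i = s p * h * s i - s i * (h * s p)" for i
      have tA: "t i \<in> A" if "i \<in> I" for i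
        unfolding t_def using that h p sA by (intro diff_mem mult_mem) auto
      have "lincomb c t I = s p * h * lincomb c s I - lincomb c s I * (h * s p)"
        unfolding t_def using h p sA
        by (subst lincomb_diff) (auto simp: lincomb_mult_left lincomb_mult_right simp del: assoc_mult_mat)
      also have "\<dots> = 0\<^sub>m n n" unfolding rel_s using h p sA[OF p(1)] by auto
      finally have "rel t" using tA by (auto simp: rel_def)
      moreover have "card (supp t) < card (supp s)"
      proof (rule psubset_card_mono)
        show "finite (supp s)" using fin by (simp add: supp_def)
        have "t p = 0\<^sub>m n n" using h p sA by (simp add: t_def)
        moreover have "t i = 0\<^sub>m n n" if "i \<in> I" "s i = 0\<^sub>m n n" for i
          using that h p sA by (simp add: t_def)
        ultimately show "supp t \<subset> supp s" using p by (auto simp: supp_def)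
      qed
      ultimately have "supp t = {}" using minimal[of t] by linarith
      then have "t i = 0\<^sub>m n n" using i by (auto simp: supp_def)
      moreover have "s p * h * s i \<in> carrier_mat n n" "s i * (h * s p) \<in> carrier_mat n n"
        using h sA[OF i] sA[OF p(1)] by simp_all
      ultimately show ?thesis unfolding t_def by (metis mat_eq_if_diff_zero)
    qed
    obtain b where b: "b \<in> carrier_mat n n" "s p * b = 1\<^sub>m n" "b * s p = 1\<^sub>m n"
      using ex_inverse sA p by blast
    have "\<exists>z. s i = z \<cdot>\<^sub>m s p" if i: "i \<in> I" for i
    proof -
      have comm1: "s p * s i = s i * s p" using key[OF one_mem i] sA p i by simp
      have swap: "b * s i = s i * b"
      proof -
        have "b * s i = b * (s i * s p) * b" using b sA p i by simp
        also have "\<dots> = b * (s p * s i) * b" by (simp only: comm1)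
        also have "\<dots> = (b * s p) * (s i * b)" using b(1) sA p i by simp
        also have "\<dots> = s i * b" unfolding b(3) using b(1) sA i by simp
        finally show ?thesis .
      qed
      have "h * (s i * b) = s i * b * h" if h: "h \<in> A" for h
      proof -
        have "h * (s i * b) = (b * s p) * (h * (s i * b))" unfolding b(3) using b(1) sA i h by simp
        also have "\<dots> = b * (s p * h * s i) * b" using b(1) sA p i h by simp
        also have "\<dots> = b * (s i * (h * s p)) * b" by (simp only: key[OF h i])
        also have "\<dots> = (b * s i) * h * (s p * b)" using b(1) sA p i h by simp
        also have "\<dots> = s i * b * h" unfolding b(2) swap using b(1) sA p i h by simp
        finally show ?thesis .
      qed
      then obtain z where z: "s i * b = z \<cdot>\<^sub>m 1\<^sub>m n"
        using commuting_imp_scalar[of "s i * b"] b sA i by auto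
      have "s i = s i * b * s p" using b sA p i by simp
      also have "\<dots> = z \<cdot>\<^sub>m s p" unfolding z using sA p by (simp add: smult_left)
      finally show ?thesis by blast
    qed
    then obtain \<zeta> where \<zeta>: "\<And>i. i \<in> I \<Longrightarrow> s i = \<zeta> i \<cdot>\<^sub>m s p" by metis
    have \<zeta>_ratio: "\<zeta> i \<in> ratios" if "i \<in> I" for i
      using \<zeta>[OF that] sA[OF that] sA p by (auto intro!: ratiosI[of _ "s p"])
    let ?I = "I - {p}"
    define v where "v i = u i * s p - u p * s i" for i
    have vA: "v i \<in> A" if "i \<in> I" for i
      unfolding v_def using that p sA u by (intro diff_mem mult_mem) auto
    have lincomb_v: "lincomb d v J = lincomb d u J * s p - u p * lincomb d s J" if "J \<subseteq> I" for d J
      unfolding v_def using that p sA u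
      by (subst lincomb_diff) (auto simp: subset_iff lincomb_mult_left lincomb_mult_right)
    have "lincomb c v I = c p \<cdot>\<^sub>m v p + lincomb c v ?I"
      using fin p vA by (intro lincomb_remove) auto
    moreover have "c p \<cdot>\<^sub>m v p = 0\<^sub>m n n"
      using p u sA by (simp add: v_def)
    moreover have "lincomb c v I = 0\<^sub>m n n"
      using lincomb_v[of I c] rel_u rel_s p u sA by simp
    ultimately have "lincomb c v ?I = 0\<^sub>m n n" by simp
    then obtain z where z: "\<forall>i\<in>?I. z i \<in> ratios" "z i0 = 1" "lincomb z v ?I = 0\<^sub>m n n"
      using less.hyps[of ?I v] card_Diff1_less[OF fin p(1)] fin p i0 vA by auto
    define z' where "z' = z(p := - (\<Sum>i\<in>?I. z i * \<zeta> i))"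
    have z'p: "z' p = - (\<Sum>i\<in>?I. z i * \<zeta> i)" and z'_eq: "\<And>i. i \<in> ?I \<Longrightarrow> z' i = z i"
      by (simp_all add: z'_def)
    have ratio: "\<forall>i\<in>I. z' i \<in> ratios"
      using z(1) \<zeta>_ratio by (auto simp: z'_def intro!: ratios_uminus ratios_sum ratios_mult)
    have "lincomb z s ?I = - z' p \<cdot>\<^sub>m s p"
    proof -
      have "lincomb z s ?I = lincomb z (\<lambda>i. \<zeta> i \<cdot>\<^sub>m s p) ?I"
        by (rule mat_sum_cong[OF refl]) (metis \<zeta> Diff_iff)
      then show ?thesis using sA p by (simp add: lincomb_scalars z'p)
    qed
    then have "0\<^sub>m n n = lincomb z u ?I * s p - u p * (- z' p \<cdot>\<^sub>m s p)"
      using lincomb_v[of ?I z] z(3) by auto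
    also have "\<dots> = (z' p \<cdot>\<^sub>m u p + lincomb z u ?I) * s p"
    proof -
      have "x - - c \<cdot>\<^sub>m y = c \<cdot>\<^sub>m y + x" if "x \<in> carrier_mat n n" "y \<in> carrier_mat n n" for x y :: "'f mat" and c
        using that by (intro eq_matI) auto
      then show ?thesis using u p sA
        by (simp add: smult_left smult_right add_mult_distrib_mat[of _ n n _ _ n])
    qed
    also have "lincomb z u ?I = lincomb z' u ?I"
      by (intro mat_sum_cong) (auto simp: z'_eq)
    also have "z' p \<cdot>\<^sub>m u p + lincomb z' u ?I = lincomb z' u I"
      using fin p u by (intro lincomb_remove[symmetric]) auto
    finally have "lincomb z' u I * s p = 0\<^sub>m n n" by (rule sym)
    then have "lincomb z' u I = 0\<^sub>m n n"
      by (rule cancel_right[OF sA[OF p(1)] p(3) mat_sum_carrier])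
    moreover have "z' i0 = 1" using z p by (simp add: z'_def)
    ultimately show ?thesis using ratio by blast
  qed
qed

lemma pow_mem: "b \<in> A \<Longrightarrow> b ^\<^sub>m j \<in> A"
proof (induction j)
  case 0
  then show ?case using one_mem by simp
qed (simp add: mult_mem)

lemma pow_nonzero: "b \<in> A \<Longrightarrow> b \<noteq> 0\<^sub>m n n \<Longrightarrow> b ^\<^sub>m j \<noteq> 0\<^sub>m n n"
proof (induction j)
  case 0
  then show ?case using one_neq_zero by simp
qed (simp add: mult_nonzero pow_mem)

lemma pow_add: "b \<in> carrier_mat n n \<Longrightarrow> (b :: 'f mat) ^\<^sub>m (i + j) = b ^\<^sub>m i * b ^\<^sub>m j"
proof (induction j)
  case (Suc j)
  then show ?case by (simp add: assoc_mult_mat[of _ n n _ n _ n])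
qed (use pow_carrier_mat in force)

text \<open>
  Among \<open>n\<^sup>2 + 1\<close> powers of \<open>b\<close> there is a relation over the field.  Cancelling the lowest power that
  occurs makes its constant coefficient nonzero, hence \<open>1\<close> without loss of generality, and
  \<open>descent\<close> preserves this.
\<close>

lemma one_combination_of_powers:
  assumes b: "b \<in> A" "b \<noteq> 0\<^sub>m n n"
  shows "\<exists>N z. (\<forall>j\<le>N. z j \<in> ratios) \<and> z 0 = 1 \<and> lincomb z (\<lambda>j. b ^\<^sub>m j) {..N} = 0\<^sub>m n n"
proof -
  have "\<exists>c. (\<exists>i\<in>{..n * n}. c i \<noteq> 0) \<and>
      (\<forall>kl\<in>{..<n} \<times> {..<n}. (\<Sum>i\<in>{..n * n}. c i * (b ^\<^sub>m i) $$ kl) = 0)"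
    by (rule underdetermined_system) auto
  then obtain c where c: "\<exists>i\<in>{..n * n}. c i \<noteq> 0"
    "\<forall>kl\<in>{..<n} \<times> {..<n}. (\<Sum>i\<in>{..n * n}. c i * (b ^\<^sub>m i) $$ kl) = 0" by blast
  have pc: "b ^\<^sub>m i \<in> carrier_mat n n" for i using b pow_mem by blast
  define p where "p = (LEAST i. c i \<noteq> 0)"
  obtain i where i: "i \<le> n * n" "c i \<noteq> 0" using c(1) by auto
  have p: "c p \<noteq> 0" "p \<le> n * n"
    using LeastI[of "\<lambda>i. c i \<noteq> 0", OF i(2)] Least_le[of "\<lambda>i. c i \<noteq> 0", OF i(2)] i(1)
    by (auto simp: p_def)
  have below: "c i = 0" if "i < p" for i
    using not_less_Least[of i "\<lambda>i. c i \<noteq> 0"] that by (auto simp: p_def)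
  let ?N = "n * n - p"
  let ?d = "\<lambda>j. c (p + j) / c p"
  have "b ^\<^sub>m p * lincomb ?d (\<lambda>j. b ^\<^sub>m j) {..?N} = lincomb ?d (\<lambda>j. b ^\<^sub>m (p + j)) {..?N}"
    using b pc by (subst lincomb_mult_left[symmetric]) (auto simp: pow_add)
  also have "\<dots> = 0\<^sub>m n n"
  proof (rule eq_matI)
    fix k l assume kl: "k < dim_row (0\<^sub>m n n :: 'f mat)" "l < dim_col (0\<^sub>m n n :: 'f mat)"
    have "lincomb ?d (\<lambda>j. b ^\<^sub>m (p + j)) {..?N} $$ (k, l) =
        (\<Sum>j\<in>{..?N}. c (p + j) * (b ^\<^sub>m (p + j)) $$ (k, l)) / c p"
      using kl pc by (subst mat_sum_smult_index) (auto simp: sum_divide_distrib)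
    also have "(\<Sum>j\<in>{..?N}. c (p + j) * (b ^\<^sub>m (p + j)) $$ (k, l)) = (\<Sum>i\<in>{p..n * n}. c i * (b ^\<^sub>m i) $$ (k, l))"
      using p by (intro sum.reindex_bij_witness[of _ "\<lambda>i. i - p" "\<lambda>j. p + j"]) auto
    also have "\<dots> = (\<Sum>i\<in>{..n * n}. c i * (b ^\<^sub>m i) $$ (k, l))"
      using below by (intro sum.mono_neutral_left) auto
    also have "\<dots> = 0" using c(2) kl by auto
    finally show "lincomb ?d (\<lambda>j. b ^\<^sub>m (p + j)) {..?N} $$ (k, l) = 0\<^sub>m n n $$ (k, l)"
      using kl by simp
  qed auto
  finally have "lincomb ?d (\<lambda>j. b ^\<^sub>m j) {..?N} = 0\<^sub>m n n"
    by (rule cancel_left[OF pow_mem[OF b(1)] pow_nonzero[OF b] mat_sum_carrier])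
  then have "\<exists>z. (\<forall>j\<in>{..?N}. z j \<in> ratios) \<and> z 0 = 1 \<and> lincomb z (\<lambda>j. b ^\<^sub>m j) {..?N} = 0\<^sub>m n n"
    using p by (intro descent[where c = ?d] pow_mem[OF b(1)]) simp_all
  then show ?thesis by auto
qed

text \<open>
  Multiply a relation \<open>1 + z\<^sub>1 b + \<dots> + z\<^sub>N b\<^sup>N = 0\<close> by \<open>x\<close> and by a common denominator \<open>t\<close> of the \<open>z\<^sub>j\<close>:
  all terms except \<open>x t\<close> have \<open>b\<close> as a left factor.
\<close>

lemma ore_condition:
  assumes "b \<in> A" "b \<noteq> 0\<^sub>m n n" "x \<in> A"
  shows "\<exists>t\<in>A. t \<noteq> 0\<^sub>m n n \<and> (\<exists>h\<in>A. x * t = b * h)"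
proof -
  obtain N z where z: "\<forall>j\<le>N. z j \<in> ratios" "z 0 = 1" "lincomb z (\<lambda>j. b ^\<^sub>m j) {..N} = 0\<^sub>m n n"
    using one_combination_of_powers assms by blast
  obtain t where t: "t \<in> A" "t \<noteq> 0\<^sub>m n n" "\<forall>j\<in>{..N}. z j \<cdot>\<^sub>m t \<in> A"
    using common_denominator[of "{..N}" z] z by auto
  have pc: "b ^\<^sub>m i \<in> carrier_mat n n" for i using assms pow_mem by blast
  define h where "h = mat_sum n (\<lambda>j. b ^\<^sub>m (j - 1) * x * (z j \<cdot>\<^sub>m t)) {1..N}"
  have h: "h \<in> A" unfolding h_def
    using assms t pow_mem by (intro mat_sum_mem mult_mem) auto
  have step: "b * (b ^\<^sub>m (j - 1) * x * (z j \<cdot>\<^sub>m t)) = z j \<cdot>\<^sub>m b ^\<^sub>m j * (x * t)" if "j \<in> {1..N}" for j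
  proof -
    have "b * b ^\<^sub>m (j - 1) = b ^\<^sub>m j"
      using that pow_add[of b 1 "j - 1"] assms by simp
    moreover have "b * (b ^\<^sub>m (j - 1) * x * (z j \<cdot>\<^sub>m t)) = z j \<cdot>\<^sub>m (b * b ^\<^sub>m (j - 1)) * (x * t)"
      using assms t pc by (simp add: smult_left smult_right)
    ultimately show ?thesis by simp
  qed
  have "0\<^sub>m n n = lincomb z (\<lambda>j. b ^\<^sub>m j) {..N} * (x * t)"
    using z assms t by simp
  also have "lincomb z (\<lambda>j. b ^\<^sub>m j) {..N} = z 0 \<cdot>\<^sub>m b ^\<^sub>m 0 + lincomb z (\<lambda>j. b ^\<^sub>m j) ({..N} - {0})"
    using pc by (intro lincomb_remove) auto
  also have "{..N} - {0} = {1..N}" by auto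
  also have "z 0 \<cdot>\<^sub>m b ^\<^sub>m 0 = 1\<^sub>m n"
    using z(2) mem_carrier[OF assms(1)] by (auto simp: one_smult_mat)
  also have "(1\<^sub>m n + lincomb z (\<lambda>j. b ^\<^sub>m j) {1..N}) * (x * t) = x * t + lincomb z (\<lambda>j. b ^\<^sub>m j) {1..N} * (x * t)"
    using assms t by (subst add_mult_distrib_mat[of _ n n _ _ n]) auto
  also have "lincomb z (\<lambda>j. b ^\<^sub>m j) {1..N} * (x * t) = mat_sum n (\<lambda>j. z j \<cdot>\<^sub>m b ^\<^sub>m j * (x * t)) {1..N}"
    using assms t pc by (intro mat_sum_mult_right) auto
  also have "\<dots> = b * h" unfolding h_def
    using assms t pc step by (subst mat_sum_mult_left) (auto intro!: mat_sum_cong)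
  finally have eq: "x * t + b * h = 0\<^sub>m n n" by simp
  have "x * t = b * (- h)"
  proof (rule mat_eq_if_diff_zero)
    have "x * t - b * (- h) = x * t + b * h" using assms t h
      by (intro eq_matI) auto
    then show "x * t - b * (- h) = 0\<^sub>m n n" using eq by simp
  qed (use assms t h in auto)
  then show ?thesis using t h uminus_mem by blast
qed

text \<open>
  The fractions \<open>a t\<^sup>-\<^sup>1\<close>, described without inverses.
\<close>

definition quotients :: "'f mat set" where
  "quotients = {x \<in> carrier_mat n n. \<exists>t\<in>A. t \<noteq> 0\<^sub>m n n \<and> x * t \<in> A}"

lemma subset_quotients: "A \<subseteq> quotients"
  using one_mem one_neq_zero by (auto simp: quotients_def intro!: bexI[of _ "1\<^sub>m n"])

end

locale full_division = full_subring n A e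
  for n :: nat and A :: "'f::field mat set" and e :: "nat \<Rightarrow> 'f mat" +
  assumes inverse_mem: "a \<in> A \<Longrightarrow> a \<noteq> 0\<^sub>m n n \<Longrightarrow> \<exists>b\<in>A. a * b = 1\<^sub>m n \<and> b * a = 1\<^sub>m n"

text \<open>
  The Ore condition brings two fractions to a common denominator, and it moves a denominator past a
  numerator in a product.
\<close>

theorem (in full_subring) quotients_full_division: "full_division n quotients e"
proof
  have incl: "a \<in> quotients" if "a \<in> A" for a
    using that one_mem one_neq_zero by (auto simp: quotients_def intro!: bexI[of _ "1\<^sub>m n"])
  show "0 < n" by (rule n_pos)
  show "quotients \<subseteq> carrier_mat n n" by (auto simp: quotients_def)
  show "1\<^sub>m n \<in> quotients" using incl one_mem by blast
  show "e i \<in> quotients" if "i < n * n" for i using incl basis_mem that by blast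
  show "c i = 0" if "lincomb c e {..<n * n} = 0\<^sub>m n n" "i < n * n" for c i
    using basis_independent that by blast
  fix x assume "x \<in> quotients"
  then obtain t where x: "x \<in> carrier_mat n n" and t: "t \<in> A" "t \<noteq> 0\<^sub>m n n" "x * t \<in> A"
    by (auto simp: quotients_def)
  have "(- x) * t = - (x * t)" using x t by (intro eq_matI) auto
  then show "- x \<in> quotients" using x t uminus_mem[OF t(3)]
    by (auto simp: quotients_def)
  {
    fix y assume "y \<in> quotients"
    then obtain s where y: "y \<in> carrier_mat n n" and s: "s \<in> A" "s \<noteq> 0\<^sub>m n n" "y * s \<in> A"
      by (auto simp: quotients_def)
    obtain q h where q: "q \<in> A" "q \<noteq> 0\<^sub>m n n" "h \<in> A" "t * q = s * h"
      using ore_condition[OF s(1,2) t(1)] by blast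
    have "(x + y) * (t * q) = x * (t * q) + y * (t * q)"
      using x y t s q by (simp add: add_mult_distrib_mat[of _ n n _ _ n])
    also have "\<dots> = (x * t) * q + (y * s) * h"
      using x y t s q by (simp add: q(4))
    finally have "(x + y) * (t * q) \<in> A"
      using add_mem mult_mem t s q by simp
    moreover have "t * q \<in> A" "t * q \<noteq> 0\<^sub>m n n" "x + y \<in> carrier_mat n n"
      using x y mult_mem[OF t(1) q(1)] mult_nonzero t q by (auto simp del: q(4))
    ultimately show "x + y \<in> quotients" unfolding quotients_def by blast
    obtain q' h' where q': "q' \<in> A" "q' \<noteq> 0\<^sub>m n n" "h' \<in> A" "(y * s) * q' = t * h'"
      using ore_condition[OF t(1,2) s(3)] by blast
    have "(x * y) * (s * q') = x * ((y * s) * q')"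
      using x y s q' by simp
    also have "\<dots> = (x * t) * h'" unfolding q'(4) using x t q' by simp
    finally have "(x * y) * (s * q') \<in> A" using mult_mem t q' by simp
    moreover have "s * q' \<in> A" "s * q' \<noteq> 0\<^sub>m n n" "x * y \<in> carrier_mat n n"
      using x y mult_mem[OF s(1) q'(1)] mult_nonzero s q' by auto
    ultimately show "x * y \<in> quotients" unfolding quotients_def by blast
  }
  assume nz: "x \<noteq> 0\<^sub>m n n"
  have "x * t \<noteq> 0\<^sub>m n n" using cancel_right[OF t(1,2) x] nz by blast
  then obtain a where a: "a \<in> carrier_mat n n" "x * t * a = 1\<^sub>m n" "a * (x * t) = 1\<^sub>m n"
    using ex_inverse t(3) by blast
  obtain t' where t': "t' \<in> carrier_mat n n" "t * t' = 1\<^sub>m n" using ex_inverse t by blast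
  have left: "t * a * x = 1\<^sub>m n"
  proof -
    have "t * a * x = t * (a * (x * (t * t')))" unfolding t'(2) using x t a(1) by simp
    also have "\<dots> = t * ((a * (x * t)) * t')" using x t a(1) t'(1) by simp
    also have "\<dots> = 1\<^sub>m n" unfolding a(3) using t t' by simp
    finally show ?thesis .
  qed
  have "t * a * (x * t) = t * (a * (x * t))" using x t a(1) by simp
  then have "t * a * (x * t) \<in> A" unfolding a(3) using t by simp
  then have "t * a \<in> quotients"
    using a(1) t \<open>x * t \<noteq> 0\<^sub>m n n\<close> by (auto simp: quotients_def simp del: assoc_mult_mat)
  moreover have "x * (t * a) = 1\<^sub>m n" using a x t by simp
  ultimately show inv: "\<exists>b\<in>quotients. x * b = 1\<^sub>m n \<and> b * x = 1\<^sub>m n" using left by blast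
  show "\<exists>b\<in>carrier_mat n n. x * b = 1\<^sub>m n \<and> b * x = 1\<^sub>m n"
    using inv by (auto simp: quotients_def)
qed

section \<open>Traces are central ratios\<close>

definition mat_trace :: "'a::comm_monoid_add mat \<Rightarrow> 'a" where
  "mat_trace a = (\<Sum>i<dim_row a. a $$ (i, i))"

lemma mat_trace_mult_comm:
  fixes a :: "'a::comm_semiring_0 mat"
  assumes "a \<in> carrier_mat n n" "b \<in> carrier_mat n n"
  shows "mat_trace (a * b) = mat_trace (b * a)"
proof -
  have "mat_trace (a * b) = (\<Sum>i<n. \<Sum>j<n. a $$ (i, j) * b $$ (j, i))"
    using assms by (auto simp: mat_trace_def scalar_prod_def atLeast0LessThan)
  also have "\<dots> = (\<Sum>j<n. \<Sum>i<n. a $$ (i, j) * b $$ (j, i))" by (rule sum.swap)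
  also have "\<dots> = mat_trace (b * a)"
    using assms by (auto simp: mat_trace_def scalar_prod_def atLeast0LessThan mult.commute)
  finally show ?thesis .
qed

lemma mat_trace_mat_sum:
  assumes "\<And>x. x \<in> I \<Longrightarrow> u x \<in> carrier_mat n n"
  shows "mat_trace (mat_sum n u I) = (\<Sum>x\<in>I. mat_trace (u x))"
proof -
  have "mat_trace (mat_sum n u I) = (\<Sum>i<n. \<Sum>x\<in>I. u x $$ (i, i))"
    by (simp add: mat_trace_def mat_sum_index)
  also have "\<dots> = (\<Sum>x\<in>I. \<Sum>i<n. u x $$ (i, i))" by (rule sum.swap)
  also have "\<dots> = (\<Sum>x\<in>I. mat_trace (u x))"
    using assms by (auto simp: mat_trace_def intro!: sum.cong)
  finally show ?thesis .
qed

lemma mat_trace_smult: "a \<in> carrier_mat n n \<Longrightarrow> mat_trace (c \<cdot>\<^sub>m a) = (c :: 'a::comm_semiring_0) * mat_trace a"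
  by (auto simp: mat_trace_def sum_distrib_left)

lemma mat_trace_diff:
  "a \<in> carrier_mat n n \<Longrightarrow> b \<in> carrier_mat n n \<Longrightarrow> mat_trace (a - b) = mat_trace a - (mat_trace b :: 'a::ab_group_add)"
  by (auto simp: mat_trace_def sum_subtractf)

lemma mat_trace_one: "mat_trace (1\<^sub>m n :: 'a::semiring_1 mat) = of_nat n"
  by (simp add: mat_trace_def)

definition elem_mat :: "nat \<Rightarrow> nat \<Rightarrow> nat \<Rightarrow> 'a::zero_neq_one mat" where
  "elem_mat n k l = mat n n (\<lambda>(i, j). if i = k \<and> j = l then 1 else 0)"

lemma elem_mat_carrier [simp]: "elem_mat n k l \<in> carrier_mat n n"
  by (simp add: elem_mat_def)

lemma elem_mat_mult_index:
  fixes a :: "'a::comm_ring_1 mat"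
  assumes "a \<in> carrier_mat n n" "i < n" "j < n" "k < n" "l < n"
  shows "(elem_mat n k l * a) $$ (i, j) = (if i = k then a $$ (l, j) else 0)"
    "(a * elem_mat n k l) $$ (i, j) = (if j = l then a $$ (i, k) else 0)"
  using assms by (auto simp: elem_mat_def scalar_prod_def if_distrib[of "\<lambda>y. y * _"]
      if_distrib[of "\<lambda>y. _ * y"] sum.delta cong: if_cong)

text \<open>
  With elementary matrices \<open>E\<^sub>k\<^sub>l\<close> one has \<open>[E\<^sub>k\<^sub>l, E\<^sub>l\<^sub>k r] = E\<^sub>k\<^sub>k r - r\<^sub>k\<^sub>k E\<^sub>l\<^sub>l\<close>; summing over \<open>k\<close> and \<open>l\<close>
  gives \<open>n r - tr(r) 1\<close>.  Up to commutators, \<open>n r\<close> is therefore scalar.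
\<close>

lemma sum_elem_mat_commutators:
  fixes r :: "'a::comm_ring_1 mat"
  assumes r: "r \<in> carrier_mat n n" and ab: "a < n" "b < n"
  shows "(\<Sum>k<n. \<Sum>l<n. (elem_mat n k l * (elem_mat n l k * r) - elem_mat n l k * r * elem_mat n k l) $$ (a, b))
    = of_nat n * r $$ (a, b) - (if a = b then mat_trace r else 0)"
proof -
  have "(elem_mat n k l * (elem_mat n l k * r) - elem_mat n l k * r * elem_mat n k l) $$ (a, b)
      = (if a = k then r $$ (a, b) else 0) - (if a = l then if b = l then r $$ (k, k) else 0 else 0)"
    if "k < n" "l < n" for k l
  proof -
    have c: "elem_mat n l k * r \<in> carrier_mat n n" using r by (intro mult_carrier_mat[of _ n n]) auto
    have "(elem_mat n k l * (elem_mat n l k * r)) $$ (a, b) = (if a = k then r $$ (a, b) else 0)"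
      using elem_mat_mult_index(1)[OF c ab that] elem_mat_mult_index(1)[OF r, of l b l k] that ab by auto
    moreover have "(elem_mat n l k * r * elem_mat n k l) $$ (a, b) =
        (if a = l then if b = l then r $$ (k, k) else 0 else 0)"
      using elem_mat_mult_index(2)[OF c ab that] elem_mat_mult_index(1)[OF r, of a k l k] that ab by auto
    moreover have "elem_mat n k l * (elem_mat n l k * r) \<in> carrier_mat n n"
      "elem_mat n l k * r * elem_mat n k l \<in> carrier_mat n n"
      using c by (auto intro!: mult_carrier_mat[of _ n n])
    then have "(elem_mat n k l * (elem_mat n l k * r) - elem_mat n l k * r * elem_mat n k l) $$ (a, b)
        = (elem_mat n k l * (elem_mat n l k * r)) $$ (a, b) - (elem_mat n l k * r * elem_mat n k l) $$ (a, b)"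
      using ab by (intro index_minus_mat(1)) auto
    ultimately show ?thesis by (simp only:)
  qed
  then have "(\<Sum>k<n. \<Sum>l<n. (elem_mat n k l * (elem_mat n l k * r) - elem_mat n l k * r * elem_mat n k l) $$ (a, b))
      = (\<Sum>k<n. \<Sum>l<n. (if a = k then r $$ (a, b) else 0) - (if a = l then if b = l then r $$ (k, k) else 0 else 0))"
    by (intro sum.cong refl) auto
  also have "\<dots> = of_nat n * r $$ (a, b) - (if a = b then mat_trace r else 0)"
    using ab r by (simp add: sum_subtractf sum.delta' mat_trace_def flip: sum_distrib_left)
  finally show ?thesis .
qed

context full_subring
begin

text \<open>
  Expanding the elementary matrices in the basis \<open>e\<close>, the identity
  \<open>n r - tr(r) 1 = \<Sum> [E\<^sub>k\<^sub>l, E\<^sub>l\<^sub>k r]\<close> becomes a relation over the field between \<open>r\<close>, \<open>1\<close> and the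
  commutators \<open>[e\<^sub>i, e\<^sub>j r]\<close>, which all lie in \<open>A\<close>.  By \<open>descent\<close> there is also a relation
  \<open>r + z 1 + \<Sum> z\<^sub>i\<^sub>j [e\<^sub>i, e\<^sub>j r] = 0\<close> with ratios as coefficients.  Its trace is \<open>tr(r) + n z = 0\<close>.
\<close>

theorem trace_in_ratios:
  assumes r: "r \<in> A" and char: "of_nat n \<noteq> (0 :: 'f)"
  shows "mat_trace r \<in> ratios"
proof -
  have "\<exists>\<gamma>. \<forall>k l. elem_mat n k l = lincomb (\<gamma> k l) e {..<n * n}"
    using ex_coordinates[OF elem_mat_carrier] by metis
  then obtain \<gamma> where \<gamma>: "\<And>k l. elem_mat n k l = lincomb (\<gamma> k l) e {..<n * n}" by blast
  define comm where "comm a b = a * b - b * a" for a b :: "'f mat"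
  have comm_A: "comm a b \<in> A" if "a \<in> A" "b \<in> A" for a b
    using that by (auto simp: comm_def intro!: diff_mem mult_mem)
  have comm_left: "comm (lincomb d u I) y = lincomb d (\<lambda>i. comm (u i) y) I"
    and comm_right: "comm y (lincomb d u I) = lincomb d (\<lambda>i. comm y (u i)) I"
    if "y \<in> carrier_mat n n" "\<And>i. i \<in> I \<Longrightarrow> u i \<in> carrier_mat n n" for d y and u :: "nat \<Rightarrow> 'f mat" and I
    using that by (simp_all add: comm_def lincomb_diff lincomb_mult_left lincomb_mult_right)
  let ?N = "{..<n * n}"
  let ?v = "\<lambda>i j. comm (e i) (e j * r)"
  have vA: "?v i j \<in> A" if "i < n * n" "j < n * n" for i j
    using that r by (intro comm_A mult_mem basis_mem)
  define \<beta> where "\<beta> i j = (\<Sum>k<n. \<Sum>l<n. \<gamma> k l i * \<gamma> l k j)" for i j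
  have expand: "(\<Sum>i\<in>?N. \<Sum>j\<in>?N. \<beta> i j * ?v i j $$ (a, b)) =
      of_nat n * r $$ (a, b) - (if a = b then mat_trace r else 0)" if ab: "a < n" "b < n" for a b
  proof -
    have E: "comm (elem_mat n k l) (elem_mat n l k * r) $$ (a, b)
        = (\<Sum>i\<in>?N. \<Sum>j\<in>?N. \<gamma> k l i * \<gamma> l k j * ?v i j $$ (a, b))" for k l
    proof -
      have 1: "elem_mat n l k * r = lincomb (\<gamma> l k) (\<lambda>j. e j * r) ?N"
        unfolding \<gamma>[of l k] using r by (subst lincomb_mult_right) (auto simp: basis_carrier)
      have "comm (elem_mat n k l) (elem_mat n l k * r)
          = lincomb (\<gamma> k l) (\<lambda>i. comm (e i) (lincomb (\<gamma> l k) (\<lambda>j. e j * r) ?N)) ?N"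
        unfolding 1 unfolding \<gamma>[of k l] using r by (intro comm_left) (auto simp: basis_carrier)
      also have "\<dots> = lincomb (\<gamma> k l) (\<lambda>i. lincomb (\<gamma> l k) (?v i) ?N) ?N"
        using r by (intro mat_sum_cong refl arg_cong[of _ _ "(\<cdot>\<^sub>m) _"] comm_right) (auto simp: basis_carrier)
      finally have *: "comm (elem_mat n k l) (elem_mat n l k * r) = \<dots>" .
      have "lincomb (\<gamma> k l) (\<lambda>i. lincomb (\<gamma> l k) (?v i) ?N) ?N $$ (a, b)
          = (\<Sum>i\<in>?N. \<gamma> k l i * lincomb (\<gamma> l k) (?v i) ?N $$ (a, b))"
        using ab by (intro mat_sum_smult_index) auto
      also have "\<dots> = (\<Sum>i\<in>?N. \<gamma> k l i * (\<Sum>j\<in>?N. \<gamma> l k j * ?v i j $$ (a, b)))"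
        using ab by (intro sum.cong refl arg_cong[of _ _ "(*) _"] mat_sum_smult_index) (auto intro: mem_carrier vA)
      finally show ?thesis unfolding * by (simp add: sum_distrib_left mult.assoc)
    qed
    have "(\<Sum>i\<in>?N. \<Sum>j\<in>?N. \<beta> i j * ?v i j $$ (a, b))
        = (\<Sum>i\<in>?N. \<Sum>j\<in>?N. \<Sum>k<n. \<Sum>l<n. \<gamma> k l i * \<gamma> l k j * ?v i j $$ (a, b))"
      by (simp add: \<beta>_def sum_distrib_right)
    also have "\<dots> = (\<Sum>i\<in>?N. \<Sum>k<n. \<Sum>j\<in>?N. \<Sum>l<n. \<gamma> k l i * \<gamma> l k j * ?v i j $$ (a, b))"
      by (rule sum.cong[OF refl], rule sum.swap)
    also have "\<dots> = (\<Sum>i\<in>?N. \<Sum>k<n. \<Sum>l<n. \<Sum>j\<in>?N. \<gamma> k l i * \<gamma> l k j * ?v i j $$ (a, b))"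
      by (rule sum.cong[OF refl], rule sum.cong[OF refl], rule sum.swap)
    also have "\<dots> = (\<Sum>k<n. \<Sum>i\<in>?N. \<Sum>l<n. \<Sum>j\<in>?N. \<gamma> k l i * \<gamma> l k j * ?v i j $$ (a, b))"
      by (rule sum.swap)
    also have "\<dots> = (\<Sum>k<n. \<Sum>l<n. \<Sum>i\<in>?N. \<Sum>j\<in>?N. \<gamma> k l i * \<gamma> l k j * ?v i j $$ (a, b))"
      by (rule sum.cong[OF refl], rule sum.swap)
    also have "\<dots> = (\<Sum>k<n. \<Sum>l<n. comm (elem_mat n k l) (elem_mat n l k * r) $$ (a, b))"
      by (simp only: E)
    also have "\<dots> = of_nat n * r $$ (a, b) - (if a = b then mat_trace r else 0)"
      unfolding comm_def using r ab by (intro sum_elem_mat_commutators) auto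
    finally show ?thesis .
  qed
  \<comment> \<open>The indices \<open>None\<close>, \<open>Some None\<close> and \<open>Some (Some (i, j))\<close> stand for \<open>r\<close>, \<open>1\<close> and \<open>[e\<^sub>i, e\<^sub>j r]\<close>.\<close>
  define I where "I = insert None (insert (Some None) ((Some \<circ> Some) ` (?N \<times> ?N)))"
  define c where "c x = (case x of None \<Rightarrow> 1 | Some None \<Rightarrow> - (mat_trace r / of_nat n)
      | Some (Some (i, j)) \<Rightarrow> - (\<beta> i j / of_nat n))" for x
  define u where "u x = (case x of None \<Rightarrow> r | Some None \<Rightarrow> 1\<^sub>m n | Some (Some (i, j)) \<Rightarrow> ?v i j)" for x
  have fin: "finite I" by (simp add: I_def)
  have uA: "u x \<in> A" if "x \<in> I" for x
    using that r one_mem vA by (auto simp: I_def u_def)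
  have sumI: "(\<Sum>x\<in>I. f x) = f None + f (Some None) + (\<Sum>i\<in>?N. \<Sum>j\<in>?N. f (Some (Some (i, j))))"
    for f :: "_ \<Rightarrow> 'f"
  proof -
    have "(\<Sum>x\<in>I. f x) = f None + (f (Some None) + (\<Sum>x\<in>(Some \<circ> Some) ` (?N \<times> ?N). f x))"
      unfolding I_def by (simp add: image_iff)
    also have "(\<Sum>x\<in>(Some \<circ> Some) ` (?N \<times> ?N). f x) = (\<Sum>i\<in>?N. \<Sum>j\<in>?N. f (Some (Some (i, j))))"
      by (subst sum.reindex) (auto simp: inj_on_def sum.cartesian_product case_prod_beta)
    finally show ?thesis by (simp add: add.assoc)
  qed
  have "lincomb c u I = 0\<^sub>m n n"
  proof (rule eq_matI)
    fix a b assume "a < dim_row (0\<^sub>m n n :: 'f mat)" "b < dim_col (0\<^sub>m n n :: 'f mat)"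
    then have ab: "a < n" "b < n" by auto
    have "lincomb c u I $$ (a, b) = (\<Sum>x\<in>I. c x * u x $$ (a, b))"
      using ab uA by (intro mat_sum_smult_index) auto
    also have "\<dots> = r $$ (a, b) - mat_trace r / of_nat n * (1\<^sub>m n $$ (a, b))
        - (\<Sum>i\<in>?N. \<Sum>j\<in>?N. \<beta> i j * ?v i j $$ (a, b)) / of_nat n"
      unfolding sumI by (simp add: c_def u_def sum_negf sum_divide_distrib)
    also have "\<dots> = 0"
      unfolding expand[OF ab] using char ab by (simp add: field_simps)
    finally show "lincomb c u I $$ (a, b) = 0\<^sub>m n n $$ (a, b)" using ab by simp
  qed auto
  then obtain z where z: "\<forall>x\<in>I. z x \<in> ratios" "z None = 1" "lincomb z u I = 0\<^sub>m n n"
    using descent[of I None c u] fin uA by (auto simp: I_def c_def)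
  have "0 = mat_trace (lincomb z u I)" unfolding z(3) by (simp add: mat_trace_def)
  also have "\<dots> = (\<Sum>x\<in>I. z x * mat_trace (u x))"
    using uA by (subst mat_trace_mat_sum) (auto intro!: sum.cong simp: mat_trace_smult[of _ n])
  also have "\<dots> = mat_trace r + z (Some None) * of_nat n + (\<Sum>i\<in>?N. \<Sum>j\<in>?N. z (Some (Some (i, j))) * mat_trace (?v i j))"
    unfolding sumI by (simp add: u_def z(2) mat_trace_one)
  also have "(\<Sum>i\<in>?N. \<Sum>j\<in>?N. z (Some (Some (i, j))) * mat_trace (?v i j)) = 0"
  proof (intro sum.neutral ballI)
    fix i j assume "i \<in> ?N" "j \<in> ?N"
    then have "e i \<in> carrier_mat n n" "e j * r \<in> carrier_mat n n" using r by (auto simp: basis_carrier)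
    then have "mat_trace (?v i j) = 0"
      unfolding comm_def
      by (simp add: mat_trace_diff[of _ n] mat_trace_mult_comm[of "e i" n] del: assoc assoc_mult_mat)
    then show "z (Some (Some (i, j))) * mat_trace (?v i j) = 0" by simp
  qed
  finally have "mat_trace r = - (z (Some None) * of_nat n)"
    by (simp add: eq_neg_iff_add_eq_0)
  moreover have "of_nat k \<in> ratios" for k
    by (induction k) (auto simp: ratios_0 ratios_1 ratios_add)
  moreover have "z (Some None) \<in> ratios" using z(1) by (auto simp: I_def)
  ultimately show ?thesis by (simp add: ratios_uminus ratios_mult)
qed

end

section \<open>Center and degree of a division ring of matrices\<close>

context full_division
begin

lemma ratios_iff: "z \<in> ratios \<longleftrightarrow> z \<cdot>\<^sub>m 1\<^sub>m n \<in> A"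
proof
  assume "z \<in> ratios"
  then obtain t where t: "t \<in> A" "t \<noteq> 0\<^sub>m n n" "z \<cdot>\<^sub>m t \<in> A" using ratiosE by blast
  obtain b where b: "b \<in> A" "t * b = 1\<^sub>m n" using inverse_mem t by blast
  have "(z \<cdot>\<^sub>m t) * b = z \<cdot>\<^sub>m 1\<^sub>m n" using t b by (simp add: smult_left)
  then show "z \<cdot>\<^sub>m 1\<^sub>m n \<in> A" using mult_mem[OF t(3) b(1)] by simp
qed (use one_mem one_neq_zero ratiosI in blast)

lemma smult_mem: "z \<in> ratios \<Longrightarrow> a \<in> A \<Longrightarrow> z \<cdot>\<^sub>m a \<in> A"
  using mult_mem[of "z \<cdot>\<^sub>m 1\<^sub>m n" a] by (simp add: ratios_iff smult_left)

text \<open>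
  Apply \<open>descent\<close> to the relation that expresses \<open>a\<close> in the basis, with \<open>a\<close> as the element whose
  coefficient stays \<open>1\<close>.
\<close>

lemma ratio_coordinates:
  assumes a: "a \<in> A"
  shows "\<exists>z. (\<forall>i<n * n. z i \<in> ratios) \<and> a = mat_sum n (\<lambda>i. z i \<cdot>\<^sub>m e i) {..<n * n}"
proof -
  obtain c where c: "a = lincomb c e {..<n * n}" using ex_coordinates a by blast
  let ?c = "\<lambda>i. if i = n * n then 1 else - c i"
  let ?u = "\<lambda>i. if i = n * n then a else e i"
  have split: "lincomb d ?u {..n * n} = d (n * n) \<cdot>\<^sub>m a + lincomb d e {..<n * n}" for d
  proof -
    have "lincomb d ?u {..n * n} = d (n * n) \<cdot>\<^sub>m ?u (n * n) + lincomb d ?u ({..n * n} - {n * n})"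
      using a by (intro lincomb_remove) (auto simp: basis_carrier)
    also have "lincomb d ?u ({..n * n} - {n * n}) = lincomb d e {..<n * n}"
      by (intro mat_sum_cong) auto
    finally show ?thesis by simp
  qed
  have neg: "lincomb (\<lambda>i. - d i) e {..<n * n} = - lincomb d e {..<n * n}" for d
  proof (rule eq_matI)
    fix k l assume "k < dim_row (- lincomb d e {..<n * n})" "l < dim_col (- lincomb d e {..<n * n})"
    then have kl: "k < n" "l < n" by auto
    have "lincomb h e {..<n * n} $$ (k, l) = (\<Sum>i<n * n. h i * e i $$ (k, l))" for h
      using kl by (intro mat_sum_smult_index) (auto simp: basis_carrier)
    then show "lincomb (\<lambda>i. - d i) e {..<n * n} $$ (k, l) = (- lincomb d e {..<n * n}) $$ (k, l)"
      using kl by (simp add: sum_negf)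
  qed auto
  have "lincomb ?c ?u {..n * n} = 1 \<cdot>\<^sub>m a + lincomb ?c e {..<n * n}" by (simp add: split)
  also have "lincomb ?c e {..<n * n} = lincomb (\<lambda>i. - c i) e {..<n * n}"
    by (intro mat_sum_cong) auto
  also have "\<dots> = - a" by (simp add: neg flip: c)
  also have "1 \<cdot>\<^sub>m a + - a = 0\<^sub>m n n" using a by (intro eq_matI) auto
  finally have "lincomb ?c ?u {..n * n} = 0\<^sub>m n n" .
  then have "\<exists>z. (\<forall>i\<in>{..n * n}. z i \<in> ratios) \<and> z (n * n) = 1 \<and> lincomb z ?u {..n * n} = 0\<^sub>m n n"
    using a by (intro descent[where c = ?c]) (auto simp: basis_mem)
  then obtain z where z: "\<forall>i\<in>{..n * n}. z i \<in> ratios" "z (n * n) = 1" "lincomb z ?u {..n * n} = 0\<^sub>m n n"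
    by blast
  have "a + lincomb z e {..<n * n} = 0\<^sub>m n n" using z(3) by (simp add: split z(2) one_smult_mat)
  moreover have "a - lincomb (\<lambda>i. - z i) e {..<n * n} = a + lincomb z e {..<n * n}"
    unfolding neg using a by (intro eq_matI) auto
  ultimately have "a = lincomb (\<lambda>i. - z i) e {..<n * n}"
    using mat_eq_if_diff_zero[OF mem_carrier[OF a] mat_sum_carrier] by metis
  then show ?thesis using z(1) ratios_uminus by (intro exI[of _ "\<lambda>i. - z i"]) auto
qed

abbreviation M :: "'f mat ring" where "M \<equiv> ring_mat TYPE('f) n ()"
abbreviation R :: "'f mat ring" where "R \<equiv> M\<lparr>carrier := A\<rparr>"

lemma subring_M: "subring A M"
proof -
  interpret M: ring M by (rule ring_mat)
  have "\<ominus>\<^bsub>M\<^esub> a = - a" if "a \<in> A" for a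
    using that by (intro M.minus_equality) (auto simp: ring_mat_simps)
  then show ?thesis
    by (intro M.subringI) (auto simp: ring_mat_simps one_mem uminus_mem mult_mem add_mem)
qed

lemma ring_R: "ring R"
  using ring.subring_is_ring[OF ring_mat subring_M] .

lemma R_simps [simp]:
  "a \<otimes>\<^bsub>R\<^esub> b = a * b" "a \<oplus>\<^bsub>R\<^esub> b = a + b" "\<one>\<^bsub>R\<^esub> = 1\<^sub>m n" "\<zero>\<^bsub>R\<^esub> = 0\<^sub>m n n" "carrier R = A"
  by (simp_all add: ring_mat_simps)

lemma Units_R: "Units R = A - {0\<^sub>m n n}"
proof -
  have "a \<noteq> 0\<^sub>m n n" if "a \<in> A" "b \<in> A" "b * a = 1\<^sub>m n" for a b
    using that one_neq_zero by auto
  then show ?thesis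
    unfolding Units_def R_simps using inverse_mem by blast
qed

lemma center_R: "ring_center R = (\<lambda>z. z \<cdot>\<^sub>m 1\<^sub>m n) ` ratios"
proof (intro equalityI subsetI)
  fix x assume "x \<in> ring_center R"
  then have x: "x \<in> A" "\<And>a. a \<in> A \<Longrightarrow> x * a = a * x" by (auto simp: ring_center_def ring_mat_simps)
  then obtain z where "x = z \<cdot>\<^sub>m 1\<^sub>m n" using commuting_imp_scalar[of x] by (metis mem_carrier)
  then show "x \<in> (\<lambda>z. z \<cdot>\<^sub>m 1\<^sub>m n) ` ratios" using x by (auto simp: ratios_iff)
next
  fix x assume "x \<in> (\<lambda>z. z \<cdot>\<^sub>m 1\<^sub>m n) ` ratios"
  then show "x \<in> ring_center R"
    by (auto simp: ring_center_def ring_mat_simps ratios_iff smult_left smult_right)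
qed

lemma subfield_scalars:
  assumes S: "S \<subseteq> ratios" "1 \<in> S" "\<And>y z. y \<in> S \<Longrightarrow> z \<in> S \<Longrightarrow> y + z \<in> S"
    "\<And>y z. y \<in> S \<Longrightarrow> z \<in> S \<Longrightarrow> y * z \<in> S" "\<And>z. z \<in> S \<Longrightarrow> - z \<in> S" "\<And>z. z \<in> S \<Longrightarrow> inverse z \<in> S"
  shows "subfield ((\<lambda>z. z \<cdot>\<^sub>m 1\<^sub>m n) ` S) R"
proof -
  let ?K = "(\<lambda>z. z \<cdot>\<^sub>m 1\<^sub>m n) ` S"
  interpret R: ring R by (rule ring_R)
  have KA: "?K \<subseteq> A" using S(1) ratios_iff by blast
  have minus: "\<ominus>\<^bsub>R\<^esub> a = - a" if "a \<in> A" for a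
    using that by (intro R.minus_equality) (auto simp: uminus_mem ring_mat_simps)
  have mult: "(y \<cdot>\<^sub>m 1\<^sub>m n) * (z \<cdot>\<^sub>m 1\<^sub>m n) = (y * z) \<cdot>\<^sub>m (1\<^sub>m n :: 'f mat)" for y z
    by (simp add: smult_left smult_right smult_smult_mat mult.commute)
  have one: "1 \<cdot>\<^sub>m 1\<^sub>m n = (1\<^sub>m n :: 'f mat)" by (simp add: one_smult_mat)
  have zero_iff: "z \<cdot>\<^sub>m 1\<^sub>m n = (0\<^sub>m n n :: 'f mat) \<longleftrightarrow> z = 0" for z
    using smult_mat_eq_0_iff[of "1\<^sub>m n" n z] one_neq_zero by auto
  show ?thesis
  proof (rule R.subfieldI[OF R.subcringI[OF R.subringI]])
    show "?K \<subseteq> carrier R" using KA by simp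
    show "\<one>\<^bsub>R\<^esub> \<in> ?K" using S(2) by (intro image_eqI[of _ _ 1]) (simp_all add: one)
    show "\<ominus>\<^bsub>R\<^esub> h \<in> ?K" if h: "h \<in> ?K" for h
    proof -
      obtain z where z: "z \<in> S" "h = z \<cdot>\<^sub>m 1\<^sub>m n" using h by blast
      have "- h = (- z) \<cdot>\<^sub>m 1\<^sub>m n" unfolding z(2) by (intro eq_matI) auto
      moreover have "\<ominus>\<^bsub>R\<^esub> h = - h" using minus h KA by blast
      ultimately show ?thesis using S(5) z by (metis image_eqI)
    qed
    show "h \<otimes>\<^bsub>R\<^esub> k \<in> ?K" if "h \<in> ?K" "k \<in> ?K" for h k
      using that S(4) by (auto simp: ring_mat_simps mult)
    show "h \<oplus>\<^bsub>R\<^esub> k \<in> ?K" if hk: "h \<in> ?K" "k \<in> ?K" for h k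
    proof -
      obtain y z where z: "z \<in> S" "y \<in> S" "h = z \<cdot>\<^sub>m 1\<^sub>m n" "k = y \<cdot>\<^sub>m 1\<^sub>m n" using hk by blast
      have "h \<oplus>\<^bsub>R\<^esub> k = (z + y) \<cdot>\<^sub>m 1\<^sub>m n"
        unfolding z R_simps by (intro eq_matI) auto
      then show ?thesis using S(3) z by blast
    qed
    show "h \<otimes>\<^bsub>R\<^esub> k = k \<otimes>\<^bsub>R\<^esub> h" if "h \<in> ?K" "k \<in> ?K" for h k
      using that by (auto simp: ring_mat_simps mult mult.commute)
    show "Units (R\<lparr>carrier := ?K\<rparr>) = ?K - {\<zero>\<^bsub>R\<^esub>}"
    proof (intro equalityI subsetI)
      fix x assume "x \<in> Units (R\<lparr>carrier := ?K\<rparr>)"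
      then have "x \<in> ?K" "\<exists>y\<in>?K. y * x = 1\<^sub>m n" by (auto simp: Units_def ring_mat_simps)
      then show "x \<in> ?K - {\<zero>\<^bsub>R\<^esub>}" using KA one_neq_zero by (auto simp: ring_mat_simps)
    next
      fix x assume x: "x \<in> ?K - {\<zero>\<^bsub>R\<^esub>}"
      then obtain z where z: "z \<in> S" "x = z \<cdot>\<^sub>m 1\<^sub>m n" by blast
      with x have nz: "z \<noteq> 0" using zero_iff by (auto simp: ring_mat_simps)
      have "inverse z \<cdot>\<^sub>m 1\<^sub>m n \<in> ?K" using S(6) z by blast
      moreover have "x * (inverse z \<cdot>\<^sub>m 1\<^sub>m n) = 1\<^sub>m n" "(inverse z \<cdot>\<^sub>m 1\<^sub>m n) * x = 1\<^sub>m n"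
        unfolding z mult using nz one by simp_all
      ultimately show "x \<in> Units (R\<lparr>carrier := ?K\<rparr>)" using x by (auto simp: Units_def ring_mat_simps)
    qed
  qed
qed

lemma subfield_center: "subfield (ring_center R) R"
  unfolding center_R
  by (rule subfield_scalars) (auto simp: ratios_1 ratios_add ratios_mult ratios_uminus ratios_inverse)

lemma combine_scalars:
  assumes "set us \<subseteq> A" "set zs \<subseteq> ratios"
  shows "ring.combine R (map (\<lambda>z. z \<cdot>\<^sub>m 1\<^sub>m n) zs) us =
    mat_sum n (\<lambda>i. zs ! i \<cdot>\<^sub>m us ! i) {..<min (length zs) (length us)}"
proof -
  interpret R: ring R by (rule ring_R)
  show ?thesis using assms
  proof (induction zs arbitrary: us)
    case (Cons z zs us')
    show ?case
    proof (cases us')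
      case (Cons u us)
      note 1 = Cons.IH[of us] Cons.prems[unfolded Cons]
    have "{..<min (length (z # zs)) (length (u # us))} = insert 0 (Suc ` {..<min (length zs) (length us)})"
      by (simp add: lessThan_Suc_eq_insert_0)
    moreover have "mat_sum n (\<lambda>i. (z # zs) ! i \<cdot>\<^sub>m (u # us) ! i) (insert 0 (Suc ` {..<min (length zs) (length us)}))
        = z \<cdot>\<^sub>m u + mat_sum n (\<lambda>i. (z # zs) ! i \<cdot>\<^sub>m (u # us) ! i) (Suc ` {..<min (length zs) (length us)})"
      using 1 by (subst mat_sum_insert) auto
    moreover have "mat_sum n (\<lambda>i. (z # zs) ! i \<cdot>\<^sub>m (u # us) ! i) (Suc ` {..<min (length zs) (length us)})
        = mat_sum n (\<lambda>i. zs ! i \<cdot>\<^sub>m us ! i) {..<min (length zs) (length us)}"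
      by (simp add: mat_sum_def sum.reindex)
    ultimately show ?thesis using 1 unfolding Cons by (simp add: smult_left ring_mat_simps)
    qed (simp add: ring_mat_simps)
  qed (simp add: ring_mat_simps)
qed

text \<open>
  The basis of all matrices over the field is a basis of \<open>A\<close> over its center: independence is
  inherited from the larger field, and \<open>ratio_coordinates\<close> shows that it spans.
\<close>

theorem dimension_R: "ring.dimension R (n * n) (ring_center R) A"
proof -
  interpret R: ring R by (rule ring_R)
  let ?us = "map e [0..<n * n]"
  let ?s = "\<lambda>z. z \<cdot>\<^sub>m 1\<^sub>m n"
  have us: "set ?us \<subseteq> A" using basis_mem by auto
  have ex_zs: "\<exists>zs. Ks = map ?s zs \<and> set zs \<subseteq> ratios" if "set Ks \<subseteq> ring_center R" for Ks
  proof -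
    have "\<forall>k\<in>set Ks. \<exists>z\<in>ratios. k = ?s z" using that unfolding center_R by blast
    then obtain f where f: "\<forall>k\<in>set Ks. f k \<in> ratios \<and> k = ?s (f k)" by metis
    then have "Ks = map ?s (map f Ks)" by (simp add: map_idI)
    then show ?thesis using f by (intro exI[of _ "map f Ks"]) auto
  qed
  have "R.independent (ring_center R) ?us"
  proof (rule R.trivial_combine_imp_independent[OF subfield_center])
    fix Ks assume Ks: "set Ks \<subseteq> ring_center R" and zero: "R.combine Ks ?us = \<zero>\<^bsub>R\<^esub>"
    obtain zs where zs: "Ks = map ?s zs" "set zs \<subseteq> ratios" using ex_zs[OF Ks] by blast
    let ?m = "min (length zs) (n * n)"
    let ?c = "\<lambda>i. if i < length zs then zs ! i else 0"
    have "0\<^sub>m n n = mat_sum n (\<lambda>i. zs ! i \<cdot>\<^sub>m ?us ! i) {..<?m}"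
      using zero combine_scalars[OF us zs(2)] by (simp add: zs(1))
    also have "\<dots> = lincomb ?c e {..<n * n}"
    proof (rule eq_matI)
      fix k l assume "k < dim_row (lincomb ?c e {..<n * n})" "l < dim_col (lincomb ?c e {..<n * n})"
      then have kl: "k < n" "l < n" by auto
      have "lincomb ?c e {..<n * n} $$ (k, l) = (\<Sum>i<n * n. ?c i * e i $$ (k, l))"
        using kl by (intro mat_sum_smult_index) (auto simp: basis_carrier)
      also have "\<dots> = (\<Sum>i<?m. ?c i * e i $$ (k, l))"
        by (intro sum.mono_neutral_right) auto
      also have "\<dots> = (\<Sum>i<?m. (zs ! i \<cdot>\<^sub>m ?us ! i) $$ (k, l))"
      proof (rule sum.cong[OF refl])
        fix i assume "i \<in> {..<?m}"
        then show "?c i * e i $$ (k, l) = (zs ! i \<cdot>\<^sub>m ?us ! i) $$ (k, l)"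
          using kl basis_carrier[of i] by auto
      qed
      finally show "mat_sum n (\<lambda>i. zs ! i \<cdot>\<^sub>m ?us ! i) {..<?m} $$ (k, l) = lincomb ?c e {..<n * n} $$ (k, l)"
        using kl by (simp add: mat_sum_index)
    qed auto
    finally have "lincomb ?c e {..<n * n} = 0\<^sub>m n n" by (rule sym)
    then have "\<forall>i<n * n. ?c i = 0" using basis_independent[of ?c] by blast
    then have "\<forall>i<?m. zs ! i = 0" by (metis min_less_iff_conj)
    moreover have "0 \<cdot>\<^sub>m 1\<^sub>m n = (0\<^sub>m n n :: 'f mat)" by auto
    ultimately show "set (take (length ?us) Ks) \<subseteq> {\<zero>\<^bsub>R\<^esub>}"
      by (auto simp: zs(1) in_set_conv_nth ring_mat_simps)
  qed (use us in simp)
  moreover have "R.Span (ring_center R) ?us = A"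
  proof (rule equalityI)
    show "R.Span (ring_center R) ?us \<subseteq> A"
      using R.Span_in_carrier[of "ring_center R" ?us] us by (auto simp: ring_center_def)
    show "A \<subseteq> R.Span (ring_center R) ?us"
    proof
      fix a assume "a \<in> A"
      then obtain z where z: "\<forall>i<n * n. z i \<in> ratios" "a = lincomb z e {..<n * n}"
        using ratio_coordinates by blast
      let ?zs = "map z [0..<n * n]"
      have "set ?zs \<subseteq> ratios" using z(1) by auto
      from combine_scalars[OF us this]
      have "R.combine (map ?s ?zs) ?us = mat_sum n (\<lambda>i. ?zs ! i \<cdot>\<^sub>m ?us ! i) {..<n * n}"
        by simp
      also have "\<dots> = a" unfolding z(2) by (intro mat_sum_cong) auto
      finally have "a = R.combine (map ?s ?zs) ?us" by (rule sym)
      moreover have "set (map ?s ?zs) \<subseteq> ring_center R" using z(1) by (auto simp: center_R)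
      ultimately have "a \<in> {R.combine Ks ?us | Ks. set Ks \<subseteq> ring_center R}" by blast
      moreover have "R.Span (ring_center R) ?us = {R.combine Ks ?us | Ks. set Ks \<subseteq> ring_center R}"
        using us by (intro R.Span_eq_combine_set[OF subfield_center]) simp
      ultimately show "a \<in> R.Span (ring_center R) ?us" by (simp only:)
    qed
  qed
  ultimately show ?thesis using R.dimensionI[OF subfield_center, of ?us A] by simp
qed

lemma division_algebra_R:
  assumes S: "S \<subseteq> ratios" "1 \<in> S" "\<And>y z. y \<in> S \<Longrightarrow> z \<in> S \<Longrightarrow> y + z \<in> S"
    "\<And>y z. y \<in> S \<Longrightarrow> z \<in> S \<Longrightarrow> y * z \<in> S" "\<And>z. z \<in> S \<Longrightarrow> - z \<in> S" "\<And>z. z \<in> S \<Longrightarrow> inverse z \<in> S"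
  shows "division_algebra ((\<lambda>z. z \<cdot>\<^sub>m 1\<^sub>m n) ` S) R"
  unfolding division_algebra_def
  using ring_R one_neq_zero Units_R subfield_scalars[OF assms] S(1) by (auto simp: center_R ring_mat_simps)

lemma division_degree_R: "division_degree R = real n" and centrally_finite_R: "centrally_finite R"
proof -
  interpret R: ring R by (rule ring_R)
  have "R.dim (ring_center R) A = n * n"
    using R.dimI[OF subfield_center dimension_R] by (simp add: over_def)
  then show "division_degree R = real n" by (simp add: division_degree_def)
  show "centrally_finite R"
    using R.finite_dimensionI[OF dimension_R] by (simp add: centrally_finite_def)
qed

end

section \<open>Generic matrices and skew polynomials\<close>

text \<open>
  Evaluation of polynomials at elements of an arbitrary commutative ring, along a map of the
  coefficients.  The substitution \<open>gsubst\<close> only covers polynomials as values.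
\<close>

definition gpoly_eval :: "('k::field \<Rightarrow> 'r::comm_ring_1) \<Rightarrow> (gvar \<Rightarrow> 'r) \<Rightarrow> 'k gpoly \<Rightarrow> 'r" where
  "gpoly_eval \<phi> x p = (\<Sum>a\<in>Poly_Mapping.keys p.
     \<phi> (Poly_Mapping.lookup p a) * (\<Prod>v\<in>Poly_Mapping.keys a. x v ^ Poly_Mapping.lookup a v))"

context
  fixes \<phi> :: "'k::field \<Rightarrow> 'r::comm_ring_1" and x :: "gvar \<Rightarrow> 'r"
  assumes hom: "comm_ring_hom \<phi>"
begin

interpretation \<phi>: comm_ring_hom \<phi> by (rule hom)

lemma gpoly_eval_superset:
  assumes "finite S" "Poly_Mapping.keys p \<subseteq> S"
  shows "gpoly_eval \<phi> x p = (\<Sum>a\<in>S. \<phi> (Poly_Mapping.lookup p a) * (\<Prod>v\<in>Poly_Mapping.keys a. x v ^ Poly_Mapping.lookup a v))"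
  unfolding gpoly_eval_def using assms
  by (intro sum.mono_neutral_left) (auto simp: in_keys_iff)

lemma monomial_eval_add:
  "(\<Prod>v\<in>Poly_Mapping.keys (a + b). x v ^ Poly_Mapping.lookup (a + b) v) =
   (\<Prod>v\<in>Poly_Mapping.keys a. x v ^ Poly_Mapping.lookup a v) * (\<Prod>v\<in>Poly_Mapping.keys b. x v ^ Poly_Mapping.lookup b v)"
proof -
  let ?S = "Poly_Mapping.keys a \<union> Poly_Mapping.keys b"
  have superset: "(\<Prod>v\<in>Poly_Mapping.keys c. x v ^ Poly_Mapping.lookup c v) = (\<Prod>v\<in>?S. x v ^ Poly_Mapping.lookup c v)"
    if "Poly_Mapping.keys c \<subseteq> ?S" for c
    using that by (intro prod.mono_neutral_left) (auto simp: in_keys_iff)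
  show ?thesis
    by (subst superset[OF keys_add]) (simp add: superset[of a] superset[of b] lookup_add power_add prod.distrib)
qed

lemma gpoly_eval_add: "gpoly_eval \<phi> x (p + q) = gpoly_eval \<phi> x p + gpoly_eval \<phi> x q"
proof -
  let ?S = "Poly_Mapping.keys p \<union> Poly_Mapping.keys q"
  have "gpoly_eval \<phi> x (p + q) = (\<Sum>a\<in>?S. \<phi> (Poly_Mapping.lookup (p + q) a) *
      (\<Prod>v\<in>Poly_Mapping.keys a. x v ^ Poly_Mapping.lookup a v))"
    by (intro gpoly_eval_superset) (simp_all add: keys_add)
  also have "\<dots> = gpoly_eval \<phi> x p + gpoly_eval \<phi> x q"
    by (simp add: lookup_add \<phi>.hom_add distrib_right sum.distrib gpoly_eval_superset[of ?S])
  finally show ?thesis .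
qed

lemma gpoly_eval_sum: "gpoly_eval \<phi> x (sum f S) = (\<Sum>i\<in>S. gpoly_eval \<phi> x (f i))"
  by (induction S rule: infinite_finite_induct) (auto simp: gpoly_eval_add, simp_all add: gpoly_eval_def)

lemma gpoly_eval_single:
  "gpoly_eval \<phi> x (Poly_Mapping.single a c) = \<phi> c * (\<Prod>v\<in>Poly_Mapping.keys a. x v ^ Poly_Mapping.lookup a v)"
  by (simp add: gpoly_eval_def)

lemma gpoly_eval_mult: "gpoly_eval \<phi> x (p * q) = gpoly_eval \<phi> x p * gpoly_eval \<phi> x q"
proof -
  let ?P = "Poly_Mapping.keys p" and ?Q = "Poly_Mapping.keys q"
  have "gpoly_eval \<phi> x (p * q) = gpoly_eval \<phi> x
      ((\<Sum>a\<in>?P. Poly_Mapping.single a (Poly_Mapping.lookup p a)) *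
       (\<Sum>b\<in>?Q. Poly_Mapping.single b (Poly_Mapping.lookup q b)))"
    by (simp only: gpoly_sum_single)
  also have "\<dots> = gpoly_eval \<phi> x p * gpoly_eval \<phi> x q"
    by (simp add: sum_product gpoly_eval_sum mult_single gpoly_eval_single monomial_eval_add \<phi>.hom_mult
        gpoly_eval_def[of \<phi> x p] gpoly_eval_def[of \<phi> x q] mult_ac)
  finally show ?thesis .
qed

lemma gpoly_eval_gconst [simp]: "gpoly_eval \<phi> x (gconst c) = \<phi> c"
  by (simp add: gconst_def gpoly_eval_single)

lemma gpoly_eval_gvar [simp]: "gpoly_eval \<phi> x (gvar v) = x v"
  by (simp add: gvar_def gpoly_eval_single)

lemma gpoly_eval_hom: "comm_ring_hom (gpoly_eval \<phi> x)"
proof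
  show "gpoly_eval \<phi> x 1 = 1" using gpoly_eval_gconst[of 1] by (simp del: gpoly_eval_gconst)
qed (simp_all add: gpoly_eval_add gpoly_eval_mult, simp add: gpoly_eval_def)

end

text \<open>
  The substitution \<open>\<sigma>\<close> that moves the entries of each generic matrix one step down along the cyclic
  diagonals.
\<close>

definition cyc_shift :: "nat \<Rightarrow> 'k::field gpoly \<Rightarrow> 'k gpoly" where
  "cyc_shift n = gsubst (\<lambda>(h, i, j). gvar (h, Suc i mod n, Suc j mod n))"

text \<open>
  The entry in row \<open>i\<close> and column \<open>j\<close> gets the weight \<open>j - i\<close> modulo \<open>n\<close>, recorded as the exponent of
  a new variable \<open>s\<close>.
\<close>

definition grading :: "nat \<Rightarrow> 'k::field gpoly \<Rightarrow> 'k gpoly poly" where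
  "grading n = gpoly_eval (\<lambda>c. [:gconst c:]) (\<lambda>(h, i, j). Polynomial.monom (gvar (h, i, j)) ((j + (n - i)) mod n))"

text \<open>
  These matrices are the standard \<open>n\<close>-dimensional representation of skew polynomials \<open>\<Sum> a\<^sub>e s\<^sup>e\<close> with
  \<open>s a = \<sigma>(a) s\<close>: the coefficient of \<open>s\<^sup>e\<close> is supported on the \<open>e\<close>-th cyclic diagonal, and its
  entries there are \<open>a\<^sub>e, \<sigma>(a\<^sub>e), \<sigma>\<^sup>2(a\<^sub>e), \<dots>\<close>.
\<close>

definition cyclic :: "nat \<Rightarrow> 'k::field gpoly poly mat \<Rightarrow> bool" where
  "cyclic n B \<longleftrightarrow> B \<in> carrier_mat n n \<and> (\<forall>i<n. \<forall>j<n. \<forall>e.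
     Polynomial.coeff (B $$ (Suc i mod n, Suc j mod n)) e = cyc_shift n (Polynomial.coeff (B $$ (i, j)) e) \<and>
     (Polynomial.coeff (B $$ (i, j)) e \<noteq> 0 \<longrightarrow> (i + e) mod n = j))"

lemma const_hom: "comm_ring_hom (\<lambda>c::'k::field. [:gconst c:])"
  by unfold_locales (simp_all add: one_pCons)

lemma grading_hom: "comm_ring_hom (grading n)"
  unfolding grading_def by (rule gpoly_eval_hom[OF const_hom])

text \<open>
  Setting \<open>s = 1\<close> undoes the grading, which is therefore injective.
\<close>

lemma poly_grading_1: "poly (grading n p) 1 = p"
proof -
  have "poly (grading n p) 1 = gsubst gvar p"
    by (simp add: grading_def gpoly_eval_def gsubst_def gmonom_eval_def poly_sum poly_prod poly_monom case_prod_beta)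
  then show ?thesis by simp
qed

lemma grading_gconst: "grading n (gconst c) = [:gconst c:]"
  and grading_gvar: "grading n (gvar (h, i, j)) = Polynomial.monom (gvar (h, i, j)) ((j + (n - i)) mod n)"
  by (simp_all add: grading_def gpoly_eval_gconst[OF const_hom] gpoly_eval_gvar[OF const_hom])

lemma cyc_shift_simps [simp]:
  "cyc_shift n 0 = 0" "cyc_shift n (p + q) = cyc_shift n p + cyc_shift n q"
  "cyc_shift n (p * q) = cyc_shift n p * cyc_shift n q" "cyc_shift n (gconst c) = gconst c"
  "cyc_shift n (gvar (h, i, j)) = gvar (h, Suc i mod n, Suc j mod n)"
  "cyc_shift n (sum f S) = (\<Sum>x\<in>S. cyc_shift n (f x))"
  by (simp_all add: cyc_shift_def gsubst_sum)

lemma bij_betw_Suc_mod: "0 < n \<Longrightarrow> bij_betw (\<lambda>i. Suc i mod n) {..<n} {..<n}"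
proof -
  assume n: "0 < n"
  have "inj_on (\<lambda>i. Suc i mod n) {..<n}"
    by (rule inj_onI) (auto simp: mod_Suc split: if_splits)
  moreover have "(\<lambda>i. Suc i mod n) ` {..<n} \<subseteq> {..<n}" using n by auto
  ultimately show ?thesis by (simp add: bij_betw_def endo_inj_surj)
qed

lemma Suc_mod_inj: "i < n \<Longrightarrow> j < n \<Longrightarrow> Suc i mod n = Suc j mod n \<longleftrightarrow> i = j"
  by (auto simp: mod_Suc split: if_splits)

lemma cyclic_add:
  assumes B: "cyclic n B" and C: "cyclic n C" and n: "0 < n"
  shows "cyclic n (B + C)"
proof -
  have car: "B \<in> carrier_mat n n" "C \<in> carrier_mat n n" using B C by (simp_all add: cyclic_def)
  have entry: "Polynomial.coeff ((B + C) $$ (i, j)) e = Polynomial.coeff (B $$ (i, j)) e + Polynomial.coeff (C $$ (i, j)) e"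
    if "i < n" "j < n" for i j e
    using car that by simp
  have "(i + e) mod n = j" if "i < n" "j < n" "Polynomial.coeff ((B + C) $$ (i, j)) e \<noteq> 0" for i j e
  proof -
    have "Polynomial.coeff (B $$ (i, j)) e \<noteq> 0 \<or> Polynomial.coeff (C $$ (i, j)) e \<noteq> 0"
      using that unfolding entry[OF that(1,2)] by auto
    then show ?thesis using B C that unfolding cyclic_def by blast
  qed
  moreover have "Polynomial.coeff ((B + C) $$ (Suc i mod n, Suc j mod n)) e =
      cyc_shift n (Polynomial.coeff ((B + C) $$ (i, j)) e)" if "i < n" "j < n" for i j e
    using B C n that by (simp add: entry cyclic_def del: index_add_mat)
  ultimately show ?thesis using car by (auto simp: cyclic_def simp del: index_add_mat(1))
qed

lemma cyclic_mult:
  assumes B: "cyclic n B" and C: "cyclic n C" and n: "0 < n"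
  shows "cyclic n (B * C)"
proof -
  have car: "B \<in> carrier_mat n n" "C \<in> carrier_mat n n" using B C by (simp_all add: cyclic_def)
  have entry: "Polynomial.coeff ((B * C) $$ (i, j)) e = (\<Sum>p<n. \<Sum>k\<le>e. Polynomial.coeff (B $$ (i, p)) k * Polynomial.coeff (C $$ (p, j)) (e - k))"
    if "i < n" "j < n" for i j e
  proof -
    have "(B * C) $$ (i, j) = (\<Sum>p<n. B $$ (i, p) * C $$ (p, j))"
      using car that by (simp add: scalar_prod_def atLeast0LessThan)
    then show ?thesis by (simp add: coeff_sum coeff_mult)
  qed
  have "Polynomial.coeff ((B * C) $$ (Suc i mod n, Suc j mod n)) e = cyc_shift n (Polynomial.coeff ((B * C) $$ (i, j)) e)"
    if ij: "i < n" "j < n" for i j e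
  proof -
    have "Polynomial.coeff ((B * C) $$ (Suc i mod n, Suc j mod n)) e =
        (\<Sum>p<n. \<Sum>k\<le>e. Polynomial.coeff (B $$ (Suc i mod n, p)) k * Polynomial.coeff (C $$ (p, Suc j mod n)) (e - k))"
      using n by (intro entry) auto
    also have "\<dots> = (\<Sum>p<n. \<Sum>k\<le>e. Polynomial.coeff (B $$ (Suc i mod n, Suc p mod n)) k * Polynomial.coeff (C $$ (Suc p mod n, Suc j mod n)) (e - k))"
      by (rule sum.reindex_bij_betw[OF bij_betw_Suc_mod[OF n], symmetric])
    also have "\<dots> = cyc_shift n (Polynomial.coeff ((B * C) $$ (i, j)) e)"
      using B C ij by (simp add: entry cyclic_def)
    finally show ?thesis .
  qed
  moreover have "(i + e) mod n = j" if ij: "i < n" "j < n" and nz: "Polynomial.coeff ((B * C) $$ (i, j)) e \<noteq> 0" for i j e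
  proof -
    obtain p where p: "p < n" "(\<Sum>k\<le>e. Polynomial.coeff (B $$ (i, p)) k * Polynomial.coeff (C $$ (p, j)) (e - k)) \<noteq> 0"
      using nz unfolding entry[OF ij] by (auto elim: sum.not_neutral_contains_not_neutral)
    then obtain k where k: "k \<le> e" "Polynomial.coeff (B $$ (i, p)) k \<noteq> 0" "Polynomial.coeff (C $$ (p, j)) (e - k) \<noteq> 0"
      by (auto elim: sum.not_neutral_contains_not_neutral)
    have "(i + k) mod n = p" using B ij p k(2) unfolding cyclic_def by blast
    moreover have "(p + (e - k)) mod n = j" using C ij p k(3) unfolding cyclic_def by blast
    ultimately have "(i + k + (e - k)) mod n = j" by (metis mod_add_left_eq)
    then show ?thesis using k by simp
  qed
  ultimately show ?thesis using car by (auto simp: cyclic_def)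
qed

lemma cyclic_grading:
  assumes "B \<in> generic_mat_algebra m n" and n: "0 < n"
  shows "cyclic n (map_mat (grading n) B)"
proof -
  interpret grading: comm_ring_hom "grading n" by (rule grading_hom)
  show ?thesis using assms(1)
  proof induction
    case (scalar c)
    have "n \<noteq> 0" using n by simp
    then show ?case unfolding cyclic_def
      by (auto simp: grading_gconst coeff_pCons Suc_mod_inj split: nat.splits)
  next
    case (generic h)
    have "(Suc j mod n + (n - Suc i mod n)) mod n = (j + (n - i)) mod n" if "i < n" "j < n" for i j
    proof (cases "Suc i = n")
      case False
      then have i: "Suc i mod n = Suc i" using that by simp
      show ?thesis
      proof (cases "Suc j = n")
        case True
        then have "j + (n - i) = (n - Suc i) + n" using that by simp
        then have "(j + (n - i)) mod n = (n - Suc i + n) mod n" by (simp only:)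
        also have "\<dots> = n - Suc i" using n by (simp only: mod_add_self2) simp
        finally show ?thesis using True i n by simp
      qed (use that i in \<open>simp add: Suc_diff_Suc\<close>)
    next
      case True
      then have "n - i = 1" by simp
      then show ?thesis using True by simp
    qed
    moreover have "(i + (j + (n - i)) mod n) mod n = j" if "i < n" "j < n" for i j
    proof -
      have "(i + (j + (n - i)) mod n) mod n = (i + (j + (n - i))) mod n" by presburger
      also have "i + (j + (n - i)) = j + n" using that by simp
      finally show ?thesis using that by simp
    qed
    ultimately show ?case using n unfolding cyclic_def
      by (auto simp: generic_mat_def grading_gvar coeff_monom split: if_splits)
  next
    case (add B C)
    then have car: "B \<in> carrier_mat n n" "C \<in> carrier_mat n n" by (auto simp: cyclic_def)
    have "cyclic n (map_mat (grading n) B + map_mat (grading n) C)"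
      using add.IH n by (rule cyclic_add)
    moreover have "map_mat (grading n) (B + C) = map_mat (grading n) B + map_mat (grading n) C"
      using car by (intro eq_matI) (auto simp: grading.hom_add)
    ultimately show ?case by simp
  next
    case (mult B C)
    then have car: "B \<in> carrier_mat n n" "C \<in> carrier_mat n n" by (auto simp: cyclic_def)
    then show ?case using cyclic_mult[OF mult.IH n] by (simp add: grading.mat_hom_mult)
  qed
qed

text \<open>
  Let \<open>s\<^sup>e\<close> be the lowest power of \<open>s\<close> in \<open>B\<close>.  Its coefficient matrix \<open>C\<close> is supported on one cyclic
  diagonal; as its entries there are translates of each other under the shift, none of them vanishes,
  and \<open>C\<close> is invertible.  Since \<open>B = s\<^sup>e (C + s (\<dots>))\<close>, the determinant of \<open>C\<close> is the lowest
  coefficient of that of \<open>B\<close>.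
\<close>

lemma cyclic_det_nonzero:
  fixes B :: "'k::field gpoly poly mat"
  assumes B: "cyclic n B" "B \<noteq> 0\<^sub>m n n" and n: "0 < n"
  shows "det B \<noteq> 0"
proof -
  have car: "B \<in> carrier_mat n n" using B by (simp add: cyclic_def)
  have "\<exists>i<n. \<exists>j<n. B $$ (i, j) \<noteq> 0"
  proof (rule ccontr)
    assume "\<not> ?thesis"
    then have "B = 0\<^sub>m n n" using car by (intro eq_matI) auto
    then show False using B by simp
  qed
  then obtain i1 j1 where "i1 < n" "j1 < n" "B $$ (i1, j1) \<noteq> 0" by blast
  then have ex: "\<exists>e i j. i < n \<and> j < n \<and> Polynomial.coeff (B $$ (i, j)) e \<noteq> 0"
    by (metis leading_coeff_neq_0)
  define e where "e = (LEAST e. \<exists>i j. i < n \<and> j < n \<and> Polynomial.coeff (B $$ (i, j)) e \<noteq> 0)"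
  obtain i0 j0 where ij0: "i0 < n" "j0 < n" "Polynomial.coeff (B $$ (i0, j0)) e \<noteq> 0"
    using LeastI_ex[OF ex] unfolding e_def by blast
  have below: "Polynomial.coeff (B $$ (i, j)) k = 0" if "k < e" "i < n" "j < n" for i j k
    using not_less_Least[OF that(1)[unfolded e_def]] that by blast
  have "\<exists>q. B $$ (i, j) = Polynomial.monom 1 e * q" if "i < n" "j < n" for i j
    using monom_1_dvd_iff'[of e "B $$ (i, j)"] below that by (auto simp: dvd_def)
  then obtain q where q: "\<And>i j. i < n \<Longrightarrow> j < n \<Longrightarrow> B $$ (i, j) = Polynomial.monom 1 e * q i j" by metis
  define Q where "Q = mat n n (\<lambda>(i, j). q i j)"
  have BQ: "B = Polynomial.monom 1 e \<cdot>\<^sub>m Q" using car q by (intro eq_matI) (auto simp: Q_def)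
  define C where "C = map_mat (\<lambda>p. Polynomial.coeff p 0) Q"
  have C: "C \<in> carrier_mat n n" by (simp add: C_def Q_def)
  have C_entry: "C $$ (i, j) = Polynomial.coeff (B $$ (i, j)) e" if "i < n" "j < n" for i j
    using that by (simp add: C_def Q_def q coeff_monom_mult)
  have shift: "C $$ (Suc i mod n, Suc j mod n) = cyc_shift n (C $$ (i, j))" if "i < n" "j < n" for i j
    using B(1) that n by (simp add: C_entry cyclic_def)
  have support: "(i + e) mod n = j" if "i < n" "j < n" "C $$ (i, j) \<noteq> 0" for i j
    using B(1) that by (simp add: C_entry cyclic_def)
  have nonzero: "C $$ (i, (i + e) mod n) \<noteq> 0" if i: "i < n" for i
  proof
    assume zero: "C $$ (i, (i + e) mod n) = 0"
    have "C $$ ((i + k) mod n, (i + e + k) mod n) = 0" for k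
    proof (induction k)
      case 0
      then show ?case using zero i by simp
    next
      case (Suc k)
      have "C $$ (Suc ((i + k) mod n) mod n, Suc ((i + e + k) mod n) mod n) = 0"
        using Suc n by (subst shift) auto
      then show ?case by (simp add: mod_Suc_eq)
    qed
    \<comment> \<open>After \<open>i0 + (n - i)\<close> shifts this zero reaches the nonzero entry in row \<open>i0\<close>.\<close>
    moreover have "i + (i0 + (n - i)) = i0 + n" "i + e + (i0 + (n - i)) = i0 + e + n" using i by simp_all
    ultimately have "C $$ ((i0 + n) mod n, (i0 + e + n) mod n) = 0" by metis
    then have "C $$ (i0, (i0 + e) mod n) = 0" unfolding mod_add_self2 using ij0 by simp
    then show False using support[of i0 j0] ij0 by (simp add: C_entry)
  qed
  have "det C \<noteq> 0"
  proof
    assume "det C = 0"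
    then obtain v where v: "v \<in> carrier_vec n" "v \<noteq> 0\<^sub>v n" "C *\<^sub>v v = 0\<^sub>v n"
      using det_0_iff_vec_prod_zero[OF C] by blast
    have "v $ j = 0" if j: "j < n" for j
    proof -
      define i where "i = (j + (n - e mod n)) mod n"
      have i: "i < n" using n by (simp add: i_def)
      have "(i + e) mod n = (j + (n - e mod n) + e mod n) mod n"
        unfolding i_def by (metis mod_add_eq mod_mod_trivial)
      also have "j + (n - e mod n) + e mod n = j + n" using mod_less_divisor[OF n, of e] by simp
      finally have ij: "(i + e) mod n = j" using j by simp
      have "0 = (C *\<^sub>v v) $ i" using v i by simp
      also have "\<dots> = (\<Sum>p<n. C $$ (i, p) * v $ p)"
        using C v(1) i by (simp add: scalar_prod_def atLeast0LessThan)
      also have "\<dots> = (\<Sum>p<n. if p = j then C $$ (i, j) * v $ j else 0)"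
        using support[OF i] ij by (intro sum.cong) auto
      also have "\<dots> = C $$ (i, j) * v $ j" using j by simp
      finally show ?thesis using nonzero[OF i] ij by simp
    qed
    then have "v = 0\<^sub>v n" using v by (intro eq_vecI) auto
    then show False using v by simp
  qed
  interpret coeff_0: comm_ring_hom "\<lambda>p :: 'k gpoly poly. Polynomial.coeff p 0"
    by unfold_locales (simp_all add: coeff_mult)
  have "Polynomial.coeff (det Q) 0 = det C" unfolding C_def by simp
  then have "det Q \<noteq> 0" using \<open>det C \<noteq> 0\<close> by auto
  then show ?thesis unfolding BQ by (simp add: monom_eq_0_iff)
qed

text \<open>
  This is Amitsur's theorem that the generic matrices generate a domain.  His specialization to a
  division algebra of degree \<open>n\<close> is replaced by the grading, which embeds the polynomials into \<open>k[x][s]\<close>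
  and maps the generic matrices to skew polynomials.
\<close>

theorem generic_det_nonzero:
  assumes B: "B \<in> generic_mat_algebra m n" "B \<noteq> 0\<^sub>m n n" and n: "0 < n"
  shows "det B \<noteq> 0"
proof
  assume zero: "det B = 0"
  interpret grading: comm_ring_hom "grading n" by (rule grading_hom)
  have cyc: "cyclic n (map_mat (grading n) B)" using cyclic_grading B n by blast
  moreover have "map_mat (grading n) B \<noteq> 0\<^sub>m n n"
  proof
    assume *: "map_mat (grading n) B = 0\<^sub>m n n"
    have car: "B \<in> carrier_mat n n" using cyc by (auto simp: cyclic_def)
    have "B $$ (i, j) = 0" if "i < n" "j < n" for i j
    proof -
      have "grading n (B $$ (i, j)) = map_mat (grading n) B $$ (i, j)" using car that by simp
      also have "\<dots> = 0" unfolding * using that by simp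
      finally show ?thesis using poly_grading_1[of n "B $$ (i, j)"] by simp
    qed
    then show False using B car by (auto intro: eq_matI)
  qed
  ultimately have "det (map_mat (grading n) B) \<noteq> 0" using cyclic_det_nonzero n by blast
  then show False using zero by simp
qed

section \<open>Linear independence by specialization\<close>

text \<open>
  A polynomial of degree less than \<open>n\<close> with \<open>n\<close> zeros vanishes.
\<close>

lemma vandermonde_injective:
  fixes d :: "nat \<Rightarrow> 'k::field"
  assumes inj: "inj_on d {..<n}" and zero: "\<And>k. k < n \<Longrightarrow> (\<Sum>i<n. c i * d k ^ i) = 0" and i: "i < n"
  shows "c i = 0"
proof -
  define p where "p = (\<Sum>i<n. Polynomial.monom (c i) i)"
  have eval: "poly p x = (\<Sum>i<n. c i * x ^ i)" for x by (simp add: p_def poly_sum poly_monom)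
  have "p = 0"
  proof (rule poly_eqI_degree[of "d ` {..<n}"])
    show "poly p x = poly 0 x" if "x \<in> d ` {..<n}" for x using that zero by (auto simp: eval)
    have "degree p \<le> n - 1" unfolding p_def
      by (intro degree_sum_le) (auto intro: order_trans[OF degree_monom_le])
    then show "degree p < card (d ` {..<n})" using i card_image[OF inj] by simp
    show "degree (0 :: 'k poly) < card (d ` {..<n})" using i card_image[OF inj] by simp
  qed
  moreover have "Polynomial.coeff p i = c i"
    using i by (simp add: p_def coeff_sum coeff_monom)
  ultimately show ?thesis by simp
qed

lemma sum_lessThan_mult_div_mod:
  fixes f :: "nat \<Rightarrow> nat \<Rightarrow> 'a::comm_monoid_add"
  assumes "0 < n"
  shows "(\<Sum>r<n * n. f (r div n) (r mod n)) = (\<Sum>i<n. \<Sum>j<n. f i j)"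
proof -
  have "(\<Sum>r<n * n. f (r div n) (r mod n)) = (\<Sum>(i, j)\<in>{..<n} \<times> {..<n}. f i j)"
  proof (rule sum.reindex_bij_witness[of _ "\<lambda>(i, j). i * n + j" "\<lambda>r. (r div n, r mod n)"])
    fix p assume "p \<in> {..<n} \<times> {..<n}"
    then obtain i j where p: "p = (i, j)" "i < n" "j < n" by auto
    have "i * n + j < Suc i * n" using p by simp
    also have "\<dots> \<le> n * n" using p by (intro mult_right_mono) auto
    finally show "(case p of (i, j) \<Rightarrow> i * n + j) \<in> {..<n * n}" using p by simp
    show "((case p of (i, j) \<Rightarrow> i * n + j) div n, (case p of (i, j) \<Rightarrow> i * n + j) mod n) = p"
      using p by simp
  next
    fix r assume r: "r \<in> {..<n * n}"
    then show "(r div n, r mod n) \<in> {..<n} \<times> {..<n}" using assms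
      by (simp add: less_mult_imp_div_less)
  qed (use assms in auto)
  then show ?thesis by (simp add: sum.cartesian_product)
qed

lemma diag_power_mult_entry:
  fixes P :: "'k::comm_ring_1 mat"
  assumes P: "P \<in> carrier_mat n n" "diagonal_mat P" and Q: "Q \<in> carrier_mat n n" and kl: "k < n" "l < n"
  shows "(P ^\<^sub>m i * Q) $$ (k, l) = P $$ (k, k) ^ i * Q $$ (k, l)"
    "(Q * P ^\<^sub>m i) $$ (k, l) = Q $$ (k, l) * P $$ (l, l) ^ i"
proof -
  have entry: "(P ^\<^sub>m i) $$ (a, b) = (if a = b then P $$ (a, a) ^ i else 0)" if "a < n" "b < n" for a b
    using that
  proof (induction i arbitrary: b)
    case (Suc i)
    have "(P ^\<^sub>m Suc i) $$ (a, b) = (\<Sum>c<n. (P ^\<^sub>m i) $$ (a, c) * P $$ (c, b))"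
      using P Suc.prems by (simp add: scalar_prod_def atLeast0LessThan)
    also have "\<dots> = (\<Sum>c<n. if c = a then P $$ (a, a) ^ i * P $$ (a, b) else 0)"
      using Suc by (intro sum.cong) auto
    also have "\<dots> = P $$ (a, a) ^ i * P $$ (a, b)" using Suc.prems by simp
    also have "\<dots> = (if a = b then P $$ (a, a) ^ Suc i else 0)"
      using P Suc.prems by (auto simp: diagonal_mat_def)
    finally show ?case .
  qed (use P in auto)
  have "(P ^\<^sub>m i * Q) $$ (k, l) = (\<Sum>c<n. (P ^\<^sub>m i) $$ (k, c) * Q $$ (c, l))"
    using P Q kl by (simp add: scalar_prod_def atLeast0LessThan)
  also have "\<dots> = (\<Sum>c<n. if c = k then P $$ (k, k) ^ i * Q $$ (k, l) else 0)"
    using kl by (intro sum.cong) (auto simp: entry)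
  finally have "(P ^\<^sub>m i * Q) $$ (k, l) = (\<Sum>c<n. if c = k then P $$ (k, k) ^ i * Q $$ (k, l) else 0)" .
  then show "(P ^\<^sub>m i * Q) $$ (k, l) = P $$ (k, k) ^ i * Q $$ (k, l)" using kl by simp
  have "(Q * P ^\<^sub>m i) $$ (k, l) = (\<Sum>c<n. Q $$ (k, c) * (P ^\<^sub>m i) $$ (c, l))"
    using P Q kl by (simp add: scalar_prod_def atLeast0LessThan)
  also have "\<dots> = (\<Sum>c<n. if c = l then Q $$ (k, l) * P $$ (l, l) ^ i else 0)"
    using kl by (intro sum.cong) (auto simp: entry)
  finally have "(Q * P ^\<^sub>m i) $$ (k, l) = (\<Sum>c<n. if c = l then Q $$ (k, l) * P $$ (l, l) ^ i else 0)" .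
  then show "(Q * P ^\<^sub>m i) $$ (k, l) = Q $$ (k, l) * P $$ (l, l) ^ i" using kl by simp
qed

text \<open>
  The products \<open>P\<^sup>i Q P\<^sup>j\<close> with \<open>i, j < n\<close>, enumerated by \<open>r = i n + j\<close>.
\<close>

definition sandwich :: "nat \<Rightarrow> 'a::comm_ring_1 mat \<Rightarrow> 'a mat \<Rightarrow> nat \<Rightarrow> 'a mat" where
  "sandwich n P Q r = P ^\<^sub>m (r div n) * Q * P ^\<^sub>m (r mod n)"

lemma sandwich_carrier [simp]:
  "P \<in> carrier_mat n n \<Longrightarrow> Q \<in> carrier_mat n n \<Longrightarrow> sandwich n P Q r \<in> carrier_mat n n"
  unfolding sandwich_def by (intro mult_carrier_mat[of _ n n] pow_carrier_mat)

text \<open>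
  If \<open>P\<close> is diagonal with entries \<open>d\<^sub>k\<close>, then \<open>P\<^sup>i Q P\<^sup>j\<close> has the entries \<open>d\<^sub>k\<^sup>i Q\<^sub>k\<^sub>l d\<^sub>l\<^sup>j\<close>.  After division by
  \<open>Q\<^sub>k\<^sub>l\<close>, a linear relation says that a polynomial of degree less than \<open>n\<close> in each of two variables
  vanishes on an \<open>n \<times> n\<close> grid.
\<close>

lemma sandwich_independent:
  fixes P Q :: "'k::field mat"
  assumes P: "P \<in> carrier_mat n n" "diagonal_mat P" and inj: "inj_on (\<lambda>i. P $$ (i, i)) {..<n}"
    and Q: "Q \<in> carrier_mat n n" and nz: "\<And>i j. i < n \<Longrightarrow> j < n \<Longrightarrow> Q $$ (i, j) \<noteq> 0"
    and zero: "mat_sum n (\<lambda>r. c r \<cdot>\<^sub>m sandwich n P Q r) {..<n * n} = 0\<^sub>m n n" and r: "r < n * n"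
  shows "c r = 0"
proof -
  have n: "0 < n" using r by (cases n) auto
  let ?d = "\<lambda>k. P $$ (k, k)"
  have entry: "sandwich n P Q r $$ (k, l) = ?d k ^ (r div n) * Q $$ (k, l) * ?d l ^ (r mod n)"
    if "k < n" "l < n" for k l r
    unfolding sandwich_def using P Q that
    by (subst diag_power_mult_entry(2)[of P n]) (auto simp: diag_power_mult_entry(1)[of P n] simp del: index_mult_mat(1) assoc_mult_mat)
  have grid: "(\<Sum>i<n. (\<Sum>j<n. c (i * n + j) * ?d l ^ j) * ?d k ^ i) = 0" if kl: "k < n" "l < n" for k l
  proof -
    have "0 = mat_sum n (\<lambda>r. c r \<cdot>\<^sub>m sandwich n P Q r) {..<n * n} $$ (k, l)"
      using zero kl by simp
    also have "\<dots> = (\<Sum>r<n * n. c r * sandwich n P Q r $$ (k, l))"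
      using P Q kl by (intro mat_sum_smult_index) auto
    also have "\<dots> = (\<Sum>r<n * n. (c (r div n * n + r mod n) * ?d l ^ (r mod n) * ?d k ^ (r div n)) * Q $$ (k, l))"
      using kl by (simp add: entry mult_ac)
    also have "\<dots> = (\<Sum>i<n. \<Sum>j<n. (c (i * n + j) * ?d l ^ j * ?d k ^ i) * Q $$ (k, l))"
      by (rule sum_lessThan_mult_div_mod[OF n, of "\<lambda>i j. (c (i * n + j) * ?d l ^ j * ?d k ^ i) * Q $$ (k, l)"])
    also have "\<dots> = (\<Sum>i<n. (\<Sum>j<n. c (i * n + j) * ?d l ^ j) * ?d k ^ i) * Q $$ (k, l)"
      by (simp add: sum_distrib_right)
    finally show ?thesis using nz[OF kl] by simp
  qed
  have "(\<Sum>j<n. c (i * n + j) * ?d l ^ j) = 0" if "i < n" "l < n" for i l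
    by (rule vandermonde_injective[OF inj]) (use grid that in auto)
  then have "c (i * n + j) = 0" if "i < n" "j < n" for i j
    using vandermonde_injective[OF inj, of "\<lambda>j. c (i * n + j)" j] that by blast
  moreover have "r div n < n" "r mod n < n" "r div n * n + r mod n = r"
    using r n by (simp_all add: less_mult_imp_div_less)
  ultimately show ?thesis by metis
qed

lemma smult_pow_mat:
  fixes a :: "'a::comm_ring_1"
  assumes "P \<in> carrier_mat n n"
  shows "(a \<cdot>\<^sub>m P) ^\<^sub>m i = a ^ i \<cdot>\<^sub>m P ^\<^sub>m i"
proof (induction i)
  case (Suc i)
  have "(a \<cdot>\<^sub>m P) ^\<^sub>m Suc i = (a ^ i \<cdot>\<^sub>m P ^\<^sub>m i) * (a \<cdot>\<^sub>m P)" by (simp add: Suc)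
  also have "\<dots> = a ^ i \<cdot>\<^sub>m (P ^\<^sub>m i * (a \<cdot>\<^sub>m P))"
    using assms by (intro mult_smult_assoc_mat[of _ n n _ n]) auto
  also have "P ^\<^sub>m i * (a \<cdot>\<^sub>m P) = a \<cdot>\<^sub>m (P ^\<^sub>m i * P)"
    using assms by (intro mult_smult_distrib[of _ n n _ n]) auto
  finally show ?case by (auto simp: mult_ac)
qed auto

lemma sandwich_smult:
  fixes a :: "'a::comm_ring_1"
  assumes P: "P \<in> carrier_mat n n" and Q: "Q \<in> carrier_mat n n"
  shows "sandwich n (a \<cdot>\<^sub>m P) (b \<cdot>\<^sub>m Q) r = (a ^ (r div n + r mod n) * b) \<cdot>\<^sub>m sandwich n P Q r"
proof -
  let ?i = "r div n" and ?j = "r mod n"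
  have p: "P ^\<^sub>m i \<in> carrier_mat n n" for i using P by simp
  have pq: "P ^\<^sub>m ?i * Q \<in> carrier_mat n n" using p Q by (rule mult_carrier_mat)
  have "(a ^ ?i \<cdot>\<^sub>m P ^\<^sub>m ?i) * (b \<cdot>\<^sub>m Q) = (a ^ ?i * b) \<cdot>\<^sub>m (P ^\<^sub>m ?i * Q)"
    using mult_smult_assoc_mat[OF p[of ?i], where B = "b \<cdot>\<^sub>m Q" and nc = n and k = "a ^ ?i"]
      mult_smult_distrib[OF p[of ?i] Q, where k = b] Q by auto
  then have "sandwich n (a \<cdot>\<^sub>m P) (b \<cdot>\<^sub>m Q) r = ((a ^ ?i * b) \<cdot>\<^sub>m (P ^\<^sub>m ?i * Q)) * (a ^ ?j \<cdot>\<^sub>m P ^\<^sub>m ?j)"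
    by (simp add: sandwich_def smult_pow_mat[OF P])
  also have "\<dots> = (a ^ ?i * b) \<cdot>\<^sub>m ((P ^\<^sub>m ?i * Q) * (a ^ ?j \<cdot>\<^sub>m P ^\<^sub>m ?j))"
    using p by (intro mult_smult_assoc_mat[OF pq, where nc = n]) auto
  also have "(P ^\<^sub>m ?i * Q) * (a ^ ?j \<cdot>\<^sub>m P ^\<^sub>m ?j) = a ^ ?j \<cdot>\<^sub>m (P ^\<^sub>m ?i * Q * P ^\<^sub>m ?j)"
    by (rule mult_smult_distrib[OF pq p])
  finally show ?thesis by (auto simp: sandwich_def power_add mult_ac)
qed

lemma map_mat_sandwich:
  assumes "comm_ring_hom h" and P: "P \<in> carrier_mat n n" and Q: "Q \<in> carrier_mat n n"
  shows "map_mat h (sandwich n P Q r) = sandwich n (map_mat h P) (map_mat h Q) r"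
proof -
  interpret h: comm_ring_hom h by (rule assms(1))
  have PQ: "P ^\<^sub>m i * Q \<in> carrier_mat n n" for i using P Q by (intro mult_carrier_mat[of _ n n]) auto
  show ?thesis
    unfolding sandwich_def using P Q
    by (simp add: h.mat_hom_mult[OF PQ pow_carrier_mat[OF P]] h.mat_hom_mult[OF pow_carrier_mat[OF P] Q] h.mat_hom_pow[OF P])
qed

text \<open>
  The entries of the \<open>n\<^sup>2\<close> matrices form a square array, and a dependence over the field of fractions
  makes its determinant vanish, also after specialization.
\<close>

lemma independent_if_specialization_independent:
  fixes T :: "nat \<Rightarrow> 'a::idom mat" and h :: "'a \<Rightarrow> 'k::field"
  assumes h: "comm_ring_hom h" and T: "\<And>r. r < n * n \<Longrightarrow> T r \<in> carrier_mat n n"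
    and indep: "\<And>c r. mat_sum n (\<lambda>r. c r \<cdot>\<^sub>m map_mat h (T r)) {..<n * n} = 0\<^sub>m n n \<Longrightarrow> r < n * n \<Longrightarrow> c r = 0"
    and zero: "mat_sum n (\<lambda>r. c r \<cdot>\<^sub>m map_mat to_fract (T r)) {..<n * n} = 0\<^sub>m n n" and r: "r < n * n"
  shows "c r = 0"
proof (rule ccontr)
  assume nz: "c r \<noteq> 0"
  interpret h: comm_ring_hom h by (rule h)
  interpret to_fract: comm_ring_hom "to_fract :: 'a \<Rightarrow> 'a fract" by unfold_locales auto
  have n: "0 < n" using r by (cases n) auto
  let ?N = "n * n"
  have sm: "s div n < n" "s mod n < n" if "s < ?N" for s
    using that n by (simp_all add: less_mult_imp_div_less)
  define V where "V = mat ?N ?N (\<lambda>(s, r). T r $$ (s div n, s mod n))"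
  have V: "V \<in> carrier_mat ?N ?N" by (simp add: V_def)
  have mult: "(map_mat f V *\<^sub>v v) $ s = mat_sum n (\<lambda>r. v $ r \<cdot>\<^sub>m map_mat f (T r)) {..<?N} $$ (s div n, s mod n)"
    if s: "s < ?N" and v: "v \<in> carrier_vec ?N" for v s and f :: "'a \<Rightarrow> 'b::comm_ring_1"
  proof -
    have "(map_mat f V *\<^sub>v v) $ s = (\<Sum>r<?N. v $ r * f (T r $$ (s div n, s mod n)))"
      using V s v by (auto simp: scalar_prod_def V_def atLeast0LessThan mult.commute)
    also have "\<dots> = (\<Sum>r<?N. v $ r * map_mat f (T r) $$ (s div n, s mod n))"
    proof (rule sum.cong[OF refl])
      fix r assume "r \<in> {..<?N}"
      then have "T r \<in> carrier_mat n n" using T by simp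
      then show "v $ r * f (T r $$ (s div n, s mod n)) = v $ r * map_mat f (T r) $$ (s div n, s mod n)"
        using sm[OF s] by simp
    qed
    also have "\<dots> = mat_sum n (\<lambda>r. v $ r \<cdot>\<^sub>m map_mat f (T r)) {..<?N} $$ (s div n, s mod n)"
      using T sm[OF s] by (intro mat_sum_smult_index[symmetric]) auto
    finally show ?thesis .
  qed
  have "det (map_mat to_fract V) = 0"
  proof -
    have "vec ?N c \<noteq> 0\<^sub>v ?N"
    proof
      assume "vec ?N c = 0\<^sub>v ?N"
      then have "vec ?N c $ r = 0\<^sub>v ?N $ r" by simp
      then show False using nz r by simp
    qed
    moreover have "map_mat to_fract V *\<^sub>v vec ?N c = 0\<^sub>v ?N"
    proof (rule eq_vecI)
      fix s assume "s < dim_vec (0\<^sub>v ?N :: 'a fract vec)"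
      then have s: "s < ?N" by simp
      have "mat_sum n (\<lambda>r. vec ?N c $ r \<cdot>\<^sub>m map_mat to_fract (T r)) {..<?N} = 0\<^sub>m n n"
        unfolding zero[symmetric] by (intro mat_sum_cong) auto
      then show "(map_mat to_fract V *\<^sub>v vec ?N c) $ s = 0\<^sub>v ?N $ s"
        using s sm[OF s] by (simp add: mult del: index_mult_mat_vec)
    qed (use V in simp)
    ultimately have "\<exists>v. v \<in> carrier_vec ?N \<and> v \<noteq> 0\<^sub>v ?N \<and> map_mat to_fract V *\<^sub>v v = 0\<^sub>v ?N"
      by (intro exI[of _ "vec ?N c"]) auto
    then show ?thesis using det_0_iff_vec_prod_zero_field[of "map_mat to_fract V" ?N] V by auto
  qed
  then have "det V = 0" by simp
  then have "det (map_mat h V) = 0" by simp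
  then obtain v where v: "v \<in> carrier_vec ?N" "v \<noteq> 0\<^sub>v ?N" "map_mat h V *\<^sub>v v = 0\<^sub>v ?N"
    using det_0_iff_vec_prod_zero_field[of "map_mat h V" ?N] V by auto
  have "mat_sum n (\<lambda>r. v $ r \<cdot>\<^sub>m map_mat h (T r)) {..<?N} = 0\<^sub>m n n"
  proof (rule eq_matI)
    fix k l assume "k < dim_row (0\<^sub>m n n :: 'k mat)" "l < dim_col (0\<^sub>m n n :: 'k mat)"
    then have kl: "k < n" "l < n" by auto
    let ?s = "k * n + l"
    have "?s < Suc k * n" using kl by simp
    also have "\<dots> \<le> ?N" using kl by (intro mult_right_mono) auto
    finally have s: "?s < ?N" .
    have "?s div n = k" "?s mod n = l" using kl by simp_all
    then show "mat_sum n (\<lambda>r. v $ r \<cdot>\<^sub>m map_mat h (T r)) {..<?N} $$ (k, l) = 0\<^sub>m n n $$ (k, l)"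
      using mult[OF s v(1), of h] v(3) s kl by simp
  qed auto
  then have "v $ r = 0" if "r < ?N" for r using indep[of "\<lambda>r. v $ r"] that by blast
  then have "v = 0\<^sub>v ?N" using v by (intro eq_vecI) auto
  then show False using v by simp
qed

section \<open>Orthogonal projection for the trace form\<close>

definition gram :: "nat \<Rightarrow> (nat \<Rightarrow> 'a::comm_ring_1 mat) \<Rightarrow> 'a mat" where
  "gram m X = mat m m (\<lambda>(i, j). mat_trace (X i * X j))"

definition gram_coeff :: "nat \<Rightarrow> (nat \<Rightarrow> 'a::comm_ring_1 mat) \<Rightarrow> 'a mat \<Rightarrow> nat \<Rightarrow> 'a" where
  "gram_coeff m X y i = (\<Sum>j<m. adj_mat (gram m X) $$ (i, j) * mat_trace (X j * y))"

text \<open>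
  The orthogonal projection onto the span of \<open>X\<close>, multiplied by the determinant of the Gram matrix.
  In this form no division is needed, so that the projection
  commutes with homomorphisms of commutative rings (\<open>gram_proj_hom\<close>).
\<close>

definition gram_proj :: "nat \<Rightarrow> nat \<Rightarrow> (nat \<Rightarrow> 'a::comm_ring_1 mat) \<Rightarrow> 'a mat \<Rightarrow> 'a mat" where
  "gram_proj n m X y = mat_sum n (\<lambda>i. gram_coeff m X y i \<cdot>\<^sub>m X i) {..<m}"

lemma gram_carrier [simp]: "gram m X \<in> carrier_mat m m" by (simp add: gram_def)

lemma gram_dim [simp]: "dim_row (gram m X) = m" "dim_col (gram m X) = m" by (simp_all add: gram_def)

lemma gram_proj_carrier [simp]: "gram_proj n m X y \<in> carrier_mat n n" by (simp add: gram_proj_def)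

lemma mat_trace_mult_mat_sum:
  assumes "a \<in> carrier_mat n n" "\<And>i. i < m \<Longrightarrow> X i \<in> carrier_mat n n"
  shows "mat_trace (a * mat_sum n (\<lambda>i. c i \<cdot>\<^sub>m X i) {..<m}) = (\<Sum>i<m. (c i :: 'a::comm_ring_1) * mat_trace (a * X i))"
proof -
  have "a * mat_sum n (\<lambda>i. c i \<cdot>\<^sub>m X i) {..<m} = mat_sum n (\<lambda>i. a * (c i \<cdot>\<^sub>m X i)) {..<m}"
    using assms by (intro mat_sum_mult_left) auto
  also have "mat_trace \<dots> = (\<Sum>i<m. mat_trace (a * (c i \<cdot>\<^sub>m X i)))"
    using assms by (intro mat_trace_mat_sum mult_carrier_mat[of _ n n]) auto
  also have "\<dots> = (\<Sum>i<m. c i * mat_trace (a * X i))"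
  proof (rule sum.cong[OF refl])
    fix i assume "i \<in> {..<m}"
    then have X: "X i \<in> carrier_mat n n" using assms by auto
    show "mat_trace (a * (c i \<cdot>\<^sub>m X i)) = c i * mat_trace (a * X i)"
      using mult_smult_distrib[OF assms(1) X] mat_trace_smult[OF mult_carrier_mat[OF assms(1) X]] by simp
  qed
  finally show ?thesis .
qed

lemma trace_gram_proj:
  assumes X: "\<And>i. i < m \<Longrightarrow> X i \<in> carrier_mat n n" and l: "l < m"
  shows "mat_trace (X l * gram_proj n m X y) = det (gram m X) * mat_trace (X l * y)"
proof -
  have adj: "(\<Sum>i<m. gram m X $$ (l, i) * adj_mat (gram m X) $$ (i, j)) = (if l = j then det (gram m X) else 0)"
    if "j < m" for j
  proof -
    have "(\<Sum>i<m. gram m X $$ (l, i) * adj_mat (gram m X) $$ (i, j)) = (gram m X * adj_mat (gram m X)) $$ (l, j)"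
      using l that adj_mat(1)[OF gram_carrier[of m X]] gram_carrier[of m X]
      by (simp add: scalar_prod_def atLeast0LessThan)
    also have "\<dots> = (det (gram m X) \<cdot>\<^sub>m 1\<^sub>m m) $$ (l, j)" by (simp only: adj_mat(2)[OF gram_carrier])
    finally show ?thesis using l that by simp
  qed
  have "mat_trace (X l * gram_proj n m X y) = (\<Sum>i<m. gram_coeff m X y i * mat_trace (X l * X i))"
    unfolding gram_proj_def using X l by (intro mat_trace_mult_mat_sum) auto
  also have "\<dots> = (\<Sum>i<m. \<Sum>j<m. gram m X $$ (l, i) * adj_mat (gram m X) $$ (i, j) * mat_trace (X j * y))"
    using l by (simp add: gram_coeff_def gram_def sum_distrib_left sum_distrib_right mult_ac)
  also have "\<dots> = (\<Sum>j<m. (\<Sum>i<m. gram m X $$ (l, i) * adj_mat (gram m X) $$ (i, j)) * mat_trace (X j * y))"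
    by (subst sum.swap) (simp add: sum_distrib_right)
  also have "\<dots> = (\<Sum>j<m. if j = l then det (gram m X) * mat_trace (X l * y) else 0)"
    by (intro sum.cong) (auto simp: adj)
  finally show ?thesis using l by simp
qed

lemma gram_span_trivial:
  fixes X :: "nat \<Rightarrow> 'f::field mat"
  assumes X: "\<And>i. i < m \<Longrightarrow> X i \<in> carrier_mat n n" and det: "det (gram m X) \<noteq> 0"
    and y: "y = mat_sum n (\<lambda>i. c i \<cdot>\<^sub>m X i) {..<m}" and orth: "\<And>l. l < m \<Longrightarrow> mat_trace (X l * y) = 0"
  shows "y = 0\<^sub>m n n"
proof -
  have "gram m X *\<^sub>v vec m c = 0\<^sub>v m"
  proof (rule eq_vecI)
    fix l assume "l < dim_vec (0\<^sub>v m :: 'f vec)"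
    then have l: "l < m" by simp
    have "(gram m X *\<^sub>v vec m c) $ l = (\<Sum>i<m. c i * mat_trace (X l * X i))"
      using l by (simp add: gram_def scalar_prod_def atLeast0LessThan mult.commute)
    also have "\<dots> = mat_trace (X l * y)"
      unfolding y using X l by (intro mat_trace_mult_mat_sum[symmetric]) auto
    finally show "(gram m X *\<^sub>v vec m c) $ l = 0\<^sub>v m $ l" using orth l by simp
  qed (simp add: gram_def)
  then have "vec m c = 0\<^sub>v m"
    using det det_0_iff_vec_prod_zero_field[OF gram_carrier[of m X]] by (metis vec_carrier)
  then have "c i = 0" if "i < m" for i using that by (metis index_vec index_zero_vec(1))
  moreover have "y $$ (i, j) = (\<Sum>x<m. c x * X x $$ (i, j))" if "i < n" "j < n" for i j
    unfolding y using X that by (intro mat_sum_smult_index) auto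
  ultimately show ?thesis by (intro eq_matI) (auto simp: y)
qed

lemma mat_mult_hom:
  assumes "comm_ring_hom h" "a \<in> carrier_mat n n" "b \<in> carrier_mat n n"
  shows "map_mat h (a * b) = map_mat h a * map_mat h b"
proof -
  interpret h: comm_ring_hom h by (rule assms(1))
  show ?thesis using assms(2,3) by (rule h.mat_hom_mult)
qed

lemma mat_trace_hom:
  assumes "comm_ring_hom h" "a \<in> carrier_mat n n"
  shows "mat_trace (map_mat h a) = h (mat_trace a)"
proof -
  interpret h: comm_ring_hom h by (rule assms(1))
  show ?thesis using assms(2) by (simp add: mat_trace_def h.hom_sum)
qed

lemma mat_sum_hom:
  assumes "comm_ring_hom h" "\<And>i. i \<in> I \<Longrightarrow> u i \<in> carrier_mat n n"
  shows "map_mat h (mat_sum n (\<lambda>i. c i \<cdot>\<^sub>m u i) I) = mat_sum n (\<lambda>i. h (c i) \<cdot>\<^sub>m map_mat h (u i)) I"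
proof -
  interpret h: comm_ring_hom h by (rule assms(1))
  show ?thesis
  proof (rule eq_matI)
    fix k l assume "k < dim_row (mat_sum n (\<lambda>i. h (c i) \<cdot>\<^sub>m map_mat h (u i)) I)"
      "l < dim_col (mat_sum n (\<lambda>i. h (c i) \<cdot>\<^sub>m map_mat h (u i)) I)"
    then have kl: "k < n" "l < n" by auto
    have "map_mat h (u i) $$ (k, l) = h (u i $$ (k, l))" if "i \<in> I" for i
      using assms(2)[OF that] kl by auto
    then show "map_mat h (mat_sum n (\<lambda>i. c i \<cdot>\<^sub>m u i) I) $$ (k, l) = mat_sum n (\<lambda>i. h (c i) \<cdot>\<^sub>m map_mat h (u i)) I $$ (k, l)"
      using kl assms(2)
      by (subst mat_sum_smult_index) (auto simp: mat_sum_smult_index h.hom_sum h.hom_mult)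
  qed auto
qed

lemma gram_hom:
  assumes h: "comm_ring_hom h" and X: "\<And>i. i < m \<Longrightarrow> X i \<in> carrier_mat n n"
  shows "gram m (\<lambda>i. map_mat h (X i)) = map_mat h (gram m X)"
proof -
  interpret h: comm_ring_hom h by (rule h)
  show ?thesis
  proof (rule eq_matI)
    fix i j assume "i < dim_row (map_mat h (gram m X))" "j < dim_col (map_mat h (gram m X))"
    then have ij: "i < m" "j < m" by (auto simp: gram_def)
    then show "gram m (\<lambda>i. map_mat h (X i)) $$ (i, j) = map_mat h (gram m X) $$ (i, j)"
      using mat_trace_hom[OF h mult_carrier_mat[OF X X], of i j] h.mat_hom_mult[OF X X, of i j]
      by (simp add: gram_def)
  qed (auto simp: gram_def)
qed

lemma adj_mat_hom:
  assumes h: "comm_ring_hom h" and B: "B \<in> carrier_mat m m"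
  shows "adj_mat (map_mat h B) = map_mat h (adj_mat B)"
proof -
  interpret h: comm_ring_hom h by (rule h)
  have "mat_delete (map_mat h B) i j = map_mat h (mat_delete B i j)" for i j
    using B by (intro eq_matI) (auto simp: mat_delete_def)
  then show ?thesis
    using B by (intro eq_matI) (auto simp: adj_mat_def cofactor_def h.hom_mult h.hom_power h.hom_uminus)
qed

lemma gram_proj_hom:
  assumes h: "comm_ring_hom h" and X: "\<And>i. i < m \<Longrightarrow> X i \<in> carrier_mat n n" and y: "y \<in> carrier_mat n n"
  shows "map_mat h (gram_proj n m X y) = gram_proj n m (\<lambda>i. map_mat h (X i)) (map_mat h y)"
proof -
  interpret h: comm_ring_hom h by (rule h)
  have "h (gram_coeff m X y i) = gram_coeff m (\<lambda>i. map_mat h (X i)) (map_mat h y) i" if i: "i < m" for i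
  proof -
    have "mat_trace (map_mat h (X j) * map_mat h y) = h (mat_trace (X j * y))" if "j < m" for j
      using mat_trace_hom[OF h mult_carrier_mat[OF X[OF that] y]] h.mat_hom_mult[OF X[OF that] y] by simp
    then show ?thesis using i adj_mat(1)[OF gram_carrier[of m X]]
      by (simp add: gram_coeff_def gram_hom[OF h X] adj_mat_hom[OF h gram_carrier] h.hom_sum h.hom_mult)
  qed
  then show ?thesis unfolding gram_proj_def
    using X by (subst mat_sum_hom[OF h]) (auto intro!: mat_sum_cong)
qed

lemma gram_proj_orthogonal:
  fixes X :: "nat \<Rightarrow> 'f::field mat"
  assumes X: "\<And>i. i < m \<Longrightarrow> X i \<in> carrier_mat n n"
    and orth: "\<And>i j. i < m \<Longrightarrow> j < m \<Longrightarrow> i \<noteq> j \<Longrightarrow> mat_trace (X i * X j) = 0"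
    and norm: "\<And>i. i < m \<Longrightarrow> mat_trace (X i * X i) \<noteq> 0"
  shows "det (gram m X) \<noteq> 0"
    and "gram_proj n m X y =
      mat_sum n (\<lambda>i. (det (gram m X) * mat_trace (X i * y) / mat_trace (X i * X i)) \<cdot>\<^sub>m X i) {..<m}"
proof -
  have diag: "gram m X $$ (i, j) = (if i = j then mat_trace (X i * X i) else 0)" if "i < m" "j < m" for i j
    using that orth by (simp add: gram_def)
  have "upper_triangular (gram m X)" using orth by (auto simp: gram_def)
  then have "det (gram m X) = prod_list (diag_mat (gram m X))"
    using det_upper_triangular[OF _ gram_carrier] by blast
  also have "\<dots> \<noteq> 0" using norm by (auto simp: prod_list_zero_iff diag_mat_def gram_def)
  finally show "det (gram m X) \<noteq> 0" .
  have "adj_mat (gram m X) $$ (i, j) = (if i = j then det (gram m X) / mat_trace (X i * X i) else 0)"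
    if ij: "i < m" "j < m" for i j
  proof -
    have "(gram m X * adj_mat (gram m X)) $$ (i, j) = (\<Sum>k<m. gram m X $$ (i, k) * adj_mat (gram m X) $$ (k, j))"
      using ij adj_mat(1)[OF gram_carrier[of m X]] gram_carrier[of m X]
      by (simp add: scalar_prod_def atLeast0LessThan)
    also have "\<dots> = (\<Sum>k<m. if k = i then mat_trace (X i * X i) * adj_mat (gram m X) $$ (i, j) else 0)"
      using ij by (intro sum.cong) (auto simp: diag)
    also have "\<dots> = mat_trace (X i * X i) * adj_mat (gram m X) $$ (i, j)" using ij by simp
    finally have "mat_trace (X i * X i) * adj_mat (gram m X) $$ (i, j) = (det (gram m X) \<cdot>\<^sub>m 1\<^sub>m m) $$ (i, j)"
      by (simp only: adj_mat(2)[OF gram_carrier])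
    then show ?thesis using ij norm[OF ij(1)] by (auto simp: field_simps)
  qed
  then have "gram_coeff m X y i = (\<Sum>j<m. if j = i then det (gram m X) / mat_trace (X i * X i) * mat_trace (X i * y) else 0)"
    if "i < m" for i
    unfolding gram_coeff_def using that by (intro sum.cong) auto
  then have "gram_coeff m X y i = det (gram m X) * mat_trace (X i * y) / mat_trace (X i * X i)" if "i < m" for i
    using that by simp
  then show "gram_proj n m X y =
      mat_sum n (\<lambda>i. (det (gram m X) * mat_trace (X i * y) / mat_trace (X i * X i)) \<cdot>\<^sub>m X i) {..<m}"
    unfolding gram_proj_def by (intro mat_sum_cong) auto
qed

lemma gram_proj_smult:
  assumes X: "\<And>i. i < m \<Longrightarrow> X i \<in> carrier_mat n n" and y: "y \<in> carrier_mat n n"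
  shows "gram_proj n m X (a \<cdot>\<^sub>m y) = a \<cdot>\<^sub>m gram_proj n m X y"
proof -
  have "mat_trace (X j * (a \<cdot>\<^sub>m y)) = a * mat_trace (X j * y)" if "j < m" for j
    using mult_smult_distrib[OF X[OF that] y] mat_trace_smult[OF mult_carrier_mat[OF X[OF that] y]] by simp
  then have "gram_coeff m X (a \<cdot>\<^sub>m y) i = a * gram_coeff m X y i" for i
    by (simp add: gram_coeff_def sum_distrib_left mult_ac)
  then have "gram_proj n m X (a \<cdot>\<^sub>m y) = mat_sum n (\<lambda>i. a \<cdot>\<^sub>m (gram_coeff m X y i \<cdot>\<^sub>m X i)) {..<m}"
    unfolding gram_proj_def by (intro mat_sum_cong) (auto simp: mult.assoc)
  also have "\<dots> = a \<cdot>\<^sub>m gram_proj n m X y"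
    unfolding gram_proj_def using X by (intro mat_sum_smult) auto
  finally show ?thesis .
qed

definition span_proj :: "nat \<Rightarrow> nat \<Rightarrow> (nat \<Rightarrow> 'f::field mat) \<Rightarrow> 'f mat \<Rightarrow> 'f mat" where
  "span_proj n m X y = inverse (det (gram m X)) \<cdot>\<^sub>m gram_proj n m X y"

lemma span_proj_carrier [simp]: "span_proj n m X y \<in> carrier_mat n n"
  by (simp add: span_proj_def)

lemma trace_span_proj:
  assumes X: "\<And>i. i < m \<Longrightarrow> X i \<in> carrier_mat n n" and det: "det (gram m X) \<noteq> 0" and l: "l < m"
  shows "mat_trace (X l * span_proj n m X y) = mat_trace (X l * y)"
proof -
  have "X l * span_proj n m X y = inverse (det (gram m X)) \<cdot>\<^sub>m (X l * gram_proj n m X y)"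
    unfolding span_proj_def by (rule mult_smult_distrib[OF X[OF l] gram_proj_carrier])
  then have "mat_trace (X l * span_proj n m X y) = inverse (det (gram m X)) * mat_trace (X l * gram_proj n m X y)"
    using mat_trace_smult[OF mult_carrier_mat[OF X[OF l] gram_proj_carrier]] by simp
  then show ?thesis using trace_gram_proj[of m X n l y] X l det by simp
qed

lemma span_proj_in_span:
  assumes X: "\<And>i. i < m \<Longrightarrow> X i \<in> carrier_mat n n"
  shows "\<exists>c. span_proj n m X y = mat_sum n (\<lambda>i. c i \<cdot>\<^sub>m X i) {..<m}"
proof -
  have "span_proj n m X y = mat_sum n (\<lambda>i. inverse (det (gram m X)) \<cdot>\<^sub>m (gram_coeff m X y i \<cdot>\<^sub>m X i)) {..<m}"
    unfolding span_proj_def gram_proj_def using X by (intro mat_sum_smult[symmetric]) auto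
  also have "\<dots> = mat_sum n (\<lambda>i. (inverse (det (gram m X)) * gram_coeff m X y i) \<cdot>\<^sub>m X i) {..<m}"
    by (intro mat_sum_cong) (auto intro!: eq_matI)
  finally show ?thesis by (intro exI[of _ "\<lambda>i. inverse (det (gram m X)) * gram_coeff m X y i"])
qed

text \<open>
  The difference of the two projections of \<open>y\<close> lies in the common span and is orthogonal to it, and
  the trace form is nondegenerate there.
\<close>

lemma span_proj_change_basis:
  fixes X Y :: "nat \<Rightarrow> 'f::field mat"
  assumes X: "\<And>i. i < m \<Longrightarrow> X i \<in> carrier_mat n n"
    and Y: "\<And>j. j < m \<Longrightarrow> Y j = mat_sum n (\<lambda>i. \<gamma> i j \<cdot>\<^sub>m X i) {..<m}"
    and inv: "\<And>i k. i < m \<Longrightarrow> k < m \<Longrightarrow> (\<Sum>l<m. \<gamma> i l * \<eta> l k) = (if i = k then 1 else 0)"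
    and det: "det (gram m X) \<noteq> 0" "det (gram m Y) \<noteq> 0" and y: "y \<in> carrier_mat n n"
  shows "span_proj n m Y y = span_proj n m X y"
proof -
  have Y_car: "Y j \<in> carrier_mat n n" if "j < m" for j using Y[OF that] by simp
  let ?P = "span_proj n m X y" and ?P' = "span_proj n m Y y"
  have trace_Y: "mat_trace (Y j * z) = (\<Sum>i<m. \<gamma> i j * mat_trace (X i * z))" if "j < m" "z \<in> carrier_mat n n" for j z
  proof -
    have "mat_trace (Y j * z) = mat_trace (z * Y j)" using Y_car that by (intro mat_trace_mult_comm)
    also have "\<dots> = (\<Sum>i<m. \<gamma> i j * mat_trace (z * X i))"
      unfolding Y[OF that(1)] using X that by (intro mat_trace_mult_mat_sum) auto
    also have "\<dots> = (\<Sum>i<m. \<gamma> i j * mat_trace (X i * z))"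
      using X that by (intro sum.cong refl arg_cong[of _ _ "(*) _"] mat_trace_mult_comm) auto
    finally show ?thesis .
  qed
  obtain c where c: "?P = mat_sum n (\<lambda>i. c i \<cdot>\<^sub>m X i) {..<m}" using span_proj_in_span[where X = X and m = m and n = n and y = y] X by blast
  obtain c' where c': "?P' = mat_sum n (\<lambda>j. c' j \<cdot>\<^sub>m Y j) {..<m}" using span_proj_in_span[where X = Y and m = m and n = n and y = y] Y_car by blast
  define D where "D = ?P' - ?P"
  have D_car: "D \<in> carrier_mat n n" unfolding D_def by (rule minus_carrier_mat) simp
  have D_span: "D = mat_sum n (\<lambda>i. ((\<Sum>j<m. c' j * \<gamma> i j) - c i) \<cdot>\<^sub>m X i) {..<m}" (is "_ = ?S")
  proof (rule eq_matI)
    fix k l assume "k < dim_row ?S" "l < dim_col ?S"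
    then have kl: "k < n" "l < n" by auto
    have "?P $$ (k, l) = (\<Sum>i<m. c i * X i $$ (k, l))"
      unfolding c using kl X by (intro mat_sum_smult_index) auto
    moreover have "?P' $$ (k, l) = (\<Sum>j<m. c' j * Y j $$ (k, l))"
      unfolding c' using kl Y_car by (intro mat_sum_smult_index) auto
    moreover have "Y j $$ (k, l) = (\<Sum>i<m. \<gamma> i j * X i $$ (k, l))" if "j < m" for j
      unfolding Y[OF that] using kl X by (intro mat_sum_smult_index) auto
    ultimately have "D $$ (k, l) = (\<Sum>j<m. \<Sum>i<m. c' j * \<gamma> i j * X i $$ (k, l)) - (\<Sum>i<m. c i * X i $$ (k, l))"
      using kl carrier_matD[OF span_proj_carrier[of n m X y]] by (simp add: D_def sum_distrib_left mult_ac)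
    also have "\<dots> = (\<Sum>i<m. ((\<Sum>j<m. c' j * \<gamma> i j) - c i) * X i $$ (k, l))"
      by (subst sum.swap) (simp add: sum_distrib_right left_diff_distrib sum_subtractf)
    also have "\<dots> = ?S $$ (k, l)" using kl X by (intro mat_sum_smult_index[symmetric]) auto
    finally show "D $$ (k, l) = ?S $$ (k, l)" .
  qed (use D_car in auto)
  have trace_diff: "mat_trace (a * D) = mat_trace (a * ?P') - mat_trace (a * ?P)" if "a \<in> carrier_mat n n" for a
    unfolding D_def using mult_minus_distrib_mat[OF that span_proj_carrier span_proj_carrier]
      mat_trace_diff[OF mult_carrier_mat[OF that span_proj_carrier] mult_carrier_mat[OF that span_proj_carrier]] by simp
  have "(\<Sum>i<m. \<gamma> i l * mat_trace (X i * D)) = 0" if l: "l < m" for l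
  proof -
    have "(\<Sum>i<m. \<gamma> i l * mat_trace (X i * D)) = mat_trace (Y l * ?P') - mat_trace (Y l * ?P)"
      using trace_Y[OF l D_car] trace_diff[OF Y_car[OF l]] by simp
    also have "mat_trace (Y l * ?P') = mat_trace (Y l * y)" using trace_span_proj[OF Y_car det(2) l] .
    also have "mat_trace (Y l * ?P) = (\<Sum>i<m. \<gamma> i l * mat_trace (X i * y))"
      using trace_Y[OF l span_proj_carrier] trace_span_proj[OF X det(1)] by simp
    also have "\<dots> = mat_trace (Y l * y)" by (rule trace_Y[OF l y, symmetric])
    finally show ?thesis by simp
  qed
  note zero = this
  have "mat_trace (X k * D) = 0" if k: "k < m" for k
  proof -
    have "0 = (\<Sum>l<m. \<eta> l k * (\<Sum>i<m. \<gamma> i l * mat_trace (X i * D)))" using zero by simp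
    also have "\<dots> = (\<Sum>i<m. (\<Sum>l<m. \<gamma> i l * \<eta> l k) * mat_trace (X i * D))"
      unfolding sum_distrib_left sum_distrib_right by (subst sum.swap) (simp add: mult_ac)
    also have "\<dots> = (\<Sum>i<m. if i = k then mat_trace (X k * D) else 0)"
      using k by (intro sum.cong) (auto simp: inv)
    finally show ?thesis using k by simp
  qed
  then have "D = 0\<^sub>m n n" using gram_span_trivial[OF X det(1) D_span] by blast
  then show ?thesis unfolding D_def by (rule mat_eq_if_diff_zero[OF span_proj_carrier span_proj_carrier])
qed

section \<open>A specialization separated by its trace form\<close>

lemma mat_trace_mult:
  assumes "a \<in> carrier_mat n n" "b \<in> carrier_mat n n"
  shows "mat_trace (a * b) = (\<Sum>k<n. \<Sum>l<n. a $$ (k, l) * (b $$ (l, k) :: 'a::comm_ring_1))"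
  using assms by (auto simp: mat_trace_def scalar_prod_def atLeast0LessThan)

text \<open>
  Symmetric or antisymmetric rational matrices.  The trace form is indefinite on all matrices, but
  definite on each of these two subspaces.
\<close>

definition transpose_eigen :: "nat \<Rightarrow> rat mat \<Rightarrow> bool" where
  "transpose_eigen n D \<longleftrightarrow> D \<in> carrier_mat n n \<and>
     (\<exists>s. (s = 1 \<or> s = -1) \<and> (\<forall>k<n. \<forall>l<n. D $$ (l, k) = s * D $$ (k, l)))"

lemma trace_square_transpose_eigen:
  assumes D: "transpose_eigen n D" and nz: "D \<noteq> 0\<^sub>m n n"
  shows "mat_trace (D * D) \<noteq> 0"
proof -
  obtain s where car: "D \<in> carrier_mat n n" and s: "s = 1 \<or> s = -1"
    and sym: "\<And>k l. k < n \<Longrightarrow> l < n \<Longrightarrow> D $$ (l, k) = s * D $$ (k, l)"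
    using D unfolding transpose_eigen_def by blast
  have "mat_trace (D * D) = (\<Sum>k<n. \<Sum>l<n. D $$ (k, l) * (s * D $$ (k, l)))"
    unfolding mat_trace_mult[OF car car] by (intro sum.cong refl arg_cong[of _ _ "(*) _"] sym) auto
  also have "\<dots> = s * (\<Sum>k<n. \<Sum>l<n. D $$ (k, l) ^ 2)"
    by (simp add: sum_distrib_left power2_eq_square mult_ac)
  finally have eq: "mat_trace (D * D) = s * (\<Sum>k<n. \<Sum>l<n. D $$ (k, l) ^ 2)" .
  have "(\<Sum>k<n. \<Sum>l<n. D $$ (k, l) ^ 2) \<noteq> 0"
  proof
    assume "(\<Sum>k<n. \<Sum>l<n. D $$ (k, l) ^ 2) = 0"
    then have "\<forall>k<n. \<forall>l<n. D $$ (k, l) = 0"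
      by (simp add: sum_nonneg_eq_0_iff sum_nonneg)
    then have "D = 0\<^sub>m n n" using car by (intro eq_matI) auto
    then show False using nz by simp
  qed
  then show ?thesis using s unfolding eq by auto
qed

text \<open>
  Orthogonality to \<open>r\<close> matrices amounts to \<open>r\<close> linear conditions on \<open>n\<^sup>2\<close> entries and thus has a nonzero
  solution.  The conditions are stable under transposition, so the symmetric and the antisymmetric part
  of the solution are solutions, too, and one of them is not zero.
\<close>

lemma ex_orthogonal_matrix:
  assumes C: "\<And>t. t < r \<Longrightarrow> transpose_eigen n (C t)" and r: "r < n * n"
  shows "\<exists>Z. transpose_eigen n Z \<and> Z \<noteq> 0\<^sub>m n n \<and> (\<forall>t<r. mat_trace (C t * Z) = 0)"
proof -
  have "\<exists>c. (\<exists>p\<in>{..<n} \<times> {..<n}. c p \<noteq> 0) \<and>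
      (\<forall>t\<in>{..<r}. (\<Sum>p\<in>{..<n} \<times> {..<n}. c p * (case p of (l, k) \<Rightarrow> C t $$ (k, l))) = (0::rat))"
    using r by (intro underdetermined_system) auto
  then obtain c k0 l0 where kl0: "k0 < n" "l0 < n" "c (k0, l0) \<noteq> 0"
    and c: "\<And>t. t < r \<Longrightarrow> (\<Sum>p\<in>{..<n} \<times> {..<n}. c p * (case p of (l, k) \<Rightarrow> C t $$ (k, l))) = (0::rat)"
    by auto
  have c1: "(\<Sum>k<n. \<Sum>l<n. C t $$ (k, l) * c (l, k)) = 0" if t: "t < r" for t
  proof -
    have "(\<Sum>k<n. \<Sum>l<n. C t $$ (k, l) * c (l, k)) = (\<Sum>l<n. \<Sum>k<n. C t $$ (k, l) * c (l, k))" by (rule sum.swap)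
    also have "\<dots> = 0" using c[OF t] by (simp add: sum.cartesian_product case_prod_beta mult.commute)
    finally show ?thesis .
  qed
  have c2: "(\<Sum>k<n. \<Sum>l<n. C t $$ (k, l) * c (k, l)) = 0" if t: "t < r" for t
  proof -
    obtain s where s: "\<And>k l. k < n \<Longrightarrow> l < n \<Longrightarrow> C t $$ (l, k) = s * C t $$ (k, l)"
      using C[OF t] unfolding transpose_eigen_def by blast
    have "(\<Sum>k<n. \<Sum>l<n. C t $$ (k, l) * c (k, l)) = (\<Sum>l<n. \<Sum>k<n. C t $$ (k, l) * c (k, l))" by (rule sum.swap)
    also have "\<dots> = (\<Sum>l<n. \<Sum>k<n. s * (C t $$ (l, k) * c (k, l)))"
    proof (intro sum.cong refl)
      fix k l assume "k \<in> {..<n}" "l \<in> {..<n}"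
      then show "C t $$ (k, l) * c (k, l) = s * (C t $$ (l, k) * c (k, l))"
        by (simp only: s[of l k] lessThan_iff mult.assoc)
    qed
    also have "\<dots> = s * (\<Sum>k<n. \<Sum>l<n. C t $$ (k, l) * c (l, k))" by (simp add: sum_distrib_left)
    finally show ?thesis using c1[OF t] by simp
  qed
  define Z where "Z s = mat n n (\<lambda>(k, l). c (k, l) + s * c (l, k))" for s
  have eigen: "transpose_eigen n (Z s)" if "s = 1 \<or> s = -1" for s
    unfolding transpose_eigen_def using that
    by (intro conjI exI[of _ s]) (auto simp: Z_def)
  have orth: "mat_trace (C t * Z s) = 0" if t: "t < r" for t s
  proof -
    have "C t \<in> carrier_mat n n" using C[OF t] by (simp add: transpose_eigen_def)
    then have "mat_trace (C t * Z s) = (\<Sum>k<n. \<Sum>l<n. C t $$ (k, l) * (c (l, k) + s * c (k, l)))"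
      by (subst mat_trace_mult[of _ n]) (auto simp: Z_def)
    also have "\<dots> = (\<Sum>k<n. \<Sum>l<n. C t $$ (k, l) * c (l, k)) + s * (\<Sum>k<n. \<Sum>l<n. C t $$ (k, l) * c (k, l))"
      by (simp add: distrib_left sum.distrib sum_distrib_left mult_ac)
    finally show ?thesis using c1[OF t] c2[OF t] by simp
  qed
  have "Z 1 \<noteq> 0\<^sub>m n n \<or> Z (-1) \<noteq> 0\<^sub>m n n"
  proof (rule ccontr)
    assume "\<not> ?thesis"
    then have "Z 1 $$ (k0, l0) = 0" "Z (-1) $$ (k0, l0) = 0" using kl0 by auto
    then show False using kl0 by (simp add: Z_def)
  qed
  then show ?thesis using eigen orth by blast
qed

lemma ex_orthogonal_family:
  assumes C: "\<And>t. t < r \<Longrightarrow> transpose_eigen n (C t)" and "r + j \<le> n * n"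
  shows "\<exists>Y. (\<forall>i<j. transpose_eigen n (Y i) \<and> Y i \<noteq> 0\<^sub>m n n \<and> (\<forall>t<r. mat_trace (C t * Y i) = 0)) \<and>
    (\<forall>i<j. \<forall>i'<j. i \<noteq> i' \<longrightarrow> mat_trace (Y i * Y i') = 0)"
  using assms(2)
proof (induction j)
  case 0
  then show ?case by simp
next
  case (Suc j)
  then obtain Y where Y: "\<forall>i<j. transpose_eigen n (Y i) \<and> Y i \<noteq> 0\<^sub>m n n \<and> (\<forall>t<r. mat_trace (C t * Y i) = 0)"
    "\<forall>i<j. \<forall>i'<j. i \<noteq> i' \<longrightarrow> mat_trace (Y i * Y i') = 0" by auto
  have "\<exists>Z. transpose_eigen n Z \<and> Z \<noteq> 0\<^sub>m n n \<and>
      (\<forall>t<r + j. mat_trace ((if t < r then C t else Y (t - r)) * Z) = 0)"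
    using C Y(1) Suc.prems by (intro ex_orthogonal_matrix) auto
  then obtain Z where Z: "transpose_eigen n Z" "Z \<noteq> 0\<^sub>m n n"
    "\<And>t. t < r + j \<Longrightarrow> mat_trace ((if t < r then C t else Y (t - r)) * Z) = 0" by blast
  have CZ: "mat_trace (C t * Z) = 0" if "t < r" for t using Z(3)[of t] that by simp
  have YZ: "mat_trace (Y i * Z) = 0" if "i < j" for i using Z(3)[of "r + i"] that by simp
  moreover have "mat_trace (Z * Y i) = 0" if "i < j" for i
    using YZ[OF that] mat_trace_mult_comm[of Z n "Y i"] Z(1) Y(1) that by (auto simp: transpose_eigen_def)
  ultimately show ?case
    using Y Z(1,2) CZ by (intro exI[of _ "Y(j := Z)"]) (auto simp: less_Suc_eq)
qed

text \<open>
  The functional form makes products and traces of diagonal matrices computable.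
\<close>

definition diag_of :: "nat \<Rightarrow> (nat \<Rightarrow> 'a::zero) \<Rightarrow> 'a mat" where
  "diag_of n f = mat n n (\<lambda>(i, j). if i = j then f i else 0)"

lemma diag_of_carrier [simp]: "diag_of n f \<in> carrier_mat n n" by (simp add: diag_of_def)

lemma trace_diag_of_mult:
  assumes "b \<in> carrier_mat n n"
  shows "mat_trace (diag_of n f * b) = (\<Sum>i<n. f i * (b $$ (i, i) :: 'a::comm_ring_1))"
proof -
  have "mat_trace (diag_of n f * b) = (\<Sum>k<n. \<Sum>l<n. diag_of n f $$ (k, l) * b $$ (l, k))"
    using assms by (intro mat_trace_mult) auto
  also have "\<dots> = (\<Sum>k<n. \<Sum>l<n. if l = k then f k * b $$ (k, k) else 0)"
    by (intro sum.cong refl) (auto simp: diag_of_def)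
  finally have "mat_trace (diag_of n f * b) = (\<Sum>k<n. \<Sum>l<n. if l = k then f k * b $$ (k, k) else 0)" .
  then show ?thesis by simp
qed

lemma diag_of_mult: "diag_of n f * diag_of n g = diag_of n (\<lambda>i. f i * (g i :: 'a::comm_ring_1))"
proof (rule eq_matI)
  fix i j assume "i < dim_row (diag_of n (\<lambda>i. f i * g i))" "j < dim_col (diag_of n (\<lambda>i. f i * g i))"
  then have ij: "i < n" "j < n" by (auto simp: diag_of_def)
  have "(diag_of n f * diag_of n g) $$ (i, j) = (\<Sum>k<n. diag_of n f $$ (i, k) * diag_of n g $$ (k, j))"
    using ij by (simp add: diag_of_def scalar_prod_def atLeast0LessThan)
  also have "\<dots> = (\<Sum>k<n. if k = i then if i = j then f i * g i else 0 else 0)"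
    using ij by (intro sum.cong refl) (auto simp: diag_of_def)
  finally have "(diag_of n f * diag_of n g) $$ (i, j) = (\<Sum>k<n. if k = i then if i = j then f i * g i else 0 else 0)" .
  then show "(diag_of n f * diag_of n g) $$ (i, j) = diag_of n (\<lambda>i. f i * g i) $$ (i, j)"
    using ij by (simp add: diag_of_def)
qed (auto simp: diag_of_def)

lemma one_mat_diag_of: "1\<^sub>m n = diag_of n (\<lambda>_. 1)" by (auto simp: diag_of_def)

text \<open>
  Up to nonzero factors, \<open>gram_proj n m x 1\<close> and \<open>gram_proj n m x (U * U)\<close> with
  \<open>U = gram_proj n m x 1\<close> are the specializations of the invariants \<open>u = p(1)\<close> and \<open>v = p(u\<^sup>2)\<close>.
\<close>

definition separating_frame :: "nat \<Rightarrow> nat \<Rightarrow> (nat \<Rightarrow> 'a::comm_ring_1 mat) \<Rightarrow> bool" where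
  "separating_frame n m x \<longleftrightarrow> (\<forall>i<m. x i \<in> carrier_mat n n) \<and> det (gram m x) \<noteq> 0 \<and>
     diagonal_mat (gram_proj n m x (1\<^sub>m n)) \<and>
     inj_on (\<lambda>i. gram_proj n m x (1\<^sub>m n) $$ (i, i)) {..<n} \<and>
     (\<forall>i<n. \<forall>j<n. i \<noteq> j \<longrightarrow>
        gram_proj n m x (gram_proj n m x (1\<^sub>m n) * gram_proj n m x (1\<^sub>m n)) $$ (i, j) \<noteq> 0)"

text \<open>
  The family consists of \<open>d = diag(1, \<dots>, n)\<close>, of \<open>b\<close> with ones off the diagonal and
  \<open>1, -2, 1, 0, \<dots>, 0\<close> on it, and of matrices orthogonal to \<open>1\<close>, \<open>d\<close>, \<open>d\<^sup>2\<close>, \<open>b\<close> and to each other.  The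
  diagonal of \<open>b\<close> is a second difference: it annihilates constant and linear sequences but not
  squares.  Hence the family is orthogonal, \<open>1\<close> projects to a multiple of \<open>d\<close>, and \<open>d\<^sup>2\<close> projects to
  a combination of \<open>d\<close> and \<open>b\<close> in which \<open>b\<close> occurs.
\<close>

lemma ex_rational_specialization:
  assumes m: "2 \<le> m" "m \<le> n\<^sup>2 - 2" and n: "3 \<le> n"
  shows "\<exists>x :: nat \<Rightarrow> rat mat. separating_frame n m x"
proof -
  define f :: "nat \<Rightarrow> rat" where "f i = of_nat (i + 1)" for i
  define \<beta> :: "nat \<Rightarrow> rat" where "\<beta> i = (if i = 0 \<or> i = 2 then 1 else if i = 1 then -2 else 0)" for i
  define d where "d = diag_of n f"
  define b where "b = mat n n (\<lambda>(i, j). if i = j then \<beta> i else 1)"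
  have car [simp]: "d \<in> carrier_mat n n" "b \<in> carrier_mat n n" by (simp_all add: d_def b_def)
  have \<beta>_sum: "(\<Sum>i<n. g i * \<beta> i) = g 0 - 2 * g 1 + g 2" for g :: "nat \<Rightarrow> rat"
  proof -
    have "(\<Sum>i<n. g i * \<beta> i) = (\<Sum>i\<in>{0, 1, 2}. g i * \<beta> i)"
      using n by (intro sum.mono_neutral_right) (auto simp: \<beta>_def)
    also have "\<dots> = g 0 - 2 * g 1 + g 2" by (simp add: \<beta>_def)
    finally show ?thesis .
  qed
  have diag_b: "mat_trace (diag_of n g * b) = g 0 - 2 * g 1 + g 2" for g
    by (subst trace_diag_of_mult[OF car(2)]) (simp add: b_def \<beta>_sum)
  have db: "mat_trace (d * b) = 0" unfolding d_def diag_b by (simp add: f_def)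
  have ddb: "mat_trace (d * d * b) = 2" unfolding d_def diag_of_mult diag_b by (simp add: f_def)
  have one_b: "mat_trace b = 0" using diag_b[of "\<lambda>_. 1"] left_mult_one_mat[OF car(2)]
    by (simp flip: one_mat_diag_of)
  have trace_d: "mat_trace d \<noteq> 0"
  proof -
    have "mat_trace d = (\<Sum>i<n. f i)" by (simp add: d_def mat_trace_def diag_of_def)
    also have "\<dots> > 0" using n by (intro sum_pos) (auto simp: f_def lessThan_empty_iff)
    finally show ?thesis by simp
  qed
  have eigen_diag: "transpose_eigen n (diag_of n g)" for g
    unfolding transpose_eigen_def by (auto intro!: exI[of _ 1] simp: diag_of_def)
  have eigen_b: "transpose_eigen n b"
    unfolding transpose_eigen_def by (auto intro!: exI[of _ 1] simp: b_def)
  have trace_dd: "mat_trace (d * d) \<noteq> 0"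
  proof (rule trace_square_transpose_eigen)
    show "transpose_eigen n d" unfolding d_def by (rule eigen_diag)
    show "d \<noteq> 0\<^sub>m n n" using trace_d by (auto simp: mat_trace_def)
  qed
  have trace_bb: "mat_trace (b * b) \<noteq> 0"
  proof (rule trace_square_transpose_eigen[OF eigen_b])
    have "b $$ (0, 1) = 1" using n by (simp add: b_def)
    then show "b \<noteq> 0\<^sub>m n n" using n by auto
  qed
  \<comment> \<open>Four conditions and at most \<open>n\<^sup>2 - 4\<close> further matrices fit into the space of dimension \<open>n\<^sup>2\<close>.\<close>
  define C where "C t = (if t = 0 then 1\<^sub>m n else if t = 1 then d else if t = 2 then d * d else b)" for t :: nat
  have "transpose_eigen n (C t)" for t
    using eigen_diag eigen_b by (simp add: C_def one_mat_diag_of d_def diag_of_mult)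
  moreover have "4 + (m - 2) \<le> n * n"
  proof -
    have "3 * 3 \<le> n * n" using n by (intro mult_mono) auto
    then show ?thesis using m by (simp add: power2_eq_square)
  qed
  ultimately obtain Y where
    Y1: "\<And>i. i < m - 2 \<Longrightarrow> transpose_eigen n (Y i) \<and> Y i \<noteq> 0\<^sub>m n n \<and> (\<forall>t<4. mat_trace (C t * Y i) = 0)"
    and Y2: "\<And>i i'. i < m - 2 \<Longrightarrow> i' < m - 2 \<Longrightarrow> i \<noteq> i' \<Longrightarrow> mat_trace (Y i * Y i') = 0"
    using ex_orthogonal_family[of 4 n C "m - 2"] by blast
  have Y_car: "Y i \<in> carrier_mat n n" if "i < m - 2" for i using Y1[OF that] by (simp add: transpose_eigen_def)
  have CY: "mat_trace (C t * Y i) = 0" if "t < 4" "i < m - 2" for t i using Y1 that by blast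
  have Y_one: "mat_trace (Y i) = 0" and Yd: "mat_trace (d * Y i) = 0"
    and Ydd: "mat_trace (d * d * Y i) = 0" and Yb: "mat_trace (b * Y i) = 0" if "i < m - 2" for i
    using CY[of 0 i] CY[of 1 i] CY[of 2 i] CY[of 3 i] that Y_car[OF that] by (simp_all add: C_def)
  define x where "x i = (if i = 0 then d else if i = 1 then b else Y (i - 2))" for i
  have x_car: "x i \<in> carrier_mat n n" if "i < m" for i using that Y_car by (auto simp: x_def)
  have comm: "mat_trace (p * q) = mat_trace (q * p)"
    if "p \<in> carrier_mat n n" "q \<in> carrier_mat n n" for p q :: "rat mat"
    using that by (rule mat_trace_mult_comm)
  have orth: "mat_trace (x i * x j) = 0" if ij: "i < m" "j < m" "i \<noteq> j" for i j
  proof -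
    have less: "mat_trace (x i * x j) = 0" if "i < j" "j < m" for i j
    proof -
      consider "i = 0" "j = 1" | "i = 0" "j \<ge> 2" | "i = 1" "j \<ge> 2" | "i \<ge> 2" "j \<ge> 2" using \<open>i < j\<close> by linarith
      then show ?thesis using that Yd[of "j - 2"] Yb[of "j - 2"] Y2[of "i - 2" "j - 2"] db
        by cases (auto simp: x_def)
    qed
    show ?thesis
      using less[of i j] less[of j i] comm[OF x_car x_car] ij by (cases "i < j") auto
  qed
  have norm: "mat_trace (x i * x i) \<noteq> 0" if "i < m" for i
  proof (cases "i \<ge> 2")
    case True
    then have "i - 2 < m - 2" using that by simp
    then show ?thesis using trace_square_transpose_eigen[of n "Y (i - 2)"] Y1[of "i - 2"] True by (simp add: x_def)
  next
    case False
    then have "i = 0 \<or> i = 1" by linarith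
    then show ?thesis using trace_dd trace_bb by (auto simp: x_def)
  qed
  define U where "U = gram_proj n m x (1\<^sub>m n)"
  define V where "V = gram_proj n m x (U * U)"
  define \<delta> where "\<delta> = det (gram m x)"
  have \<delta>: "\<delta> \<noteq> 0" unfolding \<delta>_def using x_car orth norm by (rule gram_proj_orthogonal(1))
  have proj_entry: "gram_proj n m x y $$ (k, l) = (\<Sum>i<m. \<delta> * mat_trace (x i * y) / mat_trace (x i * x i) * x i $$ (k, l))"
    if "k < n" "l < n" for y k l
  proof -
    have "gram_proj n m x y = mat_sum n (\<lambda>i. (\<delta> * mat_trace (x i * y) / mat_trace (x i * x i)) \<cdot>\<^sub>m x i) {..<m}"
      unfolding \<delta>_def using x_car orth norm by (rule gram_proj_orthogonal(2))
    then show ?thesis using that x_car by (simp only:) (intro mat_sum_smult_index, auto)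
  qed
  define \<gamma> where "\<gamma> = \<delta> * mat_trace d / mat_trace (d * d)"
  have \<gamma>: "\<gamma> \<noteq> 0" using \<delta> trace_d trace_dd by (simp add: \<gamma>_def)
  have U: "U = diag_of n (\<lambda>i. \<gamma> * f i)"
  proof (rule eq_matI)
    fix k l assume "k < dim_row (diag_of n (\<lambda>i. \<gamma> * f i))" "l < dim_col (diag_of n (\<lambda>i. \<gamma> * f i))"
    then have kl: "k < n" "l < n" by (auto simp: diag_of_def)
    have "mat_trace (x i * 1\<^sub>m n) = (if i = 0 then mat_trace d else 0)" if "i < m" for i
      using that one_b Y_one[of "i - 2"] right_mult_one_mat[OF x_car[OF that]] by (auto simp: x_def)
    then have "U $$ (k, l) = (\<Sum>i<m. if i = 0 then \<gamma> * d $$ (k, l) else 0)"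
      unfolding U_def proj_entry[OF kl] by (intro sum.cong) (auto simp: \<gamma>_def x_def)
    also have "\<dots> = \<gamma> * d $$ (k, l)" using m by simp
    finally show "U $$ (k, l) = diag_of n (\<lambda>i. \<gamma> * f i) $$ (k, l)"
      using kl by (simp add: d_def diag_of_def)
  qed (auto simp: U_def diag_of_def gram_proj_def)
  have UU: "U * U = (\<gamma>\<^sup>2) \<cdot>\<^sub>m (d * d)"
    unfolding U d_def diag_of_mult by (auto simp: diag_of_def power2_eq_square)
  have trace_UU: "mat_trace (x i * (U * U)) = \<gamma>\<^sup>2 * mat_trace (d * d * x i)" if "i < m" for i
  proof -
    have dd: "d * d \<in> carrier_mat n n" by (intro mult_carrier_mat[of _ n n]) auto
    have "x i * (U * U) = \<gamma>\<^sup>2 \<cdot>\<^sub>m (x i * (d * d))" unfolding UU by (rule mult_smult_distrib[OF x_car[OF that] dd])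
    then show ?thesis
      using mat_trace_smult[OF mult_carrier_mat[OF x_car[OF that] dd]] comm[OF x_car[OF that] dd] by simp
  qed
  have "V $$ (k, l) \<noteq> 0" if kl: "k < n" "l < n" "k \<noteq> l" for k l
  proof -
    have "\<delta> * mat_trace (x i * (U * U)) / mat_trace (x i * x i) * x i $$ (k, l)
        = (if i = 1 then \<delta> * (\<gamma>\<^sup>2 * 2) / mat_trace (b * b) else 0)" if i: "i < m" for i
    proof -
      consider "i = 0" | "i = 1" | "i \<ge> 2" by linarith
      then show ?thesis
      proof cases
        case 1
        then show ?thesis using kl by (simp add: x_def d_def diag_of_def)
      next
        case 2
        then show ?thesis using kl trace_UU[OF i] ddb by (simp add: x_def b_def)
      next
        case 3
        then have "mat_trace (x i * (U * U)) = 0" using trace_UU[OF i] Ydd[of "i - 2"] i by (simp add: x_def)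
        then show ?thesis using 3 by simp
      qed
    qed
    then have "V $$ (k, l) = (\<Sum>i<m. if i = 1 then \<delta> * (\<gamma>\<^sup>2 * 2) / mat_trace (b * b) else 0)"
      unfolding V_def proj_entry[OF kl(1,2)] by (intro sum.cong) auto
    also have "\<dots> = \<delta> * (\<gamma>\<^sup>2 * 2) / mat_trace (b * b)" using m by simp
    finally show ?thesis using \<delta> \<gamma> trace_bb by simp
  qed
  moreover have "diagonal_mat U" unfolding U by (simp add: diagonal_mat_def diag_of_def)
  moreover have "inj_on (\<lambda>i. U $$ (i, i)) {..<n}"
    unfolding U using \<gamma> by (auto simp: inj_on_def diag_of_def f_def)
  ultimately show ?thesis using x_car \<delta>
    by (intro exI[of _ x]) (simp add: separating_frame_def U_def[symmetric] V_def[symmetric] \<delta>_def)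
qed

text \<open>
  The rational family maps to every field of characteristic zero.
\<close>

lemma ex_specialization:
  assumes "2 \<le> m" "m \<le> n\<^sup>2 - 2" "3 \<le> n"
  shows "\<exists>x :: nat \<Rightarrow> 'k::field_char_0 mat. separating_frame n m x"
proof -
  let ?q = "of_rat :: rat \<Rightarrow> 'k"
  have q: "comm_ring_hom ?q" by unfold_locales (simp_all add: of_rat_add of_rat_mult)
  interpret q: comm_ring_hom ?q by (rule q)
  obtain x :: "nat \<Rightarrow> rat mat" where frame: "separating_frame n m x"
    using ex_rational_specialization[OF assms] by (elim exE)
  then have x: "\<And>i. i < m \<Longrightarrow> x i \<in> carrier_mat n n" and det: "det (gram m x) \<noteq> 0"
    by (simp_all add: separating_frame_def)
  define U where "U = gram_proj n m x (1\<^sub>m n)"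
  define V where "V = gram_proj n m x (U * U)"
  have car [simp]: "U \<in> carrier_mat n n" "V \<in> carrier_mat n n" by (simp_all add: U_def V_def)
  have UU: "U * U \<in> carrier_mat n n" by (intro mult_carrier_mat[of _ n n]) auto
  let ?x = "\<lambda>i. map_mat ?q (x i)"
  have map_one: "map_mat ?q (1\<^sub>m n) = 1\<^sub>m n" by (intro eq_matI) auto
  have U: "gram_proj n m ?x (1\<^sub>m n) = map_mat ?q U"
    using gram_proj_hom[OF q x one_carrier_mat] map_one by (simp add: U_def)
  have V: "gram_proj n m ?x (map_mat ?q U * map_mat ?q U) = map_mat ?q V"
    using gram_proj_hom[OF q x UU] mat_mult_hom[OF q car(1) car(1)] by (simp add: V_def)
  have UV': "diagonal_mat U" "inj_on (\<lambda>i. U $$ (i, i)) {..<n}"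
    "\<And>i j. i < n \<Longrightarrow> j < n \<Longrightarrow> i \<noteq> j \<Longrightarrow> V $$ (i, j) \<noteq> 0"
    using frame unfolding separating_frame_def U_def[symmetric] V_def[symmetric] by simp_all
  have "diagonal_mat (map_mat ?q U)" using UV'(1) carrier_matD[OF car(1)] by (simp add: diagonal_mat_def)
  moreover have "inj_on (\<lambda>i. map_mat ?q U $$ (i, i)) {..<n}"
    using UV'(2) carrier_matD[OF car(1)] by (auto simp: inj_on_def)
  moreover have "map_mat ?q V $$ (i, j) \<noteq> 0" if "i < n" "j < n" "i \<noteq> j" for i j
    using UV'(3)[OF that] carrier_matD[OF car(2)] that by simp
  moreover have "det (gram m ?x) \<noteq> 0"
    using det by (simp add: gram_hom[OF q x])
  ultimately show ?thesis using x by (intro exI[of _ ?x]) (simp add: separating_frame_def U V)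
qed

section \<open>The universal division algebra\<close>

lemma generic_mat_carrier [simp]: "generic_mat n h \<in> carrier_mat n n"
  by (simp add: generic_mat_def)

lemma generic_mat_algebra_carrier: "B \<in> generic_mat_algebra m n \<Longrightarrow> B \<in> carrier_mat n n"
  by (induction rule: generic_mat_algebra.induct) auto

lemma gconst_eq_0_iff [simp]: "gconst c = 0 \<longleftrightarrow> c = 0"
  by (metis gconst_def lookup_single_eq lookup_zero single_zero)

lemma map_mat_gconst_scalar: "map_mat to_fract (gconst c \<cdot>\<^sub>m 1\<^sub>m n) = (to_fract (gconst c) \<cdot>\<^sub>m 1\<^sub>m n :: 'k::field gpoly fract mat)"
  by (intro eq_matI) auto

lemma one_in_generic: "1\<^sub>m n \<in> (generic_mat_algebra m n :: 'k::field gpoly mat set)"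
proof -
  have "gconst 1 \<cdot>\<^sub>m 1\<^sub>m n = (1\<^sub>m n :: 'k gpoly mat)" by (intro eq_matI) auto
  then show ?thesis using generic_mat_algebra.scalar[of "1 :: 'k" n m] by simp
qed

lemma uminus_in_generic:
  assumes "A \<in> (generic_mat_algebra m n :: 'k::field gpoly mat set)"
  shows "- A \<in> generic_mat_algebra m n"
proof -
  have A: "A \<in> carrier_mat n n" using assms by (rule generic_mat_algebra_carrier)
  have "gconst (-1) + 1 = gconst (-1 + 1 :: 'k)" by (simp only: gconst_simps(2,3))
  then have "gconst (-1) + 1 = (0 :: 'k gpoly)" by simp
  then have neg: "gconst (-1) = (-1 :: 'k gpoly)" by (simp add: eq_neg_iff_add_eq_0)
  have "(gconst (-1) \<cdot>\<^sub>m 1\<^sub>m n) * A = gconst (-1) \<cdot>\<^sub>m (1\<^sub>m n * A)"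
    by (rule mult_smult_assoc_mat[OF one_carrier_mat A])
  also have "\<dots> = - A" unfolding left_mult_one_mat[OF A] neg by (intro eq_matI) auto
  finally show ?thesis using generic_mat_algebra.mult[OF generic_mat_algebra.scalar assms, of "-1"] by simp
qed

lemma pow_in_generic: "A \<in> generic_mat_algebra m n \<Longrightarrow> A ^\<^sub>m i \<in> generic_mat_algebra m n"
proof (induction i)
  case 0
  then show ?case using generic_mat_algebra_carrier[OF 0] one_in_generic by auto
qed (simp add: generic_mat_algebra.mult)

lemma to_fract_hom: "comm_ring_hom (to_fract :: 'a::idom \<Rightarrow> 'a fract)"
  by unfold_locales auto

lemma id_hom: "comm_ring_hom (\<lambda>x :: 'a::comm_ring_1. x)"
  by unfold_locales auto

text \<open>
  The specialization of the \<open>h\<close>-th generic matrix to \<open>x h\<close>.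
\<close>

definition evaluate :: "(nat \<Rightarrow> 'k::field mat) \<Rightarrow> 'k gpoly \<Rightarrow> 'k" where
  "evaluate x = gpoly_eval (\<lambda>c. c) (\<lambda>(h, i, j). x h $$ (i, j))"

lemma evaluate_hom: "comm_ring_hom (evaluate x)"
  unfolding evaluate_def by (rule gpoly_eval_hom[OF id_hom])

lemma evaluate_gconst [simp]: "evaluate x (gconst c) = c"
  unfolding evaluate_def by (rule gpoly_eval_gconst[OF id_hom])

lemma evaluate_generic_mat: "x h \<in> carrier_mat n n \<Longrightarrow> map_mat (evaluate x) (generic_mat n h) = x h"
  by (intro eq_matI) (auto simp: generic_mat_def evaluate_def gpoly_eval_gvar[OF id_hom])

lemma sandwich_generic_independent:
  fixes P Q :: "'k::field gpoly mat"
  assumes P: "P \<in> carrier_mat n n" and Q: "Q \<in> carrier_mat n n"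
    and spec: "diagonal_mat (map_mat (evaluate x) P)" "inj_on (\<lambda>i. map_mat (evaluate x) P $$ (i, i)) {..<n}"
      "\<And>i j. i < n \<Longrightarrow> j < n \<Longrightarrow> map_mat (evaluate x) Q $$ (i, j) \<noteq> 0"
    and zero: "mat_sum n (\<lambda>r. c r \<cdot>\<^sub>m map_mat to_fract (sandwich n P Q r)) {..<n * n} = 0\<^sub>m n n"
    and r: "r < n * n"
  shows "c r = 0"
proof (rule independent_if_specialization_independent[OF evaluate_hom _ _ zero r])
  show "sandwich n P Q r \<in> carrier_mat n n" for r using P Q by simp
  fix d r assume d: "mat_sum n (\<lambda>r. d r \<cdot>\<^sub>m map_mat (evaluate x) (sandwich n P Q r)) {..<n * n} = 0\<^sub>m n n" "r < n * n"
  show "d r = 0"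
  proof (rule sandwich_independent[OF _ spec(1,2) _ spec(3) _ d(2)])
    show "mat_sum n (\<lambda>r. d r \<cdot>\<^sub>m sandwich n (map_mat (evaluate x) P) (map_mat (evaluate x) Q) r) {..<n * n} = 0\<^sub>m n n"
      using d(1) by (simp add: map_mat_sandwich[OF evaluate_hom P Q])
  qed (use P Q in auto)
qed

definition generic_basis :: "nat \<Rightarrow> nat \<Rightarrow> 'k::field gpoly fract mat" where
  "generic_basis n r = map_mat to_fract (sandwich n (generic_mat n 0) (generic_mat n 1) r)"

text \<open>
  A basis is obtained from \<open>X\<^sub>0\<close> and \<open>X\<^sub>1\<close> alone, by specializing them to a diagonal matrix with distinct
  entries and to the matrix of ones.
\<close>

theorem generic_full_subring:
  assumes m: "2 \<le> m" and n: "0 < n"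
  shows "full_subring n (map_mat to_fract ` (generic_mat_algebra m n :: 'k::field_char_0 gpoly mat set)) (generic_basis n)"
proof
  let ?G = "generic_mat_algebra m n :: 'k gpoly mat set"
  interpret tf: comm_ring_hom "to_fract :: 'k gpoly \<Rightarrow> 'k gpoly fract" by (rule to_fract_hom)
  have car: "A \<in> carrier_mat n n" if "A \<in> ?G" for A using that by (rule generic_mat_algebra_carrier)
  show "0 < n" by (rule n)
  show "map_mat to_fract ` ?G \<subseteq> carrier_mat n n" using car by auto
  have "map_mat to_fract (1\<^sub>m n) = (1\<^sub>m n :: 'k gpoly fract mat)" by (intro eq_matI) auto
  then show "1\<^sub>m n \<in> map_mat to_fract ` ?G" using one_in_generic[of n m] by (metis image_eqI)
  fix a assume "a \<in> map_mat to_fract ` ?G"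
  then obtain A where A: "A \<in> ?G" "a = map_mat to_fract A" by blast
  have "- a = map_mat to_fract (- A)" unfolding A(2) using car[OF A(1)] by (intro eq_matI) auto
  then show "- a \<in> map_mat to_fract ` ?G" using uminus_in_generic[OF A(1)] by blast
  {
    fix b assume "b \<in> map_mat to_fract ` ?G"
    then obtain B where B: "B \<in> ?G" "b = map_mat to_fract B" by blast
    have "a + b = map_mat to_fract (A + B)"
      unfolding A(2) B(2) using car[OF A(1)] car[OF B(1)] by (intro eq_matI) auto
    then show "a + b \<in> map_mat to_fract ` ?G" using generic_mat_algebra.add[OF A(1) B(1)] by blast
    have "a * b = map_mat to_fract (A * B)"
      unfolding A(2) B(2) using mat_mult_hom[OF to_fract_hom car[OF A(1)] car[OF B(1)]] by simp
    then show "a * b \<in> map_mat to_fract ` ?G" using generic_mat_algebra.mult[OF A(1) B(1)] by blast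
  }
  assume nz: "a \<noteq> 0\<^sub>m n n"
  have "A \<noteq> 0\<^sub>m n n"
  proof
    assume "A = 0\<^sub>m n n"
    then have "a = 0\<^sub>m n n" unfolding A(2) by (intro eq_matI) auto
    then show False using nz by simp
  qed
  then have "det A \<noteq> 0" using generic_det_nonzero A(1) n by blast
  then have det: "det a \<noteq> 0" unfolding A(2) by simp
  have a: "a \<in> carrier_mat n n" using car[OF A(1)] A(2) by simp
  let ?b = "inverse (det a) \<cdot>\<^sub>m adj_mat a"
  have "a * ?b = inverse (det a) \<cdot>\<^sub>m (det a \<cdot>\<^sub>m 1\<^sub>m n)"
    using mult_smult_distrib[OF a adj_mat(1)[OF a]] adj_mat(2)[OF a] by simp
  moreover have "?b * a = inverse (det a) \<cdot>\<^sub>m (det a \<cdot>\<^sub>m 1\<^sub>m n)"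
    using mult_smult_assoc_mat[OF adj_mat(1)[OF a] a] adj_mat(3)[OF a] by simp
  moreover have "inverse (det a) \<cdot>\<^sub>m (det a \<cdot>\<^sub>m 1\<^sub>m n) = 1\<^sub>m n" using det by (intro eq_matI) auto
  moreover have "?b \<in> carrier_mat n n" using adj_mat(1)[OF a] by simp
  ultimately show "\<exists>b\<in>carrier_mat n n. a * b = 1\<^sub>m n \<and> b * a = 1\<^sub>m n" by metis
next
  fix r
  have gen: "generic_mat n h \<in> (generic_mat_algebra m n :: 'k gpoly mat set)" if "h < 2" for h
    using that m by (intro generic_mat_algebra.generic) simp
  show "generic_basis n r \<in> map_mat to_fract ` (generic_mat_algebra m n :: 'k gpoly mat set)"
    unfolding generic_basis_def sandwich_def
    by (intro imageI generic_mat_algebra.mult pow_in_generic gen) auto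
next
  fix c :: "nat \<Rightarrow> 'k gpoly fract" and r
  assume zero: "mat_sum n (\<lambda>i. c i \<cdot>\<^sub>m generic_basis n i) {..<n * n} = 0\<^sub>m n n" and r: "r < n * n"
  let ?x = "\<lambda>h. mat n n (\<lambda>(i, j). if h = 0 then if i = j then of_nat i else 0 else 1) :: 'k mat"
  have gen: "map_mat (evaluate ?x) (generic_mat n h) = ?x h" for h
    by (rule evaluate_generic_mat) simp
  show "c r = 0"
    using zero r unfolding generic_basis_def
    by (intro sandwich_generic_independent[of "generic_mat n 0" n "generic_mat n 1" ?x c r])
      (auto simp: gen diagonal_mat_def inj_on_def)
qed

lemma carrier_UD:
  assumes m: "2 \<le> m" and n: "0 < n"
  shows "carrier (UD TYPE('k::field_char_0) m n) =
    full_subring.quotients n (map_mat to_fract ` (generic_mat_algebra m n :: 'k gpoly mat set))"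
proof -
  let ?G = "generic_mat_algebra m n :: 'k gpoly mat set"
  let ?M = "frac_mat_ring TYPE('k) n"
  interpret G: full_subring n "map_mat to_fract ` ?G" "generic_basis n" by (rule generic_full_subring[OF assms])
  interpret M: ring ?M by (rule ring_mat)
  have nonzero: "map_mat to_fract B = (0\<^sub>m n n :: 'k gpoly fract mat) \<longleftrightarrow> B = 0\<^sub>m n n" if "B \<in> ?G" for B
  proof
    assume *: "map_mat to_fract B = (0\<^sub>m n n :: 'k gpoly fract mat)"
    have B: "B \<in> carrier_mat n n" using that by (rule generic_mat_algebra_carrier)
    have "B $$ (i, j) = 0" if "i < n" "j < n" for i j
    proof -
      have "to_fract (B $$ (i, j)) = map_mat to_fract B $$ (i, j)" using B that by simp
      also have "\<dots> = 0" unfolding * using that by simp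
      finally show ?thesis by simp
    qed
    then show "B = 0\<^sub>m n n" using B by (intro eq_matI) auto
  qed (auto intro: eq_matI)
  have inv: "inv\<^bsub>?M\<^esub> t = s" if "t \<in> carrier_mat n n" "s \<in> carrier_mat n n" "t * s = 1\<^sub>m n" "s * t = 1\<^sub>m n" for s t
    using M.inv_unique'[of t s] that by (simp add: ring_mat_simps)
  show ?thesis
  proof (intro equalityI subsetI)
    fix x assume "x \<in> carrier (UD TYPE('k) m n)"
    then obtain A B where AB: "A \<in> ?G" "B \<in> ?G" "B \<noteq> 0\<^sub>m n n"
      and x: "x = map_mat to_fract A * inv\<^bsub>?M\<^esub> (map_mat to_fract B)"
      by (auto simp: UD_def ring_mat_simps)
    let ?a = "map_mat to_fract A :: 'k gpoly fract mat" and ?t = "map_mat to_fract B :: 'k gpoly fract mat"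
    have t: "?t \<in> map_mat to_fract ` ?G" "?t \<noteq> 0\<^sub>m n n" using AB nonzero by auto
    have a: "?a \<in> map_mat to_fract ` ?G" using AB by auto
    obtain s where s: "s \<in> carrier_mat n n" "?t * s = 1\<^sub>m n" "s * ?t = 1\<^sub>m n"
      using G.ex_inverse[OF t] by blast
    have x': "x = ?a * s" unfolding x using inv[OF G.mem_carrier[OF t(1)] s] by simp
    have "x * ?t = ?a * (s * ?t)"
      unfolding x' by (rule assoc_mult_mat[OF G.mem_carrier[OF a] s(1) G.mem_carrier[OF t(1)]])
    also have "\<dots> = ?a" unfolding s(3) by (rule right_mult_one_mat[OF G.mem_carrier[OF a]])
    finally have "x * ?t \<in> map_mat to_fract ` ?G" using a by simp
    moreover have "x \<in> carrier_mat n n" unfolding x' using G.mem_carrier[OF a] s(1) by (rule mult_carrier_mat)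
    ultimately show "x \<in> G.quotients" unfolding G.quotients_def using t by blast
  next
    fix x assume "x \<in> G.quotients"
    then obtain t where x: "x \<in> carrier_mat n n" and t: "t \<in> map_mat to_fract ` ?G" "t \<noteq> 0\<^sub>m n n"
      and a: "x * t \<in> map_mat to_fract ` ?G" unfolding G.quotients_def by blast
    obtain s where s: "s \<in> carrier_mat n n" "t * s = 1\<^sub>m n" "s * t = 1\<^sub>m n"
      using G.ex_inverse[OF t] by blast
    have "x = x * t * s"
      using assoc_mult_mat[OF x G.mem_carrier[OF t(1)] s(1)] x by (simp add: s(2))
    then have "x = x * t * inv\<^bsub>?M\<^esub> t" using inv[OF G.mem_carrier[OF t(1)] s] by simp
    moreover obtain A B where "A \<in> ?G" "x * t = map_mat to_fract A" "B \<in> ?G" "t = map_mat to_fract B"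
      using t a by blast
    ultimately show "x \<in> carrier (UD TYPE('k) m n)"
      using t(2) nonzero by (auto simp: UD_def ring_mat_simps)
  qed
qed

lemma generic_in_UD:
  assumes "2 \<le> m" "0 < n" "A \<in> (generic_mat_algebra m n :: 'k::field_char_0 gpoly mat set)"
  shows "map_mat to_fract A \<in> carrier (UD TYPE('k) m n)"
  unfolding carrier_UD[OF assms(1,2)]
  using full_subring.subset_quotients[OF generic_full_subring[OF assms(1,2)]] assms(3) by blast

lemma scalar_in_UD:
  assumes "2 \<le> m" "0 < n"
  shows "to_fract (gconst c) \<cdot>\<^sub>m 1\<^sub>m n \<in> carrier (UD TYPE('k::field_char_0) m n)"
  using generic_in_UD[OF assms generic_mat_algebra.scalar, of c] by (simp only: map_mat_gconst_scalar)

corollary UD_full_division: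
  assumes "2 \<le> m" "0 < n"
  shows "full_division n (carrier (UD TYPE('k::field_char_0) m n)) (generic_basis n)"
  unfolding carrier_UD[OF assms]
  by (rule full_subring.quotients_full_division[OF generic_full_subring[OF assms]])

section \<open>The ring of invariants\<close>

context full_division
begin

lemma det_in_ratios:
  assumes B: "B \<in> carrier_mat k k" and entries: "\<And>i j. i < k \<Longrightarrow> j < k \<Longrightarrow> B $$ (i, j) \<in> ratios"
  shows "det B \<in> ratios"
proof -
  have "signof p \<in> ratios" for p :: "nat \<Rightarrow> nat"
    using ratios_1 ratios_uminus[OF ratios_1] by (simp add: sign_def)
  moreover have "B $$ (i, p i) \<in> ratios" if "p permutes {0..<k}" "i \<in> {0..<k}" for p i
    using permutes_in_image[OF that(1), of i] that(2) by (auto intro: entries)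
  ultimately show ?thesis
    unfolding det_def'[OF B] by (intro ratios_sum ratios_mult ratios_prod) auto
qed

lemma adj_mat_in_ratios:
  assumes B: "B \<in> carrier_mat k k" and entries: "\<And>i j. i < k \<Longrightarrow> j < k \<Longrightarrow> B $$ (i, j) \<in> ratios"
    and ij: "i < k" "j < k"
  shows "adj_mat B $$ (i, j) \<in> ratios"
proof -
  have "det (mat_delete B j i) \<in> ratios"
  proof (rule det_in_ratios)
    show "mat_delete B j i \<in> carrier_mat (k - 1) (k - 1)" using B by (rule mat_delete_carrier)
    show "mat_delete B j i $$ (i', j') \<in> ratios" if "i' < k - 1" "j' < k - 1" for i' j'
      using B that by (auto simp: mat_delete_def intro!: entries)
  qed
  moreover have "(- 1) ^ l \<in> ratios" for l
    by (induction l) (auto intro: ratios_1 ratios_uminus)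
  ultimately show ?thesis
    using B ij by (auto simp: adj_mat_def cofactor_def intro!: ratios_mult)
qed

text \<open>
  The coefficients of the projection are rational expressions in traces, and traces are ratios by
  \<open>trace_in_ratios\<close>.
\<close>

theorem span_proj_mem:
  assumes X: "\<And>i. i < k \<Longrightarrow> X i \<in> A" and y: "y \<in> A" and char: "of_nat n \<noteq> (0 :: 'f)"
  shows "span_proj n k X y \<in> A"
proof -
  have trace: "mat_trace a \<in> ratios" if "a \<in> A" for a using trace_in_ratios that char by blast
  have gram: "gram k X $$ (i, j) \<in> ratios" if "i < k" "j < k" for i j
    using that by (auto simp: gram_def intro!: trace mult_mem X)
  have "gram_coeff k X y i \<in> ratios" if "i < k" for i
    unfolding gram_coeff_def using that gram
    by (intro ratios_sum ratios_mult adj_mat_in_ratios[OF gram_carrier] trace mult_mem X y) auto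
  then have "gram_proj n k X y \<in> A"
    unfolding gram_proj_def by (intro mat_sum_mem smult_mem X) auto
  moreover have "inverse (det (gram k X)) \<in> ratios"
    using gram by (intro ratios_inverse det_in_ratios[OF gram_carrier]) auto
  ultimately show ?thesis unfolding span_proj_def by (intro smult_mem)
qed

end

lemma gl_fract_hom:
  assumes "g \<in> GL_mats m"
  shows "comm_ring_hom (gl_fract m g)"
  using gl_fract_to_fract[OF assms, of 0] gl_fract_to_fract[OF assms, of 1]
  by unfold_locales (simp_all add: gl_fract_add[OF assms] gl_fract_mult[OF assms] gl_poly_def)

abbreviation generic_fract_mat :: "nat \<Rightarrow> nat \<Rightarrow> 'k::field gpoly fract mat" where
  "generic_fract_mat n h \<equiv> map_mat to_fract (generic_mat n h)"

lemma gl_act_generic_fract_mat: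
  assumes g: "g \<in> GL_mats m" and j: "j < m"
  shows "gl_act m g (generic_fract_mat n j) =
    mat_sum n (\<lambda>i. to_fract (gconst (g $$ (i, j))) \<cdot>\<^sub>m generic_fract_mat n i) {..<m}"
proof (rule eq_matI)
  interpret tf: comm_ring_hom "to_fract :: 'a gpoly \<Rightarrow> 'a gpoly fract" by (rule to_fract_hom)
  let ?S = "mat_sum n (\<lambda>i. to_fract (gconst (g $$ (i, j))) \<cdot>\<^sub>m generic_fract_mat n i) {..<m}"
  fix a b assume "a < dim_row ?S" "b < dim_col ?S"
  then have ab: "a < n" "b < n" by auto
  have "?S $$ (a, b) = (\<Sum>i<m. to_fract (gconst (g $$ (i, j))) * generic_fract_mat n i $$ (a, b))"
    using ab by (intro mat_sum_smult_index) auto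
  then show "gl_act m g (generic_fract_mat n j) $$ (a, b) = ?S $$ (a, b)"
    unfolding gl_act_generic_mat[OF assms] using ab by (simp add: generic_mat_def tf.hom_sum tf.hom_mult)
qed (simp_all add: gl_act_generic_mat[OF assms])

text \<open>
  A group element \<open>g\<close> acts by a field automorphism, which carries the projection onto the span of the
  \<open>X\<^sub>i\<close> to that onto the span of the \<open>g X\<^sub>i\<close>.  This is the same span.
\<close>

theorem gl_act_span_proj:
  fixes g :: "'k::field mat"
  assumes g: "g \<in> GL_mats m" and det: "det (gram m (generic_fract_mat n) :: 'k gpoly fract mat) \<noteq> 0"
    and y: "y \<in> carrier_mat n n" "gl_act m g y = y"
  shows "gl_act m g (span_proj n m (generic_fract_mat n) y) = span_proj n m (generic_fract_mat n) y"
proof -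
  let ?h = "gl_fract m g"
  have h: "comm_ring_hom ?h" by (rule gl_fract_hom[OF g])
  interpret h: comm_ring_hom ?h by (rule h)
  let ?X = "generic_fract_mat n :: nat \<Rightarrow> 'k gpoly fract mat"
  let ?Y = "\<lambda>j. map_mat ?h (?X j)"
  have X: "?X i \<in> carrier_mat n n" for i by simp
  have gramY: "det (gram m ?Y) = ?h (det (gram m ?X))"
    using gram_hom[OF h, of m ?X n] by simp
  have "?h (det (gram m ?X)) * ?h (inverse (det (gram m ?X))) = ?h (det (gram m ?X) * inverse (det (gram m ?X)))"
    by (simp only: h.hom_mult)
  also have "\<dots> = 1" using det by simp
  finally have unit: "?h (det (gram m ?X)) * ?h (inverse (det (gram m ?X))) = 1" .
  then have nz: "det (gram m ?Y) \<noteq> 0" unfolding gramY by auto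
  have inv: "?h (inverse (det (gram m ?X))) = inverse (det (gram m ?Y))"
    unfolding gramY using unit by (metis inverse_unique)
  have "gl_act m g (span_proj n m ?X y) = ?h (inverse (det (gram m ?X))) \<cdot>\<^sub>m map_mat ?h (gram_proj n m ?X y)"
    unfolding gl_act_def span_proj_def by (intro eq_matI) (auto simp: h.hom_mult)
  also have "map_mat ?h (gram_proj n m ?X y) = gram_proj n m ?Y y"
    using gram_proj_hom[OF h X y(1), of m] y(2) by (simp add: gl_act_def)
  finally have act: "gl_act m g (span_proj n m ?X y) = span_proj n m ?Y y"
    by (simp add: inv span_proj_def)
  have gc: "g \<in> carrier_mat m m" using g by (simp add: GL_mats_def)
  obtain \<eta> where \<eta>: "\<eta> \<in> carrier_mat m m" "g * \<eta> = 1\<^sub>m m"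
  proof -
    from g obtain \<eta> where \<eta>: "g * \<eta> = 1\<^sub>m m" "\<eta> * g = 1\<^sub>m (dim_row \<eta>)"
      by (auto simp: GL_mats_def invertible_mat_def inverts_mat_def)
    have "dim_col (g * \<eta>) = m" "dim_col (\<eta> * g) = dim_row \<eta>" by (simp_all add: \<eta>)
    with gc have "\<eta> \<in> carrier_mat m m" by auto
    with \<eta>(1) show ?thesis by (rule that[rotated])
  qed
  have "span_proj n m ?Y y = span_proj n m ?X y"
  proof (rule span_proj_change_basis)
    show "?Y j = mat_sum n (\<lambda>i. to_fract (gconst (g $$ (i, j))) \<cdot>\<^sub>m ?X i) {..<m}" if "j < m" for j
      using gl_act_generic_fract_mat[OF g that] by (simp add: gl_act_def)
    show "(\<Sum>l<m. to_fract (gconst (g $$ (i, l))) * to_fract (gconst (\<eta> $$ (l, k)))) = (if i = k then 1 else 0 :: 'k gpoly fract)"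
      if "i < m" "k < m" for i k
    proof -
      interpret tf: comm_ring_hom "to_fract :: 'k gpoly \<Rightarrow> 'k gpoly fract" by (rule to_fract_hom)
      have "(\<Sum>l<m. g $$ (i, l) * \<eta> $$ (l, k)) = (g * \<eta>) $$ (i, k)"
        using gc \<eta>(1) that by (simp add: scalar_prod_def atLeast0LessThan)
      also have "\<dots> = (if i = k then 1 else 0)" unfolding \<eta>(2) using that by simp
      finally have "to_fract (gconst (\<Sum>l<m. g $$ (i, l) * \<eta> $$ (l, k))) = (to_fract (gconst (if i = k then 1 else 0)) :: 'k gpoly fract)"
        by simp
      then show ?thesis by (simp add: gconst_sum tf.hom_sum tf.hom_mult split: if_splits)
    qed
  qed (use det nz y X in auto)
  then show ?thesis using act by simp
qed

lemma of_nat_fract_nonzero: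
  assumes "0 < k"
  shows "of_nat k \<noteq> (0 :: 'k::field_char_0 gpoly fract)"
proof -
  have "of_nat k = (to_fract (gconst (of_nat k)) :: 'k gpoly fract)"
  proof (induction k)
    case (Suc k)
    have "to_fract (gconst (of_nat (Suc k))) = (to_fract (1 + gconst (of_nat k)) :: 'k gpoly fract)" by simp
    also have "\<dots> = 1 + to_fract (gconst (of_nat k))" by (simp only: to_fract_add to_fract_1)
    finally show ?case using Suc by simp
  qed simp
  then show ?thesis using assms by simp
qed

lemma gram_proj_cong:
  assumes "\<And>i. i < m \<Longrightarrow> X i = Y i"
  shows "gram m X = gram m Y" "gram_proj n m X y = gram_proj n m Y y"
proof -
  show gram: "gram m X = gram m Y" using assms by (intro eq_matI) (auto simp: gram_def)
  show "gram_proj n m X y = gram_proj n m Y y"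
    unfolding gram_proj_def gram_coeff_def gram using assms by (intro mat_sum_cong) auto
qed

text \<open>
  The generators are \<open>u = p(1)\<close> and \<open>w = p(u\<^sup>2) + c\<close>.  The constant \<open>c\<close> is only there to make the
  diagonal entries of the specialization of \<open>w\<close> nonzero.  In the proof \<open>U\<close>, \<open>V\<close> and \<open>W\<close> are the
  polynomial matrices obtained from \<open>u\<close>, \<open>p(u\<^sup>2)\<close> and \<open>w\<close> by multiplication with \<open>d\<close>, \<open>d\<^sup>3\<close> and \<open>d\<^sup>3\<close>,
  where \<open>d\<close> is the determinant of the Gram matrix.
\<close>

lemma ex_invariant_generators:
  assumes m: "2 \<le> m" "m \<le> n\<^sup>2 - 2" and n: "3 \<le> n"
  shows "\<exists>u w :: 'k::field_char_0 gpoly fract mat.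
    u \<in> carrier (UD_fixed TYPE('k) m n) \<and> w \<in> carrier (UD_fixed TYPE('k) m n) \<and>
    (\<forall>c. mat_sum n (\<lambda>r. c r \<cdot>\<^sub>m sandwich n u w r) {..<n * n} = 0\<^sub>m n n \<longrightarrow> (\<forall>r<n * n. c r = 0))"
proof -
  have n0: "0 < n" using n by simp
  let ?UD = "carrier (UD TYPE('k) m n)"
  interpret UD: full_division n ?UD "generic_basis n" by (rule UD_full_division[OF m(1) n0])
  obtain x :: "nat \<Rightarrow> 'k mat" where frame: "separating_frame n m x"
    using ex_specialization[OF m n] by (elim exE)
  let ?ev = "evaluate x"
  let ?g = "generic_mat n :: nat \<Rightarrow> 'k gpoly mat"
  let ?X = "generic_fract_mat n :: nat \<Rightarrow> 'k gpoly fract mat"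
  let ?tf = "to_fract :: 'k gpoly \<Rightarrow> 'k gpoly fract"
  interpret tf: comm_ring_hom ?tf by (rule to_fract_hom)
  interpret ev: comm_ring_hom ?ev by (rule evaluate_hom)
  have x: "x i \<in> carrier_mat n n" if "i < m" for i using frame that by (simp add: separating_frame_def)
  have g: "?g i \<in> carrier_mat n n" for i by simp
  have ev_g: "map_mat ?ev (?g i) = x i" if "i < m" for i using evaluate_generic_mat[of x i n] x[OF that] by simp
  have ev_proj: "map_mat ?ev (gram_proj n m ?g y) = gram_proj n m x (map_mat ?ev y)" if "y \<in> carrier_mat n n" for y
    using gram_proj_hom[OF evaluate_hom g that, of x m] gram_proj_cong(2)[of m "\<lambda>i. map_mat ?ev (?g i)" x] ev_g by simp
  define d where "d = det (gram m ?g)"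
  have ev_d: "?ev d = det (gram m x)"
    using gram_hom[OF evaluate_hom, of m ?g n x] gram_proj_cong(1)[of m "\<lambda>i. map_mat ?ev (?g i)" x] ev_g
    by (simp add: d_def flip: ev.hom_det)
  have ev_d_nz: "?ev d \<noteq> 0" using frame by (simp add: ev_d separating_frame_def)
  then have d: "d \<noteq> 0" by auto
  define \<delta> where "\<delta> = ?tf d"
  have det_X: "det (gram m ?X) = \<delta>"
    using gram_hom[OF to_fract_hom, of m ?g n] by (simp add: \<delta>_def d_def)
  have \<delta>: "\<delta> \<noteq> 0" using d by (simp add: \<delta>_def)
  have tf_proj: "map_mat ?tf (gram_proj n m ?g y) = gram_proj n m ?X (map_mat ?tf y)" if "y \<in> carrier_mat n n" for y
    using gram_proj_hom[OF to_fract_hom g that] .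
  define U where "U = gram_proj n m ?g (1\<^sub>m n)"
  define V where "V = gram_proj n m ?g (U * U)"
  have U: "U \<in> carrier_mat n n" and V: "V \<in> carrier_mat n n" by (simp_all add: U_def V_def)
  have UU: "U * U \<in> carrier_mat n n" using U U by (rule mult_carrier_mat)
  have map_one: "map_mat ?ev (1\<^sub>m n) = 1\<^sub>m n" "map_mat ?tf (1\<^sub>m n) = 1\<^sub>m n" by (auto intro!: eq_matI)
  have ev_U: "map_mat ?ev U = gram_proj n m x (1\<^sub>m n)" unfolding U_def by (simp add: ev_proj map_one)
  have ev_V: "map_mat ?ev V = gram_proj n m x (gram_proj n m x (1\<^sub>m n) * gram_proj n m x (1\<^sub>m n))"
    unfolding V_def ev_proj[OF UU] mat_mult_hom[OF evaluate_hom U U] ev_U ..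
  \<comment> \<open>The excluded values are those that produce a zero on the diagonal of the specialization of \<open>W\<close>.\<close>
  define c where "c = (SOME c. c \<notin> (\<lambda>i. - (map_mat ?ev V $$ (i, i)) / ?ev d ^ 3) ` {..<n})"
  have "\<exists>c. c \<notin> (\<lambda>i. - (map_mat ?ev V $$ (i, i)) / ?ev d ^ 3) ` {..<n}"
    by (intro ex_new_if_finite infinite_UNIV_char_0 finite_imageI) auto
  then have c: "c \<notin> (\<lambda>i. - (map_mat ?ev V $$ (i, i)) / ?ev d ^ 3) ` {..<n}"
    unfolding c_def by (rule someI_ex)
  define W where "W = V + (gconst c * d ^ 3) \<cdot>\<^sub>m 1\<^sub>m n"
  have W: "W \<in> carrier_mat n n" using V by (simp add: W_def)
  define u where "u = span_proj n m ?X (1\<^sub>m n)"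
  define w where "w = span_proj n m ?X (u * u) + ?tf (gconst c) \<cdot>\<^sub>m 1\<^sub>m n"
  have u: "u \<in> carrier_mat n n" by (simp add: u_def)
  have uu: "u * u \<in> carrier_mat n n" using u u by (rule mult_carrier_mat)
  have u_eq: "u = inverse \<delta> \<cdot>\<^sub>m map_mat ?tf U"
    unfolding u_def span_proj_def det_X U_def by (simp add: tf_proj map_one)
  have mU: "map_mat ?tf U \<in> carrier_mat n n" using U by simp
  have "u * u = inverse \<delta> \<cdot>\<^sub>m (inverse \<delta> \<cdot>\<^sub>m (map_mat ?tf U * map_mat ?tf U))"
    unfolding u_eq using mult_smult_assoc_mat[OF mU smult_carrier_mat[OF mU]] mult_smult_distrib[OF mU mU] by simp
  also have "\<dots> = (inverse \<delta> ^ 2) \<cdot>\<^sub>m map_mat ?tf (U * U)"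
    unfolding mat_mult_hom[OF to_fract_hom U U] by (intro eq_matI) (auto simp: power2_eq_square)
  finally have uu_eq: "u * u = (inverse \<delta> ^ 2) \<cdot>\<^sub>m map_mat ?tf (U * U)" .
  have "span_proj n m ?X (u * u) = inverse \<delta> \<cdot>\<^sub>m ((inverse \<delta> ^ 2) \<cdot>\<^sub>m gram_proj n m ?X (map_mat ?tf (U * U)))"
    unfolding span_proj_def det_X uu_eq using UU by (subst gram_proj_smult) auto
  also have "gram_proj n m ?X (map_mat ?tf (U * U)) = map_mat ?tf V"
    unfolding V_def by (rule tf_proj[OF UU, symmetric])
  finally have v_eq: "span_proj n m ?X (u * u) = inverse \<delta> \<cdot>\<^sub>m ((inverse \<delta> ^ 2) \<cdot>\<^sub>m map_mat ?tf V)" .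
  have w_eq: "w = inverse \<delta> ^ 3 \<cdot>\<^sub>m map_mat ?tf W"
  proof (rule eq_matI)
    fix i j assume "i < dim_row (inverse \<delta> ^ 3 \<cdot>\<^sub>m map_mat ?tf W)" "j < dim_col (inverse \<delta> ^ 3 \<cdot>\<^sub>m map_mat ?tf W)"
    then have ij: "i < n" "j < n" using W by auto
    have "w $$ (i, j) = inverse \<delta> ^ 3 * ?tf (V $$ (i, j)) + (if i = j then ?tf (gconst c) else 0)"
      unfolding w_def v_eq using ij V by (auto simp: power3_eq_cube power2_eq_square)
    moreover have "(inverse \<delta> ^ 3 \<cdot>\<^sub>m map_mat ?tf W) $$ (i, j) =
        inverse \<delta> ^ 3 * (?tf (V $$ (i, j)) + (if i = j then ?tf (gconst c) * \<delta> ^ 3 else 0))"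
      using ij V by (auto simp: W_def \<delta>_def tf.hom_add tf.hom_mult tf.hom_power)
    moreover have "inverse \<delta> ^ 3 * (?tf (gconst c) * \<delta> ^ 3) = ?tf (gconst c)"
      using \<delta> by (simp add: field_simps)
    ultimately show "w $$ (i, j) = (inverse \<delta> ^ 3 \<cdot>\<^sub>m map_mat ?tf W) $$ (i, j)"
      by (cases "i = j") (simp_all only: distrib_left if_True if_False mult_zero_right simp_thms)
  qed (use W V in \<open>auto simp: w_def\<close>)
  have X_mem: "?X i \<in> ?UD" if "i < m" for i
    using that by (intro generic_in_UD[OF m(1) n0] generic_mat_algebra.generic)
  have char: "of_nat n \<noteq> (0 :: 'k gpoly fract)" using n0 by (rule of_nat_fract_nonzero)
  have u_mem: "u \<in> ?UD" unfolding u_def using X_mem UD.one_mem char by (intro UD.span_proj_mem) auto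
  have w_mem: "w \<in> ?UD" unfolding w_def using X_mem char u_mem scalar_in_UD[OF m(1) n0]
    by (intro UD.add_mem UD.span_proj_mem UD.mult_mem) auto
  have det_X_nz: "det (gram m ?X) \<noteq> 0" using \<delta> det_X by simp
  have fixed: "gl_act m h u = u" "gl_act m h w = w" if h: "h \<in> GL_mats m" for h :: "'k mat"
  proof -
    interpret h: comm_ring_hom "gl_fract m h" by (rule gl_fract_hom[OF h])
    have "gl_act m h (1\<^sub>m n) = 1\<^sub>m n" unfolding gl_act_def by (intro eq_matI) auto
    then show fix_u: "gl_act m h u = u" unfolding u_def using gl_act_span_proj[OF h det_X_nz] by simp
    have "gl_act m h (u * u) = u * u" unfolding gl_act_mult[OF h u u] fix_u ..
    then have v: "gl_act m h (span_proj n m ?X (u * u)) = span_proj n m ?X (u * u)"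
      by (rule gl_act_span_proj[OF h det_X_nz uu])
    have "gl_act m h (?tf (gconst c) \<cdot>\<^sub>m 1\<^sub>m n) = ?tf (gconst c) \<cdot>\<^sub>m 1\<^sub>m n"
      by (rule gl_act_scalar[OF h]) (auto simp: base_scalars_def)
    then show "gl_act m h w = w" unfolding w_def using v
      by (subst gl_act_add[OF h, of _ n]) auto
  qed
  have indep: "k r = 0" if zero: "mat_sum n (\<lambda>r. k r \<cdot>\<^sub>m sandwich n u w r) {..<n * n} = 0\<^sub>m n n" and r: "r < n * n" for k r
  proof -
    let ?s = "\<lambda>r. inverse \<delta> ^ (r div n + r mod n) * inverse \<delta> ^ 3"
    have "sandwich n u w r = ?s r \<cdot>\<^sub>m map_mat ?tf (sandwich n U W r)" for r
      unfolding u_eq w_eq using U W by (simp add: sandwich_smult map_mat_sandwich[OF to_fract_hom U W])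
    then have "mat_sum n (\<lambda>r. (k r * ?s r) \<cdot>\<^sub>m map_mat ?tf (sandwich n U W r)) {..<n * n} = 0\<^sub>m n n"
      using zero by (simp add: smult_smult_mat)
    then have "k r * ?s r = 0"
    proof (rule sandwich_generic_independent[OF U W _ _ _ _ r, rotated 3])
      show "diagonal_mat (map_mat ?ev U)" "inj_on (\<lambda>i. map_mat ?ev U $$ (i, i)) {..<n}"
        unfolding ev_U using frame by (simp_all add: separating_frame_def)
      show "map_mat ?ev W $$ (i, j) \<noteq> 0" if ij: "i < n" "j < n" for i j
      proof -
        have entry: "map_mat ?ev W $$ (i, j) = map_mat ?ev V $$ (i, j) + (if i = j then c * ?ev d ^ 3 else 0)"
          using ij V by (simp add: W_def ev.hom_add ev.hom_mult ev.hom_power)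
        show ?thesis
        proof (cases "i = j")
          case True
          have "c \<noteq> - (map_mat ?ev V $$ (i, i)) / ?ev d ^ 3" using c ij by blast
          then have "c * ?ev d ^ 3 \<noteq> - (map_mat ?ev V $$ (i, i))"
            using ev_d_nz by (metis nonzero_mult_div_cancel_right power_not_zero)
          then have "map_mat ?ev V $$ (i, i) + c * ?ev d ^ 3 \<noteq> 0"
            by (metis add.commute eq_neg_iff_add_eq_0)
          then show ?thesis unfolding entry using True by simp
        next
          case False
          then show ?thesis unfolding entry ev_V using frame ij by (simp add: separating_frame_def)
        qed
      qed
    qed
    then show ?thesis using \<delta> by simp
  qed
  have "u \<in> carrier (UD_fixed TYPE('k) m n)" "w \<in> carrier (UD_fixed TYPE('k) m n)"
    using u_mem w_mem fixed by (simp_all add: UD_fixed_def)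
  then show ?thesis using indep by blast
qed

text \<open>
  The group acts by ring automorphisms, and the inverse of an invariant is invariant because inverses
  are unique.
\<close>

lemma UD_fixed_full_division:
  fixes u w :: "'k::field_char_0 gpoly fract mat"
  assumes m: "2 \<le> m" and n: "0 < n"
    and uw: "u \<in> carrier (UD_fixed TYPE('k) m n)" "w \<in> carrier (UD_fixed TYPE('k) m n)"
    and indep: "\<And>c r. mat_sum n (\<lambda>r. c r \<cdot>\<^sub>m sandwich n u w r) {..<n * n} = 0\<^sub>m n n \<Longrightarrow> r < n * n \<Longrightarrow> c r = 0"
  shows "full_division n (carrier (UD_fixed TYPE('k) m n)) (sandwich n u w)"
proof -
  let ?UD = "carrier (UD TYPE('k) m n)"
  let ?R = "carrier (UD_fixed TYPE('k) m n)"
  interpret UD: full_division n ?UD "generic_basis n" by (rule UD_full_division[OF m n])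
  have R: "a \<in> ?R \<longleftrightarrow> a \<in> ?UD \<and> (\<forall>g\<in>GL_mats m. gl_act m (g :: 'k mat) a = a)" for a
    by (auto simp: UD_fixed_def)
  have car: "a \<in> carrier_mat n n" if "a \<in> ?R" for a using that R by blast
  have act_one: "gl_act m g (1\<^sub>m n) = 1\<^sub>m n" if "g \<in> GL_mats m" for g :: "'k mat"
  proof -
    interpret h: comm_ring_hom "gl_fract m g" by (rule gl_fract_hom[OF that])
    show ?thesis unfolding gl_act_def by (intro eq_matI) auto
  qed
  have act_car: "gl_act m g a \<in> carrier_mat n n" if "a \<in> carrier_mat n n" for g :: "'k mat" and a
    using that by (simp add: gl_act_def)
  have one: "1\<^sub>m n \<in> ?R" using R UD.one_mem act_one by blast
  have mult: "a * b \<in> ?R" if "a \<in> ?R" "b \<in> ?R" for a b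
    using that R UD.mult_mem by (auto simp: gl_act_mult[of _ m _ n] simp del: assoc_mult_mat)
  have inverse: "\<exists>b\<in>?R. a * b = 1\<^sub>m n \<and> b * a = 1\<^sub>m n" if a: "a \<in> ?R" "a \<noteq> 0\<^sub>m n n" for a
  proof -
    obtain b where b: "b \<in> ?UD" "a * b = 1\<^sub>m n" "b * a = 1\<^sub>m n" using UD.inverse_mem a R by blast
    have "gl_act m g b = b" if g: "g \<in> GL_mats m" for g :: "'k mat"
    proof -
      have bc: "b \<in> carrier_mat n n" and ac: "a \<in> carrier_mat n n" using b(1) car[OF a(1)] by auto
      have "gl_act m g a * gl_act m g b = 1\<^sub>m n"
        using gl_act_mult[OF g ac bc] act_one[OF g] by (simp only: b(2))
      then have ab: "a * gl_act m g b = 1\<^sub>m n" using a R g by auto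
      have "gl_act m g b = (b * a) * gl_act m g b" unfolding b(3) using act_car[OF bc] by simp
      also have "\<dots> = b * (a * gl_act m g b)" by (rule assoc_mult_mat[OF bc ac act_car[OF bc]])
      also have "\<dots> = b" unfolding ab using bc by simp
      finally show ?thesis .
    qed
    then show ?thesis using b R by blast
  qed
  have pow: "a ^\<^sub>m i \<in> ?R" if "a \<in> ?R" for a i
  proof (induction i)
    case 0
    then show ?case using one car[OF that] by auto
  qed (simp add: mult that)
  show ?thesis
  proof
    show "0 < n" by (rule n)
    show "?R \<subseteq> carrier_mat n n" using car by blast
    show "1\<^sub>m n \<in> ?R" by (rule one)
    show "- a \<in> ?R" if a: "a \<in> ?R" for a
    proof -
      have "gl_act m g (- a) = - a" if g: "g \<in> GL_mats m" for g :: "'k mat"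
      proof -
        interpret h: comm_ring_hom "gl_fract m g" by (rule gl_fract_hom[OF g])
        have "gl_act m g (- a) = - gl_act m g a"
          unfolding gl_act_def by (intro eq_matI) (auto simp: h.hom_uminus)
        then show ?thesis using a R g by auto
      qed
      then show ?thesis using a R UD.uminus_mem by blast
    qed
    show "a + b \<in> ?R" if "a \<in> ?R" "b \<in> ?R" for a b
      using that R UD.add_mem by (auto simp: gl_act_add[of _ m _ n])
    show "a * b \<in> ?R" if "a \<in> ?R" "b \<in> ?R" for a b using mult that by blast
    show "\<exists>b\<in>?R. a * b = 1\<^sub>m n \<and> b * a = 1\<^sub>m n" if "a \<in> ?R" "a \<noteq> 0\<^sub>m n n" for a
      using inverse that by blast
    then show "\<exists>b\<in>carrier_mat n n. a * b = 1\<^sub>m n \<and> b * a = 1\<^sub>m n" if "a \<in> ?R" "a \<noteq> 0\<^sub>m n n" for a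
      using car that by blast
    show "sandwich n u w r \<in> ?R" for r
      unfolding sandwich_def using uw by (intro mult pow)
    show "c r = 0" if "mat_sum n (\<lambda>r. c r \<cdot>\<^sub>m sandwich n u w r) {..<n * n} = 0\<^sub>m n n" "r < n * n" for c r
      using indep that by blast
  qed
qed

theorem theorem1p4:
  fixes m n :: nat
  assumes "2 \<le> m" and "m \<le> n\<^sup>2 - 2" and "n \<ge> 3"
  shows "division_algebra (base_scalars TYPE('k::field_char_0) n) (UD_fixed TYPE('k) m n) \<and>
    centrally_finite (UD_fixed TYPE('k) m n) \<and>
    division_degree (UD_fixed TYPE('k) m n) = real n"
proof -
  let ?R = "carrier (UD_fixed TYPE('k) m n)"
  have n: "0 < n" using assms by simp
  obtain u w :: "'k gpoly fract mat" where uw: "u \<in> ?R" "w \<in> ?R"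
    and indep: "\<forall>c. mat_sum n (\<lambda>r. c r \<cdot>\<^sub>m sandwich n u w r) {..<n * n} = 0\<^sub>m n n \<longrightarrow> (\<forall>r<n * n. c r = 0)"
    using ex_invariant_generators[OF assms] by blast
  interpret R: full_division n ?R "sandwich n u w"
    by (rule UD_fixed_full_division[OF assms(1) n uw]) (use indep in blast)
  interpret UD: full_division n "carrier (UD TYPE('k) m n)" "generic_basis n"
    by (rule UD_full_division[OF assms(1) n])
  have R_eq: "UD_fixed TYPE('k) m n = R.R" by (simp add: UD_fixed_def UD_def)
  let ?S = "range (\<lambda>c :: 'k. to_fract (gconst c))"
  have base: "base_scalars TYPE('k) n = (\<lambda>z. z \<cdot>\<^sub>m 1\<^sub>m n) ` ?S"
    by (auto simp: base_scalars_def)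
  have scalars: "?S \<subseteq> R.ratios"
  proof
    fix z assume "z \<in> ?S"
    then obtain c :: 'k where z: "z = to_fract (gconst c)" by blast
    have "z \<cdot>\<^sub>m 1\<^sub>m n \<in> carrier (UD TYPE('k) m n)"
      unfolding z by (rule scalar_in_UD[OF assms(1) n])
    moreover have "gl_act m g (z \<cdot>\<^sub>m 1\<^sub>m n) = z \<cdot>\<^sub>m 1\<^sub>m n" if "g \<in> GL_mats m" for g :: "'k mat"
      unfolding z using that by (rule gl_act_scalar[where n = n]) (simp add: base_scalars_def)
    ultimately have "z \<cdot>\<^sub>m 1\<^sub>m n \<in> ?R" by (simp add: UD_fixed_def)
    then show "z \<in> R.ratios" by (rule R.ratios_iff[THEN iffD2])
  qed
  have "division_algebra (base_scalars TYPE('k) n) R.R"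
    unfolding base
  proof (rule R.division_algebra_R[OF scalars])
    show "1 \<in> ?S" by (rule range_eqI[of _ _ 1]) simp
    fix y assume "y \<in> ?S"
    then obtain b :: 'k where y: "y = to_fract (gconst b)" by blast
    show "- y \<in> ?S"
    proof (rule range_eqI)
      have "to_fract (gconst (- b)) + y = to_fract (gconst (- b + b))"
        unfolding y by (simp only: gconst_simps to_fract_add)
      then show "- y = to_fract (gconst (- b))" by (simp add: eq_neg_iff_add_eq_0 neg_eq_iff_add_eq_0 add.commute)
    qed
    show "inverse y \<in> ?S"
    proof (cases "b = 0")
      case False
      have "y * to_fract (gconst (inverse b)) = to_fract (gconst (b * inverse b))"
        unfolding y by (simp only: gconst_simps to_fract_mult)
      then have "inverse y = to_fract (gconst (inverse b))" using False by (simp add: inverse_unique)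
      then show ?thesis by blast
    next
      case True
      then show ?thesis unfolding y by (intro range_eqI[of _ _ 0]) simp
    qed
    fix z assume "z \<in> ?S"
    then obtain c :: 'k where z: "z = to_fract (gconst c)" by blast
    show "y + z \<in> ?S" unfolding y z by (intro range_eqI[of _ _ "b + c"]) simp
    show "y * z \<in> ?S" unfolding y z by (intro range_eqI[of _ _ "b * c"]) simp
  qed
  then show ?thesis
    using R.centrally_finite_R R.division_degree_R by (simp only: R_eq[symmetric] simp_thms)
qed

end
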